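(* Fix $n\in\mathbb{N}$ and let $\operatorname{EVec}_n$ be the multivalued mapping assigning to each real symmetric $n\times n$ matrix $A$ the set of (nonzero) eigenvectors $\vec w\in\mathbb{R}^n$ of $A$. Then $$\mathfrak{C}_{\rm t}(\operatorname{EVec}_n)=\mathfrak{C}_{\rm c}(\operatorname{EVec}_n,\rho^{n(n+1)/2},\rho^n)=\lfloor\log_2 n\rfloor+1.$$
   Context: Real symmetric $n\times n$ matrices are identified with $\mathbb{R}^{n(n+1)/2}$ (upper triangular entries) with the Euclidean topology. $\rho$ is the Cauchy representation of $\mathbb{R}$ (names encode rationals $q_k$ with $|x-q_k|\le2^{-k}$), $\rho^k$ its componentwise extension. For a multivalued $f:\subseteq X\rightrightarrows Y$ (with $\operatorname{dom}(f)=\{x:f(x)\ne\emptyset\}$), $f$ is continuous at $x$ if there is $y\in f(x)$ such that for every open $V\ni y$ there is a neighbourhood $U$ of $x$ with $f(z)\cap V\neq\emptyset$ for all $z\in U\cap\operatorname{dom}(f)$; $f$ is continuous if continuous at every point of its domain. $\mathfrak{C}_{\rm t}(f)$ is the least cardinality of a partition $\Delta$ of $\operatorname{dom}(f)$ with $f|_D$ continuous for all $D\in\Delta$. $\mathfrak{C}_{\rm c}(f,\alpha,\beta)$ is the least cardinality $k$ of an (at most countable) partition $\Delta$ of $\operatorname{dom}(f)$ for which there is a notation $\delta$ of $\Delta$ and a Type-2 machine that, given an $\alpha$-name of $a$ and a $\delta$-name of the $D\in\Delta$ containing $a$, outputs a $\beta$-name of some element of $f(a)$. *)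

theory Defs
  imports
    "HOL-Analysis.Analysis"
    "HOL-Library.Disjoint_Sets"
    "HOL-Library.Extended_Nat"
    "Jordan_Normal_Form.Char_Poly"
begin

section \<open>Multivalued maps and their continuity\<close>

text \<open>A partial multivalued map is a set-valued function; a point lies outside the domain
  iff it is mapped to the empty set.\<close>

definition mv_dom :: "('a \<Rightarrow> 'b set) \<Rightarrow> 'a set" where
  "mv_dom f = {x. f x \<noteq> {}}"

definition mv_restrict :: "('a \<Rightarrow> 'b set) \<Rightarrow> 'a set \<Rightarrow> 'a \<Rightarrow> 'b set" where
  "mv_restrict f D = (\<lambda>x. if x \<in> D then f x else {})"

definition mv_continuous_at ::
  "'a topology \<Rightarrow> 'b topology \<Rightarrow> ('a \<Rightarrow> 'b set) \<Rightarrow> 'a \<Rightarrow> bool" where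
  "mv_continuous_at X Y f x \<longleftrightarrow>
     (\<exists>y\<in>f x. \<forall>V. openin Y V \<and> y \<in> V \<longrightarrow>
        (\<exists>U. openin X U \<and> x \<in> U \<and> (\<forall>z\<in>U \<inter> mv_dom f. f z \<inter> V \<noteq> {})))"

definition mv_continuous :: "'a topology \<Rightarrow> 'b topology \<Rightarrow> ('a \<Rightarrow> 'b set) \<Rightarrow> bool" where
  "mv_continuous X Y f \<longleftrightarrow> (\<forall>x\<in>mv_dom f. mv_continuous_at X Y f x)"

text \<open>Infinite cardinalities are all recorded as \<open>\<infinity>\<close>. Every set of extended naturals is
  well-ordered, so the infima below are least elements whenever an admissible partition exists.\<close>

definition ecard :: "'a set \<Rightarrow> enat" where
  "ecard S = (if finite S then enat (card S) else \<infinity>)"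

definition C_t :: "'a topology \<Rightarrow> 'b topology \<Rightarrow> ('a \<Rightarrow> 'b set) \<Rightarrow> enat" where
  "C_t X Y f =
     (INF \<Delta> \<in> {\<Delta>. partition_on (mv_dom f) \<Delta> \<and>
                    (\<forall>D\<in>\<Delta>. mv_continuous X Y (mv_restrict f D))}. ecard \<Delta>)"


section \<open>Type-2 machines\<close>

text \<open>
  Turing machines over the alphabet \<open>{0,1}\<close> (\<open>Some False\<close>, \<open>Some True\<close>) with blank \<open>None\<close>:
  finitely many one-way read-only input tapes, finitely many two-way work tapes and one
  one-way write-only output tape. The current state, the scanned input symbols and the scanned
  work symbols determine the new state, which input heads advance, the symbol written and the
  move made on each work tape, and optionally one symbol appended to the output.
\<close>

type_synonym symbol = "bool option"

datatype move = Move_Left | Stay | Move_Right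

record t2machine =
  num_states :: nat
  num_inputs :: nat
  num_works :: nat
  trans :: "nat \<Rightarrow> symbol list \<Rightarrow> symbol list \<Rightarrow>
              nat \<times> bool list \<times> (symbol \<times> move) list \<times> bool option"

text \<open>The states are \<open>{..<num_states M}\<close> with initial state \<open>0\<close>. Since \<open>symbol\<close> is a finite
  type, well-formedness makes the reachable part of \<open>trans\<close> a finite table.\<close>

definition t2_wf :: "t2machine \<Rightarrow> bool" where
  "t2_wf M \<longleftrightarrow> 0 < num_states M \<and>
     (\<forall>s us vs. s < num_states M \<and> length us = num_inputs M \<and> length vs = num_works M \<longrightarrow>
        (case trans M s us vs of (s', adv, acts, e) \<Rightarrow>
           s' < num_states M \<and> length adv = num_inputs M \<and> length acts = num_works M))"

record t2config =
  state :: nat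
  in_pos :: "nat list"
  work :: "((int \<Rightarrow> symbol) \<times> int) list"
  written :: "bool list"

definition t2_init :: "t2machine \<Rightarrow> t2config" where
  "t2_init M = \<lparr>state = 0, in_pos = replicate (num_inputs M) 0,
     work = replicate (num_works M) (\<lambda>_. None, 0), written = []\<rparr>"

fun move_head :: "move \<Rightarrow> int \<Rightarrow> int" where
  "move_head Move_Left h = h - 1"
| "move_head Stay h = h"
| "move_head Move_Right h = h + 1"

definition t2_step :: "t2machine \<Rightarrow> (nat \<Rightarrow> symbol) list \<Rightarrow> t2config \<Rightarrow> t2config" where
  "t2_step M xs c =
     (case trans M (state c) (map2 (\<lambda>x i. x i) xs (in_pos c)) (map (\<lambda>(t, h). t h) (work c)) of
        (s', adv, acts, e) \<Rightarrow>
          \<lparr>state = s',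
           in_pos = map2 (\<lambda>i b. if b then Suc i else i) (in_pos c) adv,
           work = map2 (\<lambda>(t, h) (a, d). (t(h := a), move_head d h)) (work c) acts,
           written = written c @ (case e of None \<Rightarrow> [] | Some b \<Rightarrow> [b])\<rparr>)"

definition t2_run :: "t2machine \<Rightarrow> (nat \<Rightarrow> symbol) list \<Rightarrow> nat \<Rightarrow> t2config" where
  "t2_run M xs t = (t2_step M xs ^^ t) (t2_init M)"

text \<open>The input tapes hold finite words (followed by blanks) or infinite words.\<close>

definition word_tape :: "bool list \<Rightarrow> nat \<Rightarrow> symbol" where
  "word_tape w i = (if i < length w then Some (w ! i) else None)"

definition omega_tape :: "(nat \<Rightarrow> bool) \<Rightarrow> nat \<Rightarrow> symbol" where
  "omega_tape p i = Some (p i)"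

definition t2_outputs :: "t2machine \<Rightarrow> (nat \<Rightarrow> symbol) list \<Rightarrow> (nat \<Rightarrow> bool) \<Rightarrow> bool" where
  "t2_outputs M xs q \<longleftrightarrow> length xs = num_inputs M \<and>
     (\<forall>i. \<exists>t. i < length (written (t2_run M xs t)) \<and> written (t2_run M xs t) ! i = q i)"


section \<open>Computability with discrete advice\<close>

text \<open>A representation of \<open>'a\<close> is given by its name relation: \<open>\<alpha> p x\<close> means that \<open>p\<close> is an
  \<open>\<alpha>\<close>-name of \<open>x\<close>. A notation \<open>\<delta>\<close> of \<open>\<Delta>\<close> is a partial surjection from finite words to \<open>\<Delta>\<close>.\<close>

type_synonym 'a rep = "(nat \<Rightarrow> bool) \<Rightarrow> 'a \<Rightarrow> bool"

definition notation_of :: "(bool list \<rightharpoonup> 'a) \<Rightarrow> 'a set \<Rightarrow> bool" where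
  "notation_of \<delta> \<Delta> \<longleftrightarrow> ran \<delta> = \<Delta>"

definition computable_with_advice ::
  "('a \<Rightarrow> 'b set) \<Rightarrow> 'a rep \<Rightarrow> 'b rep \<Rightarrow> 'a set set \<Rightarrow> bool" where
  "computable_with_advice f \<alpha> \<beta> \<Delta> \<longleftrightarrow>
     (\<exists>\<delta> M. notation_of \<delta> \<Delta> \<and> t2_wf M \<and>
        (\<forall>D\<in>\<Delta>. \<forall>a\<in>D. \<forall>p w. \<alpha> p a \<and> \<delta> w = Some D \<longrightarrow>
           (\<exists>q. t2_outputs M [omega_tape p, word_tape w] q \<and> (\<exists>b\<in>f a. \<beta> q b))))"

definition C_c :: "('a \<Rightarrow> 'b set) \<Rightarrow> 'a rep \<Rightarrow> 'b rep \<Rightarrow> enat" where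
  "C_c f \<alpha> \<beta> =
     (INF \<Delta> \<in> {\<Delta>. partition_on (mv_dom f) \<Delta> \<and> countable \<Delta> \<and>
                    computable_with_advice f \<alpha> \<beta> \<Delta>}. ecard \<Delta>)"


section \<open>The Cauchy representation\<close>

text \<open>\<open>encodes p u\<close>: the infinite word \<open>p\<close> is \<open>1^(u 0) 0 1^(u 1) 0 1^(u 2) 0 \<dots>\<close>.\<close>

definition encodes :: "(nat \<Rightarrow> bool) \<Rightarrow> (nat \<Rightarrow> nat) \<Rightarrow> bool" where
  "encodes p u \<longleftrightarrow>
     (\<forall>m. let w = concat (map (\<lambda>i. replicate (u i) True @ [False]) [0..<m])
          in map p [0..<length w] = w)"

text \<open>Three consecutive numbers \<open>a\<close>, \<open>b\<close>, \<open>c\<close> denote the rational \<open>(a - b) / (c + 1)\<close>.\<close>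

definition rat_at :: "(nat \<Rightarrow> nat) \<Rightarrow> nat \<Rightarrow> rat" where
  "rat_at u k = (of_nat (u (3 * k)) - of_nat (u (3 * k + 1))) / (of_nat (u (3 * k + 2)) + 1)"

definition cauchy_rep :: "real rep" where
  "cauchy_rep p x \<longleftrightarrow>
     (\<exists>u. encodes p u \<and> (\<forall>k. \<bar>x - of_rat (rat_at u k)\<bar> \<le> 1 / 2 ^ k))"

text \<open>Names of the components are interleaved symbol by symbol. Points of
  \<^term>\<open>Euclidean_space d\<close> are sequences vanishing from index \<open>d\<close> on.\<close>

definition cauchy_rep_pow :: "nat \<Rightarrow> (nat \<Rightarrow> real) rep" where
  "cauchy_rep_pow d p x \<longleftrightarrow> x \<in> topspace (Euclidean_space d) \<and>
     (\<forall>i<d. cauchy_rep (\<lambda>k. p (d * k + i)) (x i))"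


section \<open>Eigenvectors of symmetric matrices\<close>

text \<open>The entries \<open>(i, j)\<close> with \<open>i \<le> j < n\<close> of the upper triangle are listed column by column
  and thus numbered by \<open>{..<n * (n + 1) div 2}\<close>.\<close>

definition upper_index :: "nat \<Rightarrow> nat \<Rightarrow> nat" where
  "upper_index i j = j * (j + 1) div 2 + i"

definition sym_mat :: "nat \<Rightarrow> (nat \<Rightarrow> real) \<Rightarrow> real Matrix.mat" where
  "sym_mat n a = Matrix.mat n n (\<lambda>(i, j). a (upper_index (min i j) (max i j)))"

definition EVec :: "nat \<Rightarrow> (nat \<Rightarrow> real) \<Rightarrow> (nat \<Rightarrow> real) set" where
  "EVec n a =
     (if a \<in> topspace (Euclidean_space (n * (n + 1) div 2))
      then {w \<in> topspace (Euclidean_space n). \<exists>l. eigenvector (sym_mat n a) (Matrix.vec n w) l}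
      else {})"

end

theory Submission
  imports Defs
begin

text \<open>
  All multiplicities are counted in an orthonormal eigenbasis. For the lower bound, splitting every
  eigenspace along a direction transversal to a given eigenvector destroys that eigenvector, so a
  matrix with all multiplicities at least \<open>2 ^ m\<close> has at least \<open>m + 1\<close> pieces in each of its
  neighbourhoods. A machine reads finite prefixes only, whence \<open>C_t \<le> C_c\<close>. For the upper bound, the
  advice is the integer part \<open>j\<close> of the binary logarithm of the least multiplicity. Any group of fewer
  than \<open>2 ^ (j + 1)\<close> eigenvalues that is separated from the rest then consists of a single eigenvalue.
  So once such a group has been certified, every sufficiently good approximate eigenvector \<open>v\<close> of the
  group is close to a true one, and a search for a better approximation near \<open>v\<close> cannot fail: the
  machine never has to revise its output.
\<close>

section \<open>Symmetric matrices in coordinates\<close>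

text \<open>The logarithm comes from halving: splitting eigenspaces of dimension at least
  \<open>2 ^ (m + 1)\<close> leaves parts of dimension at least \<open>2 ^ m\<close>, so the zero
  matrix admits as many successive splittings as 2 divides into \<open>n\<close> by halving. The
  obstacle on the other side is that a machine sees a real only through finite prefixes and never
  retracts a symbol, so it can neither decide which eigenvalues coincide nor find their
  multiplicities. Hence every test must be confirmed by finitely many input symbols, while exact
  data must pass it with room to spare, so that some rational candidate near them is accepted. This
  is why \<open>accept\<close> consists of inequalities between rational expressions with explicit
  error terms. The advice is given in unary, as the largest admissible group size, and is read one
  symbol per round; a bound that is still too small only strengthens what a certificate proves, so
  starting early is safe. Computability is shown for an actual machine: an arithmetic program is
  compiled to counter loops, these to jumps, and these to a transition table.\<close>

definition ip :: "nat \<Rightarrow> (nat \<Rightarrow> real) \<Rightarrow> (nat \<Rightarrow> real) \<Rightarrow> real" where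
  "ip n x y = (\<Sum>i<n. x i * y i)"

definition mv :: "nat \<Rightarrow> (nat \<Rightarrow> nat \<Rightarrow> real) \<Rightarrow> (nat \<Rightarrow> real) \<Rightarrow> nat \<Rightarrow> real" where
  "mv n M x i = (\<Sum>j<n. M i j * x j)"

lemma ip_commute: "ip n x y = ip n y x"
  by (simp add: ip_def mult.commute)

lemma ip_cong: "(\<And>i. i < n \<Longrightarrow> x i = x' i) \<Longrightarrow> (\<And>i. i < n \<Longrightarrow> y i = y' i) \<Longrightarrow> ip n x y = ip n x' y'"
  unfolding ip_def by (intro sum.cong) auto

lemma ip_add_right: "ip n x (\<lambda>i. y i + z i) = ip n x y + ip n x z"
  by (simp add: ip_def algebra_simps sum.distrib)

lemma ip_diff_right: "ip n x (\<lambda>i. y i - z i) = ip n x y - ip n x z"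
  by (simp add: ip_def algebra_simps sum_subtractf)

lemma ip_scale_right: "ip n x (\<lambda>i. c * y i) = c * ip n x y"
  by (simp add: ip_def sum_distrib_left algebra_simps)

lemma ip_add_left: "ip n (\<lambda>i. y i + z i) x = ip n y x + ip n z x"
  by (simp add: ip_def algebra_simps sum.distrib)

lemma ip_diff_left: "ip n (\<lambda>i. y i - z i) x = ip n y x - ip n z x"
  by (simp add: ip_def algebra_simps sum_subtractf)

lemma ip_scale_left: "ip n (\<lambda>i. c * y i) x = c * ip n y x"
  by (simp add: ip_def sum_distrib_left algebra_simps)

lemma ip_sum_right: "ip n x (\<lambda>i. \<Sum>r\<in>S. f r i) = (\<Sum>r\<in>S. ip n x (f r))"
  unfolding ip_def by (simp add: sum_distrib_left) (rule sum.swap)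

lemma ip_self_nonneg: "0 \<le> ip n x x"
  by (simp add: ip_def sum_nonneg)

lemma ip_self_eq_0: "ip n x x = 0 \<Longrightarrow> i < n \<Longrightarrow> x i = 0"
  unfolding ip_def by (subst (asm) sum_nonneg_eq_0_iff) auto

lemma ip_self_pos: "i < n \<Longrightarrow> x i \<noteq> 0 \<Longrightarrow> 0 < ip n x x"
  using ip_self_nonneg[of n x] ip_self_eq_0[of n x i] by force

lemma sq_le_ip_self: "i < n \<Longrightarrow> (x i)\<^sup>2 \<le> ip n x x"
  unfolding ip_def power2_eq_square by (rule member_le_sum) auto

lemmas ip_simps = ip_add_right ip_diff_right ip_scale_right ip_add_left ip_diff_left ip_scale_left

lemma ip_mv_sym:
  assumes "\<forall>i<n. \<forall>j<n. M i j = M j i"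
  shows "ip n x (mv n M y) = ip n (mv n M x) y"
proof -
  have "ip n x (mv n M y) = (\<Sum>i<n. \<Sum>j<n. x i * M i j * y j)"
    by (simp add: ip_def mv_def sum_distrib_left mult.assoc)
  also have "\<dots> = (\<Sum>j<n. \<Sum>i<n. M j i * x i * y j)"
    using assms by (subst sum.swap) (intro sum.cong refl, auto simp: mult.commute)
  also have "\<dots> = ip n (mv n M x) y"
    by (simp add: ip_def mv_def sum_distrib_right)
  finally show ?thesis .
qed

lemma mv_add: "mv n M (\<lambda>j. x j + y j) i = mv n M x i + mv n M y i"
  by (simp add: mv_def algebra_simps sum.distrib)

lemma mv_scale: "mv n M (\<lambda>j. c * x j) i = c * mv n M x i"
  by (simp add: mv_def algebra_simps sum_distrib_left)

lemma mv_sum: "mv n M (\<lambda>j. \<Sum>r\<in>S. f r j) i = (\<Sum>r\<in>S. mv n M (f r) i)"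
  unfolding mv_def by (simp add: sum_distrib_left) (rule sum.swap)

lemma mv_cong: "(\<And>j. j < n \<Longrightarrow> x j = y j) \<Longrightarrow> mv n M x i = mv n M y i"
  unfolding mv_def by (intro sum.cong) auto

text \<open>Zero rows pad the \<open>m\<close> equations to a square matrix. It is singular because
  its transpose kills the unit vector of the first padded row.\<close>

lemma homogeneous_system:
  fixes c :: "nat \<Rightarrow> nat \<Rightarrow> real"
  assumes "m < n"
  shows "\<exists>x. (\<exists>i<n. x i \<noteq> 0) \<and> (\<forall>r<m. ip n (c r) x = 0)"
proof -
  define A where "A = Matrix.mat n n (\<lambda>(r, i). if r < m then c r i else 0)"
  have A: "A \<in> carrier_mat n n" by (simp add: A_def)
  have "transpose_mat A *\<^sub>v unit_vec n m = 0\<^sub>v n"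
    using assms by (intro eq_vecI) (auto simp: A_def scalar_prod_def unit_vec_def intro!: sum.neutral)
  moreover have "unit_vec n m \<noteq> (0\<^sub>v n :: real Matrix.vec)"
    using assms by (metis index_unit_vec(1) index_zero_vec(1) zero_neq_one)
  ultimately have "Determinant.det (transpose_mat A) = 0"
    using A by (auto simp: det_0_iff_vec_prod_zero_field[of _ n] intro!: exI[of _ "unit_vec n m"])
  then have "Determinant.det A = 0" using A by (simp add: det_transpose)
  then obtain v where v: "v \<in> carrier_vec n" "v \<noteq> 0\<^sub>v n" "A *\<^sub>v v = 0\<^sub>v n"
    using A by (auto simp: det_0_iff_vec_prod_zero_field)
  from v(1,2) obtain i where "i < n" "vec_index v i \<noteq> 0"
    by (metis carrier_vecD eq_vecI index_zero_vec(1) index_zero_vec(2))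
  moreover have "ip n (c r) (vec_index v) = 0" if "r < m" for r
  proof -
    have "vec_index (A *\<^sub>v v) r = 0" using v(3) assms that by simp
    then show ?thesis
      using assms that v(1) by (simp add: A_def scalar_prod_def ip_def atLeast0LessThan)
  qed
  ultimately show ?thesis by blast
qed

section \<open>Orthonormal bases and coordinates in them\<close>

definition onb :: "nat \<Rightarrow> (nat \<Rightarrow> nat \<Rightarrow> real) \<Rightarrow> bool" where
  "onb n b \<longleftrightarrow> (\<forall>i<n. \<forall>j<n. ip n (b i) (b j) = (if i = j then 1 else 0)) \<and>
     (\<forall>k<n. \<forall>l<n. (\<Sum>i<n. b i k * b i l) = (if k = l then 1 else 0))"

lemma onb_ip: "onb n b \<Longrightarrow> i < n \<Longrightarrow> j < n \<Longrightarrow> ip n (b i) (b j) = (if i = j then 1 else 0)"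
  by (simp add: onb_def)

lemma onb_complete:
  "onb n b \<Longrightarrow> k < n \<Longrightarrow> l < n \<Longrightarrow> (\<Sum>i<n. b i k * b i l) = (if k = l then 1 else 0)"
  by (simp add: onb_def)

lemma onb_expand:
  assumes "onb n b" "k < n"
  shows "x k = (\<Sum>i<n. ip n (b i) x * b i k)"
proof -
  have "(\<Sum>i<n. ip n (b i) x * b i k) = (\<Sum>i<n. \<Sum>l<n. (b i l * b i k) * x l)"
    by (simp add: ip_def sum_distrib_left sum_distrib_right mult_ac)
  also have "\<dots> = (\<Sum>l<n. (\<Sum>i<n. b i l * b i k) * x l)"
    by (subst sum.swap) (simp add: sum_distrib_right)
  also have "\<dots> = (\<Sum>l<n. if l = k then x l else 0)"
    using assms by (intro sum.cong) (auto simp: onb_complete)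
  also have "\<dots> = x k" using assms by simp
  finally show ?thesis by simp
qed

lemma onb_parseval:
  assumes "onb n b"
  shows "ip n x x = (\<Sum>i<n. (ip n (b i) x)\<^sup>2)"
proof -
  have "ip n x x = ip n x (\<lambda>k. \<Sum>i<n. ip n (b i) x * b i k)"
    using onb_expand[OF assms, of _ x] by (intro ip_cong) auto
  also have "\<dots> = (\<Sum>i<n. (ip n (b i) x)\<^sup>2)"
    by (simp add: ip_sum_right ip_scale_right power2_eq_square ip_commute[of n x])
  finally show ?thesis .
qed

text \<open>For a square matrix a right inverse is also a left inverse, so orthonormal rows give
  orthonormal columns, which is the completeness relation in \<open>onb\<close>.\<close>

lemma orthonormal_imp_onb:
  assumes "\<forall>i<n. \<forall>j<n. ip n (b i) (b j) = (if i = j then 1 else 0)"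
  shows "onb n b"
proof -
  define B where "B = Matrix.mat n n (\<lambda>(i, k). b i k)"
  have B: "B \<in> carrier_mat n n" by (simp add: B_def)
  have "B * transpose_mat B = 1\<^sub>m n"
    using assms by (intro eq_matI) (auto simp: B_def scalar_prod_def ip_def atLeast0LessThan)
  then have *: "transpose_mat B * B = 1\<^sub>m n"
    using B by (metis mat_mult_left_right_inverse transpose_carrier_mat)
  have "(\<Sum>i<n. b i k * b i l) = (if k = l then 1 else 0)" if "k < n" "l < n" for k l
    using arg_cong[OF *, of "\<lambda>X. X $$ (k, l)"] that
    by (simp add: B_def scalar_prod_def atLeast0LessThan)
  then show ?thesis using assms by (simp add: onb_def)
qed

section \<open>The spectral theorem by maximising the Rayleigh quotient\<close>

lemma linear_coeff_zero:
  fixes \<alpha> \<beta> :: real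
  assumes "\<And>t. 2 * t * \<alpha> \<le> t\<^sup>2 * \<beta>"
  shows "\<alpha> = 0"
proof (rule ccontr)
  assume "\<alpha> \<noteq> 0"
  \<comment> \<open>A positive majorant of \<beta>. The choice \<open>t = \<alpha> / c\<close> turns
    the assumption into \<open>2 * t * \<alpha> \<le> t * \<alpha>\<close>, although
    \<open>t * \<alpha>\<close> is positive.\<close>
  define c where "c = \<bar>\<beta>\<bar> + 1"
  define t where "t = \<alpha> / c"
  have pos: "c > 0" by (simp add: c_def)
  have "2 * t * \<alpha> \<le> t\<^sup>2 * c"
    using assms[of t] unfolding c_def by (smt (verit) mult_left_mono zero_le_power2)
  also have "\<dots> = t * \<alpha>" using pos by (simp add: t_def power2_eq_square)
  finally have "t * \<alpha> \<le> 0" by (simp add: mult.commute)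
  moreover have "t * \<alpha> > 0" using \<open>\<alpha> \<noteq> 0\<close> pos by (simp add: t_def zero_less_mult_iff zero_less_divide_iff) (metis linorder_neqE_linordered_idom)
  ultimately show False by simp
qed

text \<open>Vectors are sequences in the product topology. Pinning the coordinates from
  \<open>n\<close> on to 0 gives a product of compact sets, so Tychonoff applies; the unit vectors
  considered below form a closed part of this cube.\<close>

lemma compact_coordinate_cube:
  "compact {x :: nat \<Rightarrow> real. \<forall>i. x i \<in> (if i < n then {-1..1} else {0})}"
proof -
  have "compactin (product_topology (\<lambda>_::nat. euclideanreal) UNIV)
          (PiE UNIV (\<lambda>i. if i < n then {-1..1} else {0::real}))"
    by (subst compactin_PiE) auto
  then show ?thesis
    by (simp add: euclidean_product_topology PiE_def Pi_def)
qed

lemma continuous_on_ip [continuous_intros]: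
  fixes f g :: "'a::topological_space \<Rightarrow> nat \<Rightarrow> real"
  shows "(\<And>i. continuous_on S (\<lambda>x. f x i)) \<Longrightarrow> (\<And>i. continuous_on S (\<lambda>x. g x i)) \<Longrightarrow>
    continuous_on S (\<lambda>x. ip n (f x) (g x))"
  unfolding ip_def by (intro continuous_intros)

lemma continuous_on_coord [continuous_intros]: "continuous_on S (\<lambda>x :: nat \<Rightarrow> real. x i)"
  by (metis continuous_on_product_coordinates continuous_on_subset top_greatest)

text \<open>The next eigenvector maximises the Rayleigh quotient on the orthogonal complement of the
  previous ones.\<close>

lemma orthonormal_eigenvectors:
  assumes sym: "\<forall>i<n. \<forall>j<n. M i j = M j i" and "m \<le> n"
  shows "\<exists>b lam. (\<forall>i<m. \<forall>j<m. ip n (b i) (b j) = (if i = j then 1 else 0)) \<and>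
    (\<forall>i<m. \<forall>k<n. mv n M (b i) k = lam i * b i k)"
  using \<open>m \<le> n\<close>
proof (induction m)
  case 0
  then show ?case by simp
next
  case (Suc m)
  then obtain b lam where
    on: "\<forall>i<m. \<forall>j<m. ip n (b i) (b j) = (if i = j then 1 else 0)" and
    eig: "\<forall>i<m. \<forall>k<n. mv n M (b i) k = lam i * b i k" by auto
  define S where "S = {x :: nat \<Rightarrow> real. \<forall>i. x i \<in> (if i < n then {-1..1} else {0})} \<inter>
     {x. ip n x x = 1} \<inter> (\<Inter>r\<in>{..<m}. {x. ip n (b r) x = 0})"
  define q where "q x = ip n x (mv n M x)" for x
  have compS: "compact S" unfolding S_def
    by (intro compact_Int_closed compact_coordinate_cube closed_INT ballI closed_Collect_eq
        continuous_intros)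
  have norm1: "\<exists>c\<noteq>0. (\<lambda>i. if i < n then c * x i else 0) \<in> S"
    if x: "\<exists>i<n. x i \<noteq> 0" "\<And>r. r < m \<Longrightarrow> ip n (b r) x = 0" for x
  proof -
    from x(1) obtain i where "i < n" "x i \<noteq> 0" by blast
    then have pos: "ip n x x > 0" by (rule ip_self_pos)
    define c where "c = 1 / sqrt (ip n x x)"
    define z where "z = (\<lambda>i. if i < n then c * x i else 0)"
    have "ip n z z = ip n (\<lambda>i. c * x i) (\<lambda>i. c * x i)" by (intro ip_cong) (auto simp: z_def)
    also have "\<dots> = c\<^sup>2 * ip n x x" by (simp add: ip_simps power2_eq_square)
    also have "\<dots> = 1" using pos by (simp add: c_def power_divide)
    finally have "ip n z z = 1" .
    moreover have "z i \<in> {-1..1}" if "i < n" for i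
      using sq_le_ip_self[OF that, of z] \<open>ip n z z = 1\<close> by (simp add: abs_square_le_1 abs_le_iff)
    moreover have "ip n (b r) z = 0" if "r < m" for r
    proof -
      have "ip n (b r) z = ip n (b r) (\<lambda>i. c * x i)" by (intro ip_cong) (auto simp: z_def)
      then show ?thesis using x(2)[OF that] by (simp add: ip_simps)
    qed
    ultimately have "z \<in> S" by (simp add: S_def) (simp add: z_def)
    then show ?thesis using pos unfolding z_def by (intro exI[of _ c]) (auto simp: c_def)
  qed
  obtain x0 where "\<exists>i<n. x0 i \<noteq> 0" "\<And>r. r < m \<Longrightarrow> ip n (b r) x0 = 0"
    using homogeneous_system[of m n b] Suc.prems by auto
  then have neS: "S \<noteq> {}" using norm1[of x0] by blast
  have contq: "continuous_on S q"
    unfolding q_def mv_def by (intro continuous_intros)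
  obtain x where x: "x \<in> S" and max: "\<And>y. y \<in> S \<Longrightarrow> q y \<le> q x"
    using continuous_attains_sup[OF compS neS contq] by blast
  have xx: "ip n x x = 1" and xb: "\<And>r. r < m \<Longrightarrow> ip n (b r) x = 0" using x by (simp_all only: S_def Int_iff INT_iff mem_Collect_eq lessThan_iff)
  \<comment> \<open>By homogeneity the maximum over unit vectors bounds \<open>q\<close> on the
    whole orthogonal complement.\<close>
  have rayleigh: "q z \<le> q x * ip n z z" if zb: "\<And>r. r < m \<Longrightarrow> ip n (b r) z = 0" for z
  proof (cases "\<exists>i<n. z i \<noteq> 0")
    case True
    then obtain c where c: "c \<noteq> 0" "(\<lambda>i. if i < n then c * z i else 0) \<in> S"
      using norm1[OF True zb] by blast
    define y where "y = (\<lambda>i. if i < n then c * z i else 0)"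
    have yc: "\<And>i. i < n \<Longrightarrow> y i = c * z i" by (simp add: y_def)
    have "mv n M y i = c * mv n M z i" for i
      using yc by (subst mv_scale[symmetric]) (rule mv_cong)
    then have "q y = ip n (\<lambda>i. c * z i) (\<lambda>i. c * mv n M z i)"
      unfolding q_def using yc by (intro ip_cong) auto
    then have "q y = c\<^sup>2 * q z" by (simp add: ip_simps q_def power2_eq_square)
    moreover have "ip n y y = c\<^sup>2 * ip n z z"
      using ip_cong[of n y "\<lambda>i. c * z i" y "\<lambda>i. c * z i"] yc by (simp add: ip_simps power2_eq_square)
    moreover have "ip n y y = 1" using c(2) by (simp only: S_def y_def Int_iff mem_Collect_eq)
    moreover have "q y \<le> q x" using max c(2) by (simp add: y_def)
    ultimately have "c\<^sup>2 * q z \<le> c\<^sup>2 * (q x * ip n z z)" by (simp add: mult.left_commute)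
    then show ?thesis using c(1) by simp
  next
    case False
    then have "q z = 0" "ip n z z = 0" by (auto simp: q_def ip_def)
    then show ?thesis by simp
  qed
  have ortho: "ip n y (mv n M x) = q x * ip n y x" if y: "\<And>r. r < m \<Longrightarrow> ip n (b r) y = 0" for y
  proof -
    \<comment> \<open>The Rayleigh bound at \<open>x + t * y\<close>. The terms of order 0 cancel,
      and a linear term dominated by a quadratic one for all \<open>t\<close> has coefficient
      0.\<close>
    have "2 * t * (ip n y (mv n M x) - q x * ip n y x) \<le> t\<^sup>2 * (q x * ip n y y - q y)" for t
    proof -
      define z where "z = (\<lambda>i. x i + t * y i)"
      have sy: "ip n x (mv n M y) = ip n y (mv n M x)"
        using ip_mv_sym[OF sym, of x y] by (simp add: ip_commute)
      have "mv n M z = (\<lambda>i. mv n M x i + t * mv n M y i)"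
        by (auto simp: z_def mv_add mv_scale)
      then have "q z = q x + 2 * t * ip n y (mv n M x) + t\<^sup>2 * q y"
        by (simp add: q_def z_def ip_simps sy algebra_simps power2_eq_square)
      moreover have "ip n z z = 1 + 2 * t * ip n y x + t\<^sup>2 * ip n y y"
        by (simp add: z_def ip_simps xx ip_commute[of n x y] algebra_simps power2_eq_square)
      moreover have "q z \<le> q x * ip n z z"
        by (rule rayleigh) (simp add: z_def ip_simps xb y)
      ultimately show ?thesis by (simp add: algebra_simps)
    qed
    then show ?thesis using linear_coeff_zero by fastforce
  qed
  define r where "r = (\<lambda>i. mv n M x i - q x * x i)"
  have rb: "ip n (b s) r = 0" if "s < m" for s
  proof -
    have "ip n (b s) (mv n M x) = ip n (mv n M (b s)) x" by (rule ip_mv_sym[OF sym])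
    also have "\<dots> = ip n (\<lambda>k. lam s * b s k) x" by (intro ip_cong) (auto simp: eig that)
    also have "\<dots> = 0" using xb that by (simp add: ip_simps)
    finally show ?thesis using xb that by (simp add: r_def ip_simps)
  qed
  \<comment> \<open>The residual is itself an admissible test direction, so \<open>ortho\<close>
    applies to it.\<close>
  have "ip n r r = 0" using ortho[OF rb] by (subst (2) r_def) (simp add: ip_simps)
  then have eigx: "mv n M x k = q x * x k" if "k < n" for k
    using ip_self_eq_0[of n r k] that by (simp add: r_def)
  show ?case
  proof (intro exI conjI allI impI)
    fix i j assume "i < Suc m" "j < Suc m"
    then show "ip n ((b(m := x)) i) ((b(m := x)) j) = (if i = j then 1 else 0)"
      using on xb xx ip_commute[of n x "b i"] ip_commute[of n x "b j"] by (auto simp: less_Suc_eq)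
  next
    fix i k assume "i < Suc m" "k < n"
    then show "mv n M ((b(m := x)) i) k = (lam(m := q x)) i * (b(m := x)) i k"
      using eig eigx by (auto simp: less_Suc_eq)
  qed
qed

definition eigenbasis :: "nat \<Rightarrow> (nat \<Rightarrow> nat \<Rightarrow> real) \<Rightarrow> (nat \<Rightarrow> nat \<Rightarrow> real) \<Rightarrow> (nat \<Rightarrow> real) \<Rightarrow> bool" where
  "eigenbasis n M b lam \<longleftrightarrow> onb n b \<and> (\<forall>i<n. \<forall>k<n. mv n M (b i) k = lam i * b i k)"

theorem spectral_theorem:
  assumes "\<forall>i<n. \<forall>j<n. M i j = M j i"
  shows "\<exists>b lam. eigenbasis n M b lam"
  using orthonormal_eigenvectors[OF assms order.refl] orthonormal_imp_onb
  unfolding eigenbasis_def by metis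

lemma eigenbasis_ip_mv:
  assumes e: "eigenbasis n M b lam" and sym: "\<forall>i<n. \<forall>j<n. M i j = M j i" and "i < n"
  shows "ip n (b i) (mv n M x) = lam i * ip n (b i) x"
proof -
  have "ip n (b i) (mv n M x) = ip n (mv n M (b i)) x" by (rule ip_mv_sym[OF sym])
  also have "\<dots> = ip n (\<lambda>k. lam i * b i k) x"
    using e \<open>i < n\<close> by (intro ip_cong) (auto simp: eigenbasis_def)
  finally show ?thesis by (simp add: ip_simps)
qed

section \<open>Symmetric matrices as points of Euclidean space\<close>

definition smat :: "(nat \<Rightarrow> real) \<Rightarrow> nat \<Rightarrow> nat \<Rightarrow> real" where
  "smat a i j = a (upper_index (min i j) (max i j))"

text \<open>Listing the upper triangle column by column is the Cantor pairing of the row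
  \<open>i\<close> with the offset \<open>j - i\<close> from the diagonal, so
  \<open>prod_decode\<close> inverts the numbering.\<close>

definition of_smat :: "nat \<Rightarrow> (nat \<Rightarrow> nat \<Rightarrow> real) \<Rightarrow> nat \<Rightarrow> real" where
  "of_smat n M k = (if k < n * (n + 1) div 2 then case prod_decode k of (i, r) \<Rightarrow> M i (i + r) else 0)"

lemma smat_sym: "smat a i j = smat a j i"
  by (simp add: smat_def min.commute max.commute)

lemma upper_index_eq: "i \<le> j \<Longrightarrow> upper_index i j = prod_encode (i, j - i)"
  by (simp add: upper_index_def prod_encode_def triangle_def)

lemma triangle_mono: "i \<le> j \<Longrightarrow> triangle i \<le> triangle j"
  by (induction j rule: dec_induct) auto

lemma upper_index_less:
  assumes "i \<le> j" "j < n"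
  shows "upper_index i j < n * (n + 1) div 2"
proof -
  have "upper_index i j < triangle (Suc j)"
    using assms(1) by (simp add: upper_index_def triangle_def)
  also have "\<dots> \<le> triangle n" using assms(2) by (intro triangle_mono) simp
  finally show ?thesis by (simp add: triangle_def)
qed

lemma smat_of_smat:
  assumes "\<And>i j. M i j = M j i" "i < n" "j < n"
  shows "smat (of_smat n M) i j = M i j"
proof -
  have "smat (of_smat n M) i j = M (min i j) (max i j)"
    using upper_index_less[of "min i j" "max i j" n] assms(2,3)
    by (simp add: smat_def of_smat_def) (simp add: upper_index_eq)
  then show ?thesis using assms(1) by (simp add: min_def max_def)
qed

lemma topspace_Euclidean_space_iff:
  "x \<in> topspace (Euclidean_space d) \<longleftrightarrow> (\<forall>k\<ge>d. x k = 0)"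
  by (simp add: topspace_Euclidean_space)

lemma of_smat_topspace: "of_smat n M \<in> topspace (Euclidean_space (n * (n + 1) div 2))"
  by (simp add: topspace_Euclidean_space_iff of_smat_def)

lemma EVec_iff:
  assumes "a \<in> topspace (Euclidean_space (n * (n + 1) div 2))"
  shows "w \<in> EVec n a \<longleftrightarrow> w \<in> topspace (Euclidean_space n) \<and> (\<exists>i<n. w i \<noteq> 0) \<and>
    (\<exists>l. \<forall>i<n. mv n (smat a) w i = l * w i)"
proof -
  have "(Matrix.vec n w \<noteq> 0\<^sub>v n) \<longleftrightarrow> (\<exists>i<n. w i \<noteq> 0)"
    by (auto simp: vec_eq_iff)
  moreover have "(sym_mat n a *\<^sub>v Matrix.vec n w = l \<cdot>\<^sub>v Matrix.vec n w) \<longleftrightarrow>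
     (\<forall>i<n. mv n (smat a) w i = l * w i)" for l
    by (auto simp: vec_eq_iff sym_mat_def scalar_prod_def mv_def smat_def atLeast0LessThan)
  moreover have "dim_row (sym_mat n a) = n" by (simp add: sym_mat_def)
  ultimately have "eigenvector (sym_mat n a) (Matrix.vec n w) l \<longleftrightarrow>
     (\<exists>i<n. w i \<noteq> 0) \<and> (\<forall>i<n. mv n (smat a) w i = l * w i)" for l
    by (simp add: eigenvector_def)
  then show ?thesis
    using assms unfolding EVec_def by auto
qed

lemma EVec_outside: "a \<notin> topspace (Euclidean_space (n * (n + 1) div 2)) \<Longrightarrow> EVec n a = {}"
  by (simp add: EVec_def)

lemma mv_dom_EVec:
  assumes "n \<ge> 1"
  shows "mv_dom (EVec n) = topspace (Euclidean_space (n * (n + 1) div 2))"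
proof -
  have "EVec n a \<noteq> {}" if a: "a \<in> topspace (Euclidean_space (n * (n + 1) div 2))" for a
  proof -
    obtain b lam where e: "eigenbasis n (smat a) b lam"
      using spectral_theorem[of n "smat a"] smat_sym by blast
    define w where "w k = (if k < n then b 0 k else 0)" for k
    have "ip n (b 0) (b 0) = 1" using e assms by (simp add: eigenbasis_def onb_def)
    then have "\<exists>i<n. b 0 i \<noteq> 0" unfolding ip_def by (metis (no_types, lifting) lessThan_iff mult_zero_left sum.neutral zero_neq_one)
    moreover have "mv n (smat a) w k = lam 0 * w k" if "k < n" for k
      using e assms that mv_cong[of n w "b 0" "smat a" k] by (simp add: eigenbasis_def w_def)
    ultimately have "w \<in> EVec n a"
      unfolding EVec_iff[OF a] by (auto simp: topspace_Euclidean_space_iff w_def)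
    then show ?thesis by blast
  qed
  then show ?thesis using EVec_outside by (auto simp: mv_dom_def)
qed

section \<open>Coordinate boxes as neighbourhoods\<close>

lemma openin_box:
  "openin (Euclidean_space d) {z \<in> topspace (Euclidean_space d). \<forall>k<d. \<bar>z k - x k\<bar> < e}"
proof -
  have "open {z :: nat \<Rightarrow> real. \<forall>k\<in>{..<d}. \<bar>z k - x k\<bar> < e}"
    unfolding Collect_ball_eq
    by (intro open_INT finite_lessThan ballI open_Collect_less continuous_intros)
  then have "openin (powertop_real UNIV) {z. \<forall>k\<in>{..<d}. \<bar>z k - x k\<bar> < e}"
    by (simp add: euclidean_product_topology)
  then show ?thesis
    unfolding Euclidean_space_def openin_subtopology
    by (intro exI[of _ "{z. \<forall>k\<in>{..<d}. \<bar>z k - x k\<bar> < e}"]) auto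
qed

lemma openin_contains_box:
  assumes "openin (Euclidean_space d) U" "x \<in> U"
  shows "\<exists>e>0. \<forall>z\<in>topspace (Euclidean_space d). (\<forall>k<d. \<bar>z k - x k\<bar> < e) \<longrightarrow> z \<in> U"
proof -
  obtain T where T: "openin (powertop_real UNIV) T" "U = T \<inter> {x. \<forall>i\<ge>d. x i = 0}"
    using assms(1) unfolding Euclidean_space_def openin_subtopology by blast
  then have "x \<in> T" using assms(2) by blast
  then obtain X where X: "x \<in> PiE UNIV X" "\<And>i. open (X i)" "PiE UNIV X \<subseteq> T"
    using product_topology_open_contains_basis[OF T(1), of x] by auto
  have "\<exists>e>0. \<forall>y. \<bar>y - x i\<bar> < e \<longrightarrow> y \<in> X i" for i
    using X(1) X(2)[of i] unfolding open_dist by (force simp: dist_real_def)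
  then obtain e where e: "\<And>i. e i > 0" "\<And>i y. \<bar>y - x i\<bar> < e i \<Longrightarrow> y \<in> X i" by metis
  \<comment> \<open>The extra 1 keeps the minimum defined for \<open>d = 0\<close>. Coordinates from
    \<open>d\<close> on are 0 on both sides and need no radius.\<close>
  define r where "r = Min (insert 1 (e ` {..<d}))"
  have r: "r > 0" "\<And>i. i < d \<Longrightarrow> r \<le> e i" using e(1) by (auto simp: r_def)
  have "z \<in> U" if z: "z \<in> topspace (Euclidean_space d)" "\<forall>k<d. \<bar>z k - x k\<bar> < r" for z
  proof -
    have x0: "x i = 0" "z i = 0" if "i \<ge> d" for i
      using that z(1) assms(2) T(2) by (auto simp: topspace_Euclidean_space_iff)
    have "z i \<in> X i" for i
    proof (cases "i < d")
      case True
      then show ?thesis using r(2)[OF True] z(2) by (intro e(2)) force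
    next
      case False
      then show ?thesis using e(1)[of i] by (intro e(2)) (simp add: x0)
    qed
    then have "z \<in> T" using X(3) by auto
    then show ?thesis using z(1) T(2) by (simp add: topspace_Euclidean_space_iff)
  qed
  then show ?thesis using r(1) by blast
qed

section \<open>The lower bound\<close>

lemma onb_entry_le_1:
  assumes "onb n b" "i < n" "k < n"
  shows "\<bar>b i k\<bar> \<le> 1"
  using sq_le_ip_self[OF assms(3), of "b i"] assms by (simp add: onb_ip abs_square_le_1)

text \<open>Inside one eigenspace the orthonormal basis may be changed freely. Sum and difference of
  two basis vectors spread a vector with a single nonzero coordinate over two.\<close>

lemma eigenbasis_rotate:
  assumes e: "eigenbasis n M b lam" and ij: "i < n" "j < n" "i \<noteq> j" "lam i = lam j"
  defines "c \<equiv> 1 / sqrt 2"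
  shows "eigenbasis n M (b(i := (\<lambda>k. c * (b i k + b j k)), j := (\<lambda>k. c * (b i k - b j k)))) lam"
    (is "eigenbasis n M ?b lam")
proof -
  have o: "\<And>r s. r < n \<Longrightarrow> s < n \<Longrightarrow> ip n (b r) (b s) = (if r = s then 1 else 0)"
    using e by (auto simp: eigenbasis_def onb_ip)
  have c: "c * c = 1 / 2" by (simp add: c_def)
  have "onb n ?b"
    using ij o c by (intro orthonormal_imp_onb) (auto simp: ip_simps algebra_simps)
  moreover have "mv n M (\<lambda>k. c * (b i k + s * b j k)) k = lam i * (c * (b i k + s * b j k))" if "k < n" for k s
    using e ij that unfolding mv_scale mv_add by (simp add: eigenbasis_def algebra_simps)
  from this[of _ 1] this[of _ "-1"] have "\<forall>r<n. \<forall>k<n. mv n M (?b r) k = lam r * ?b r k"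
    using e ij by (auto simp: eigenbasis_def)
  ultimately show ?thesis by (simp add: eigenbasis_def)
qed

lemma eigenbasis_eigenvalue:
  assumes "eigenbasis n M b lam" "\<forall>i<n. \<forall>j<n. M i j = M j i" "\<forall>i<n. mv n M w i = l * w i"
    "i < n" "ip n (b i) w \<noteq> 0"
  shows "lam i = l"
proof -
  have "lam i * ip n (b i) w = ip n (b i) (mv n M w)"
    using assms by (simp add: eigenbasis_ip_mv)
  also have "\<dots> = ip n (b i) (\<lambda>k. l * w k)" using assms by (intro ip_cong) auto
  finally show ?thesis using assms by (simp add: ip_simps)
qed

text \<open>After a rotation inside its eigenspace, \<open>w\<close> has two nonzero coordinates, so the index set
  of the eigenspace can be split into halves neither of which spans \<open>w\<close>.\<close>

lemma eigenspace_split: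
  assumes e: "eigenbasis n M b lam" and sym: "\<forall>i<n. \<forall>j<n. M i j = M j i"
    and w: "\<exists>i<n. w i \<noteq> 0" "\<forall>i<n. mv n M w i = l * w i"
    and mult: "\<forall>i<n. 2 ^ Suc m \<le> card {i'. i' < n \<and> lam i' = lam i}"
  shows "\<exists>b' J1 J2 i1 i2. eigenbasis n M b' lam \<and> i1 \<in> J1 \<and> i2 \<in> J2 \<and> J1 \<inter> J2 = {} \<and>
    J1 \<union> J2 = {i. i < n \<and> lam i = l} \<and> 2 ^ m \<le> card J1 \<and> 2 ^ m \<le> card J2 \<and>
    ip n (b' i1) w \<noteq> 0 \<and> ip n (b' i2) w \<noteq> 0"
proof -
  define J where "J = {i. i < n \<and> lam i = l}"
  have [simp]: "finite J" by (simp add: J_def)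
  have "\<exists>i0<n. ip n (b i0) w \<noteq> 0"
  proof (rule ccontr)
    assume "\<not> ?thesis"
    then have "w k = 0" if "k < n" for k
      using e that by (subst onb_expand[of n b k w]) (auto simp: eigenbasis_def)
    then show False using w(1) by auto
  qed
  then obtain i0 where i0: "i0 < n" "ip n (b i0) w \<noteq> 0" by blast
  then have "lam i0 = l" using eigenbasis_eigenvalue[OF e sym w(2)] by blast
  then have i0J: "i0 \<in> J" using i0 by (simp add: J_def)
  have cardJ: "2 ^ Suc m \<le> card J" using mult[rule_format, OF i0(1)] \<open>lam i0 = l\<close> by (simp add: J_def)
  obtain b' i1 i2 where b': "eigenbasis n M b' lam" "i1 \<in> J" "i2 \<in> J" "i1 \<noteq> i2"
    "ip n (b' i1) w \<noteq> 0" "ip n (b' i2) w \<noteq> 0"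
  proof (cases "\<exists>i2\<in>J. i2 \<noteq> i0 \<and> ip n (b i2) w \<noteq> 0")
    case True
    then show ?thesis using that e i0 i0J by blast
  next
    case False
    have "(2::nat) \<le> 2 ^ Suc m" by simp
    then have "2 \<le> card J" using cardJ by linarith
    then have "J \<noteq> {i0}" by auto
    then obtain i2 where i2: "i2 \<in> J" "i2 \<noteq> i0" using i0J by blast
    then have z: "ip n (b i2) w = 0" using False by blast
    define c :: real where "c = 1 / sqrt 2"
    have c: "c \<noteq> 0" by (simp add: c_def)
    define b' where "b' = b(i0 := (\<lambda>k. c * (b i0 k + b i2 k)), i2 := (\<lambda>k. c * (b i0 k - b i2 k)))"
    have "eigenbasis n M b' lam" unfolding b'_def c_def
      using i0J i2 by (intro eigenbasis_rotate e) (auto simp: J_def)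
    moreover have "ip n (b' i0) w \<noteq> 0"
      using i0 i2 z c by (simp add: b'_def ip_simps)
    moreover have "ip n (b' i2) w \<noteq> 0"
      using i0 i2 z c by (simp add: b'_def ip_simps)
    ultimately show ?thesis using that i0J i2 by blast
  qed
  have "card (J - {i1, i2}) = card J - 2" using b' by (subst card_Diff_subset) auto
  \<comment> \<open>One half receives \<open>i1\<close> and \<open>2 ^ m - 1\<close> further
    indices, hence exactly \<open>2 ^ m\<close>; the other keeps \<open>i2\<close> and at least
    \<open>2 ^ m\<close> in all.\<close>
  then have "2 ^ m - 1 \<le> card (J - {i1, i2})" using cardJ by simp
  then obtain J0 where J0: "J0 \<subseteq> J - {i1, i2}" "card J0 = 2 ^ m - 1" "finite J0"
    by (rule obtain_subset_with_card_n)
  define J1 where "J1 = insert i1 J0"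
  have "card J1 = 2 ^ m" using J0 by (subst J1_def, subst card_insert_disjoint) auto
  moreover have "J1 \<subseteq> J" using J0 b' by (auto simp: J1_def)
  then have "card (J - J1) = card J - card J1" by (intro card_Diff_subset) (auto intro: finite_subset)
  then have "2 ^ m \<le> card (J - J1)" using cardJ \<open>card J1 = 2 ^ m\<close> by simp
  moreover have "i2 \<in> J - J1" using J0 b' by (auto simp: J1_def)
  moreover have "i1 \<in> J1" by (simp add: J1_def)
  moreover have "J1 \<union> (J - J1) = {i. i < n \<and> lam i = l}" using \<open>J1 \<subseteq> J\<close> by (auto simp: J_def)
  moreover have "J1 \<inter> (J - J1) = {}" "2 ^ m \<le> card J1" using \<open>card J1 = 2 ^ m\<close> by auto
  moreover note b'(1,5,6)
  ultimately show ?thesis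
    by (intro exI[of _ b'] exI[of _ J1] exI[of _ "J - J1"] exI[of _ i1] exI[of _ i2] conjI)
qed

text \<open>If \<open>x\<close> is an eigenvector of \<open>M'\<close> for \<open>l\<close>, then
  \<open>lam i - l\<close> times its \<open>i\<close>-th coordinate equals the \<open>i\<close>-th
  coordinate of \<open>(M - M') x\<close>, which is small. Two large coordinates thus force both
  eigenvalues close to the same \<open>l\<close>.\<close>

lemma no_near_eigenvector:
  assumes e: "eigenbasis n M b lam" and sym: "\<forall>i<n. \<forall>j<n. M i j = M j i"
    and i12: "i1 < n" "i2 < n"
    and near: "\<And>i j. i < n \<Longrightarrow> j < n \<Longrightarrow> \<bar>M' i j - M i j\<bar> \<le> \<zeta>"
    and x: "\<forall>i<n. mv n M' x i = l * x i" "\<And>j. j < n \<Longrightarrow> \<bar>x j\<bar> \<le> B"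
    and large: "\<bar>ip n (b i1) x\<bar> \<ge> \<gamma>" "\<bar>ip n (b i2) x\<bar> \<ge> \<gamma>"
  shows "\<bar>lam i1 - lam i2\<bar> * \<gamma> \<le> 2 * (real n * (real n * (\<zeta> * B)))"
proof -
  have *: "\<bar>lam i - l\<bar> * \<gamma> \<le> real n * (real n * (\<zeta> * B))" if i: "i < n" "\<bar>ip n (b i) x\<bar> \<ge> \<gamma>" for i
  proof -
    have d: "(lam i - l) * ip n (b i) x = ip n (b i) (\<lambda>k. mv n M x k - mv n M' x k)"
    proof -
      have "ip n (b i) (mv n M' x) = ip n (b i) (\<lambda>k. l * x k)" using x(1) by (intro ip_cong) auto
      then show ?thesis
        using eigenbasis_ip_mv[OF e sym i(1), of x] by (simp add: ip_simps algebra_simps)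
    qed
    have "\<bar>mv n M x k - mv n M' x k\<bar> \<le> real n * (\<zeta> * B)" if "k < n" for k
    proof -
      have "\<bar>mv n M x k - mv n M' x k\<bar> = \<bar>\<Sum>j<n. (M k j - M' k j) * x j\<bar>"
        by (simp add: mv_def sum_subtractf algebra_simps)
      also have "\<dots> \<le> (\<Sum>j<n. \<bar>(M k j - M' k j) * x j\<bar>)" by (rule sum_abs)
      also have "\<dots> \<le> (\<Sum>j<n. \<zeta> * B)"
      proof (intro sum_mono)
        fix j assume "j \<in> {..<n}"
        then have "\<bar>M' k j - M k j\<bar> \<le> \<zeta>" "\<bar>x j\<bar> \<le> B" using near x(2) that by auto
        then show "\<bar>(M k j - M' k j) * x j\<bar> \<le> \<zeta> * B"
          unfolding abs_mult by (intro mult_mono) (auto simp: abs_minus_commute)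
      qed
      finally show ?thesis by simp
    qed
    moreover have "\<bar>b i k\<bar> \<le> 1" if "k < n" for k
      using e i that by (auto simp: eigenbasis_def intro: onb_entry_le_1)
    ultimately have "\<bar>b i k * (mv n M x k - mv n M' x k)\<bar> \<le> real n * (\<zeta> * B)" if "k < n" for k
      using that mult_mono[of "\<bar>b i k\<bar>" 1 "\<bar>mv n M x k - mv n M' x k\<bar>" "real n * (\<zeta> * B)"]
      by (simp add: abs_mult)
    then have "\<bar>ip n (b i) (\<lambda>k. mv n M x k - mv n M' x k)\<bar> \<le> (\<Sum>k<n. real n * (\<zeta> * B))"
      unfolding ip_def by (intro order.trans[OF sum_abs] sum_mono) auto
    then have "\<bar>lam i - l\<bar> * \<bar>ip n (b i) x\<bar> \<le> real n * (real n * (\<zeta> * B))"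
      by (simp add: d[symmetric] abs_mult)
    moreover have "\<bar>lam i - l\<bar> * \<gamma> \<le> \<bar>lam i - l\<bar> * \<bar>ip n (b i) x\<bar>"
      using i(2) by (intro mult_left_mono) auto
    ultimately show ?thesis by linarith
  qed
  show ?thesis
  proof (cases "\<gamma> \<ge> 0")
    case True
    have "\<bar>lam i1 - lam i2\<bar> * \<gamma> \<le> (\<bar>lam i1 - l\<bar> + \<bar>lam i2 - l\<bar>) * \<gamma>"
      using True by (intro mult_right_mono) auto
    then show ?thesis using *[OF i12(1) large(1)] *[OF i12(2) large(2)] by (simp add: algebra_simps)
  next
    case False
    then have "\<bar>lam i1 - lam i2\<bar> * \<gamma> \<le> 0" by (simp add: mult_nonneg_nonpos)
    moreover have "0 \<le> \<zeta> * B"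
      using near[OF i12(1) i12(1)] x(2)[OF i12(1)] by (intro mult_nonneg_nonneg) auto
    ultimately show ?thesis by (smt (verit) mult_nonneg_nonneg of_nat_0_le_iff)
  qed
qed

text \<open>\<open>g\<close> is the orthogonal projection onto the span of the vectors indexed by
  \<open>J2\<close>. It is diagonal in the same basis, so adding a multiple of it shifts exactly
  their eigenvalues.\<close>

lemma perturb_eigenspace:
  fixes a :: "nat \<Rightarrow> real"
  assumes e: "eigenbasis n (smat a) b lam" and J2: "J2 \<subseteq> {..<n}"
  defines "g \<equiv> of_smat n (\<lambda>i j. \<Sum>r\<in>J2. b r i * b r j)"
  shows "eigenbasis n (smat (\<lambda>k. a k + e' * g k)) b (\<lambda>r. lam r + (if r \<in> J2 then e' else 0))"
proof -
  have fin: "finite J2" using J2 finite_subset by blast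
  have sm: "smat (\<lambda>k. a k + e' * g k) i j = smat a i j + e' * (\<Sum>r\<in>J2. b r i * b r j)" if "i < n" "j < n" for i j
    using smat_of_smat[of "\<lambda>i j. \<Sum>r\<in>J2. b r i * b r j" i n j] that
    by (simp add: smat_def g_def mult.commute)
  have "mv n (smat (\<lambda>k. a k + e' * g k)) (b s) k = (lam s + (if s \<in> J2 then e' else 0)) * b s k"
    if "s < n" "k < n" for s k
  proof -
    have "mv n (smat (\<lambda>k. a k + e' * g k)) (b s) k
        = (\<Sum>j<n. smat a k j * b s j + (\<Sum>r\<in>J2. e' * b r k * (b r j * b s j)))"
      unfolding mv_def using sm that
      by (intro sum.cong) (auto simp: algebra_simps sum_distrib_left)
    also have "\<dots> = mv n (smat a) (b s) k + (\<Sum>r\<in>J2. \<Sum>j<n. e' * b r k * (b r j * b s j))"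
      unfolding sum.distrib mv_def by (simp add: sum.swap[of _ "J2"])
    also have "(\<Sum>r\<in>J2. \<Sum>j<n. e' * b r k * (b r j * b s j)) = (\<Sum>r\<in>J2. e' * b r k * ip n (b r) (b s))"
      by (simp add: ip_def sum_distrib_left)
    also have "\<dots> = (\<Sum>r\<in>J2. if r = s then e' * b r k else 0)"
      using e J2 that by (intro sum.cong) (auto simp: eigenbasis_def onb_ip)
    also have "\<dots> = (if s \<in> J2 then e' * b s k else 0)" using fin by simp
    finally show ?thesis using e that by (simp add: eigenbasis_def algebra_simps)
  qed
  then show ?thesis using e by (simp add: eigenbasis_def)
qed

text \<open>Each induction step contributes the piece \<open>D\<close> containing \<open>a\<close>.
  Continuity on \<open>D\<close> supplies an eigenvector \<open>w\<close> of \<open>a\<close>;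
  splitting its eigenspace yields a matrix \<open>a'\<close> near \<open>a\<close> with a
  neighbourhood that misses \<open>D\<close>, and the induction hypothesis inside this neighbourhood
  gives pieces other than \<open>D\<close>. Hence \<open>a\<close> and \<open>U\<close> have to
  vary.\<close>

lemma pieces_near:
  fixes n :: nat
  defines "d \<equiv> n * (n + 1) div 2"
  assumes n: "n \<ge> 1"
    and part: "partition_on (mv_dom (EVec n)) \<Delta>"
    and cont: "\<forall>D\<in>\<Delta>. mv_continuous (Euclidean_space d) (Euclidean_space n) (mv_restrict (EVec n) D)"
  shows "a \<in> U \<Longrightarrow> openin (Euclidean_space d) U \<Longrightarrow> eigenbasis n (smat a) b lam \<Longrightarrow>
    \<forall>i<n. 2 ^ m \<le> card {i'. i' < n \<and> lam i' = lam i} \<Longrightarrow>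
    \<exists>F\<subseteq>\<Delta>. finite F \<and> card F = Suc m \<and> (\<forall>D\<in>F. D \<inter> U \<noteq> {})"
proof (induction m arbitrary: a b lam U)
  case 0
  have "a \<in> mv_dom (EVec n)"
    using 0 openin_subset mv_dom_EVec[OF n] by (auto simp: d_def)
  then obtain D where "D \<in> \<Delta>" "a \<in> D" using part by (auto simp: partition_on_def)
  then show ?case using 0 by (intro exI[of _ "{D}"]) auto
next
  case (Suc m)
  have a: "a \<in> topspace (Euclidean_space d)" using Suc.prems openin_subset by blast
  then have "a \<in> mv_dom (EVec n)" using mv_dom_EVec[OF n] by (simp add: d_def)
  then obtain D where D: "D \<in> \<Delta>" "a \<in> D" using part by (auto simp: partition_on_def)
  then have Dsub: "D \<subseteq> mv_dom (EVec n)" using part by (auto simp: partition_on_def)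
  then have domD: "mv_dom (mv_restrict (EVec n) D) = D"
    by (auto simp: mv_dom_def mv_restrict_def)
  have "mv_continuous_at (Euclidean_space d) (Euclidean_space n) (mv_restrict (EVec n) D) a"
    using cont D domD by (auto simp: mv_continuous_def)
  then obtain w where w: "w \<in> EVec n a" and
    wV: "\<And>V. openin (Euclidean_space n) V \<Longrightarrow> w \<in> V \<Longrightarrow>
       \<exists>U. openin (Euclidean_space d) U \<and> a \<in> U \<and> (\<forall>z\<in>U \<inter> D. EVec n z \<inter> V \<noteq> {})"
    using D unfolding mv_continuous_at_def domD by (auto simp: mv_restrict_def)
  from w a obtain l where w0: "w \<in> topspace (Euclidean_space n)" "\<exists>i<n. w i \<noteq> 0"
    "\<forall>i<n. mv n (smat a) w i = l * w i" unfolding d_def by (auto simp: EVec_iff)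
  have sym: "\<And>a. \<forall>i<n. \<forall>j<n. smat a i j = smat a j i" using smat_sym by blast
  obtain b' J1 J2 i1 i2 where b': "eigenbasis n (smat a) b' lam" and J: "i1 \<in> J1" "i2 \<in> J2"
     "J1 \<inter> J2 = {}" "J1 \<union> J2 = {i. i < n \<and> lam i = l}" "2 ^ m \<le> card J1" "2 ^ m \<le> card J2"
     and nz: "ip n (b' i1) w \<noteq> 0" "ip n (b' i2) w \<noteq> 0"
    using eigenspace_split[OF Suc.prems(3) sym w0(2,3) Suc.prems(4)] by metis
  have J1D: "r < n \<and> lam r = l \<and> r \<notin> J2" if "r \<in> J1" for r using J(3,4) that by blast
  have J2D: "r < n \<and> lam r = l" if "r \<in> J2" for r using J(4) that by blast
  have i12: "i1 < n" "i2 < n" and J2n: "J2 \<subseteq> {..<n}" using J1D[OF J(1)] J2D[OF J(2)] J2D by auto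
  \<comment> \<open>Half of the smaller coordinate of \<open>w\<close>, so that every
    \<open>x\<close> in the box \<open>V\<close> around \<open>w\<close> keeps both coordinates at
    least \<gamma>.\<close>
  define \<gamma> where "\<gamma> = min \<bar>ip n (b' i1) w\<bar> \<bar>ip n (b' i2) w\<bar> / 2"
  have \<gamma>: "\<gamma> > 0" using nz by (simp add: \<gamma>_def)
  define \<eta> where "\<eta> = min 1 (\<gamma> / real n)"
  have \<eta>: "\<eta> > 0" "\<eta> \<le> 1" "real n * \<eta> \<le> \<gamma>"
    using \<gamma> n by (auto simp: \<eta>_def min_def field_simps)
  define B where "B = (\<Sum>j<n. \<bar>w j\<bar>) + 1"
  have B: "B > 0" unfolding B_def by (smt (verit) sum_nonneg abs_ge_zero)
  define V where "V = {x \<in> topspace (Euclidean_space n). \<forall>k<n. \<bar>x k - w k\<bar> < \<eta>}"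
  have V: "openin (Euclidean_space n) V" "w \<in> V"
    using openin_box w0 \<eta> by (auto simp: V_def)
  have xB: "\<bar>x j\<bar> \<le> B" if "x \<in> V" "j < n" for x j
  proof -
    have "\<bar>w j\<bar> \<le> (\<Sum>j<n. \<bar>w j\<bar>)" using that(2) by (intro member_le_sum) auto
    moreover have "\<bar>x j - w j\<bar> < 1" using that \<eta> by (force simp: V_def)
    ultimately show ?thesis by (simp add: B_def)
  qed
  have xlarge: "\<bar>ip n (b' i) x\<bar> \<ge> \<gamma>" if "x \<in> V" "i < n" "2 * \<gamma> \<le> \<bar>ip n (b' i) w\<bar>" for x i
  proof -
    have "\<bar>ip n (b' i) (\<lambda>k. x k - w k)\<bar> \<le> (\<Sum>k<n. \<eta>)"
      unfolding ip_def
    proof (intro order.trans[OF sum_abs] sum_mono)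
      fix k assume k: "k \<in> {..<n}"
      then have "\<bar>b' i k\<bar> \<le> 1" "\<bar>x k - w k\<bar> \<le> \<eta>"
        using b' that by (auto simp: eigenbasis_def V_def intro: onb_entry_le_1 less_imp_le)
      then have "\<bar>b' i k\<bar> * \<bar>x k - w k\<bar> \<le> 1 * \<eta>" by (intro mult_mono) auto
      then show "\<bar>b' i k * (x k - w k)\<bar> \<le> \<eta>" by (simp add: abs_mult)
    qed
    then show ?thesis using \<eta> that(3) by (simp add: ip_simps)
  qed
  obtain UV where UV: "openin (Euclidean_space d) UV" "a \<in> UV" "\<And>z. z \<in> UV \<inter> D \<Longrightarrow> EVec n z \<inter> V \<noteq> {}"
    using wV[OF V] by blast
  define g where "g = of_smat n (\<lambda>i j. \<Sum>r\<in>J2. b' r i * b' r j)"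
  obtain \<delta> where \<delta>: "\<delta> > 0" "\<And>z. z \<in> topspace (Euclidean_space d) \<Longrightarrow> \<forall>k<d. \<bar>z k - a k\<bar> < \<delta> \<Longrightarrow> z \<in> U \<inter> UV"
    using openin_contains_box[OF openin_Int[OF Suc.prems(2) UV(1)] IntI[OF Suc.prems(1) UV(2)]] by blast
  define G where "G = (\<Sum>k<d. \<bar>g k\<bar>) + 1"
  have G: "G > 0" unfolding G_def by (smt (verit) sum_nonneg abs_ge_zero)
  \<comment> \<open>\<open>G\<close> bounds the entries of \<open>g\<close>, so the perturbation
    stays within \<open>\<delta> / 2\<close> and \<open>a'\<close> inside
    \<open>U \<inter> UV\<close>.\<close>
  define \<epsilon> where "\<epsilon> = \<delta> / (2 * G)"
  have \<epsilon>: "\<epsilon> > 0" using \<delta> G by (simp add: \<epsilon>_def)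
  define a' where "a' k = a k + \<epsilon> * g k" for k
  define lam' where "lam' r = lam r + (if r \<in> J2 then \<epsilon> else 0)" for r
  have e': "eigenbasis n (smat a') b' lam'"
    using perturb_eigenspace[OF b' J2n, of \<epsilon>] unfolding a'_def lam'_def g_def by simp
  have a't: "a' \<in> topspace (Euclidean_space d)"
    using a of_smat_topspace[of n] by (auto simp: a'_def g_def d_def topspace_Euclidean_space_iff)
  have "\<bar>a' k - a k\<bar> < \<delta>" if "k < d" for k
  proof -
    have "\<bar>g k\<bar> \<le> G" unfolding G_def using that member_le_sum[of k "{..<d}" "\<lambda>k. \<bar>g k\<bar>"] by auto
    then have "\<epsilon> * \<bar>g k\<bar> \<le> \<epsilon> * G" using \<epsilon> by (intro mult_left_mono) auto
    also have "\<dots> < \<delta>" using \<delta> G by (simp add: \<epsilon>_def)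
    finally show ?thesis using \<epsilon> by (simp add: a'_def abs_mult)
  qed
  then have a'U: "a' \<in> U \<inter> UV" using \<delta>(2)[OF a't] by blast
  \<comment> \<open>Chosen so that \<open>no_near_eigenvector\<close> would bound
    \<open>\<epsilon> * \<gamma>\<close> by half of itself.\<close>
  define \<zeta> where "\<zeta> = \<epsilon> * \<gamma> / (4 * (real n * (real n * B)))"
  have den: "real n * (real n * B) > 0" using n B by simp
  have \<zeta>: "\<zeta> > 0" using \<epsilon> \<gamma> den by (simp add: \<zeta>_def)
  have \<zeta>2: "2 * (real n * (real n * (\<zeta> * B))) = \<epsilon> * \<gamma> / 2"
  proof -
    have *: "2 * (e / (4 * Q)) * Q = e / 2" if "Q > 0" for Q e :: real using that by simp
    have "2 * (real n * (real n * (\<zeta> * B))) = 2 * \<zeta> * (real n * (real n * B))" by (simp add: mult_ac)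
    also have "\<dots> = \<epsilon> * \<gamma> / 2" unfolding \<zeta>_def using den
      by (metis (no_types) *)
    finally show ?thesis .
  qed
  define U' where "U' = {z \<in> topspace (Euclidean_space d). \<forall>k<d. \<bar>z k - a' k\<bar> < \<zeta>}"
  have "\<exists>F\<subseteq>\<Delta>. finite F \<and> card F = Suc m \<and> (\<forall>D\<in>F. D \<inter> (U \<inter> UV \<inter> U') \<noteq> {})"
  proof (rule Suc.IH[OF _ _ e'])
    show "a' \<in> U \<inter> UV \<inter> U'" using a'U a't \<zeta> by (simp add: U'_def)
    show "openin (Euclidean_space d) (U \<inter> UV \<inter> U')"
      using Suc.prems UV openin_box by (auto simp: U'_def)
    have "2 ^ m \<le> card {i'. i' < n \<and> lam' i' = lam' i}" if i: "i < n" for i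
    proof -
      \<comment> \<open>Only inclusions are used: the shifted eigenvalue
        \<open>l + \<epsilon>\<close> may meet another eigenvalue, which merely enlarges a
        class.\<close>
      have sub: "X \<subseteq> {i'. i' < n \<and> lam' i' = lam' i} \<Longrightarrow> 2 ^ m \<le> card X \<Longrightarrow> ?thesis" for X
        using card_mono[of "{i'. i' < n \<and> lam' i' = lam' i}" X] by force
      consider "i \<in> J1" | "i \<in> J2" | "lam i \<noteq> l" using i J(4) by blast
      then show ?thesis
      proof cases
        case 1
        then show ?thesis using J(5) J1D by (intro sub[of J1]) (auto simp: lam'_def)
      next
        case 2
        then show ?thesis using J(6) J2D by (intro sub[of J2]) (auto simp: lam'_def)
      next
        case 3
        have "(2::nat) ^ m \<le> 2 ^ Suc m" by simp
        also have "\<dots> \<le> card {i'. i' < n \<and> lam i' = lam i}" using Suc.prems(4) i by blast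
        finally show ?thesis using 3 J2D by (intro sub[of "{i'. i' < n \<and> lam i' = lam i}"]) (auto simp: lam'_def)
      qed
    qed
    then show "\<forall>i<n. 2 ^ m \<le> card {i'. i' < n \<and> lam' i' = lam' i}" by blast
  qed
  then obtain F where F: "F \<subseteq> \<Delta>" "finite F" "card F = Suc m" "\<And>D. D \<in> F \<Longrightarrow> D \<inter> (U \<inter> UV \<inter> U') \<noteq> {}"
    by blast
  have "D \<notin> F"
  proof
    assume "D \<in> F"
    \<comment> \<open>By continuity a point of \<open>D\<close> in this neighbourhood has an
      eigenvector near \<open>w\<close>, against the gap between the eigenvalues of
      \<open>i1\<close> and \<open>i2\<close>.\<close>
    then obtain z where z: "z \<in> D" "z \<in> UV" "z \<in> U'" using F(4) by blast
    then obtain x where x: "x \<in> EVec n z" "x \<in> V" using UV(3) by blast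
    have zt: "z \<in> topspace (Euclidean_space d)" using z by (simp add: U'_def)
    obtain l' where l': "\<forall>i<n. mv n (smat z) x i = l' * x i"
      using x(1) zt unfolding d_def by (auto simp: EVec_iff)
    have "\<bar>smat z i j - smat a' i j\<bar> \<le> \<zeta>" if "i < n" "j < n" for i j
      using z(3) upper_index_less[of "min i j" "max i j" n] that
      by (auto simp: U'_def smat_def d_def intro: less_imp_le)
    from no_near_eigenvector[OF e' sym i12 this l' xB[OF x(2)] xlarge[OF x(2) i12(1)] xlarge[OF x(2) i12(2)]]
    have "\<bar>lam' i1 - lam' i2\<bar> * \<gamma> \<le> 2 * (real n * (real n * (\<zeta> * B)))"
      by (simp add: \<gamma>_def)
    moreover have "\<bar>lam' i1 - lam' i2\<bar> = \<epsilon>"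
    proof -
      have "lam i1 = l" "lam i2 = l" "i1 \<notin> J2" using J1D[OF J(1)] J2D[OF J(2)] by auto
      then show ?thesis using \<epsilon> J(2) by (simp add: lam'_def)
    qed
    ultimately show False using \<zeta>2 \<epsilon> \<gamma> by (simp add: zero_less_mult_iff)
  qed
  have "insert D F \<subseteq> \<Delta>" "finite (insert D F)" using F(1,2) D(1) by auto
  moreover have "card (insert D F) = Suc (Suc m)" using \<open>D \<notin> F\<close> F(2,3) by simp
  moreover have "D' \<inter> U \<noteq> {}" if "D' \<in> insert D F" for D'
    using that F(4) D(2) Suc.prems(1) by blast
  ultimately show ?case by blast
qed

lemma log2_floor:
  assumes "n \<ge> 1"
  shows "2 ^ nat \<lfloor>log 2 (real n)\<rfloor> \<le> n" "n < 2 ^ Suc (nat \<lfloor>log 2 (real n)\<rfloor>)"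
proof -
  define N where "N = nat \<lfloor>log 2 (real n)\<rfloor>"
  have "log 2 (real n) \<ge> 0" using assms by simp
  then have N: "real N \<le> log 2 (real n)" "log 2 (real n) < real (Suc N)"
    unfolding N_def by linarith+
  have "2 powr real N \<le> real n" using N(1) le_log_iff[of 2 "real n" "real N"] assms by (auto simp only: of_nat_0_less_iff)
  then have "real (2 ^ N) \<le> real n" using powr_realpow[of 2 N] by simp
  then show "2 ^ nat \<lfloor>log 2 (real n)\<rfloor> \<le> n" unfolding N_def[symmetric] by linarith
  have "real n < 2 powr real (Suc N)" using N(2) log_less_iff[of 2 "real n" "real (Suc N)"] assms by (auto simp only: of_nat_0_less_iff)
  then have "real n < real (2 ^ Suc N)" using powr_realpow[of 2 "Suc N"] by simp
  then show "n < 2 ^ Suc (nat \<lfloor>log 2 (real n)\<rfloor>)" unfolding N_def[symmetric] by linarith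
qed

theorem C_t_EVec_ge:
  assumes n: "n \<ge> 1"
  shows "enat (nat \<lfloor>log 2 (real n)\<rfloor> + 1) \<le> C_t (Euclidean_space (n * (n + 1) div 2)) (Euclidean_space n) (EVec n)"
  unfolding C_t_def
proof (rule INF_greatest)
  fix \<Delta> assume "\<Delta> \<in> {\<Delta>. partition_on (mv_dom (EVec n)) \<Delta> \<and> (\<forall>D\<in>\<Delta>. mv_continuous (Euclidean_space (n * (n + 1) div 2)) (Euclidean_space n) (mv_restrict (EVec n) D))}"
  then have part: "partition_on (mv_dom (EVec n)) \<Delta>"
    and cont: "\<forall>D\<in>\<Delta>. mv_continuous (Euclidean_space (n * (n + 1) div 2)) (Euclidean_space n) (mv_restrict (EVec n) D)"
    by auto
  \<comment> \<open>The zero matrix has a single eigenvalue, of multiplicity \<open>n\<close>, which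
    is at least \<open>2 ^ m\<close> for \<open>m\<close> the integer part of the logarithm. Every
    one of its neighbourhoods thus meets \<open>m + 1\<close> pieces.\<close>
  define b :: "nat \<Rightarrow> nat \<Rightarrow> real" where "b = (\<lambda>i k. if i = k then 1 else 0)"
  have "eigenbasis n (smat (\<lambda>_. 0)) b (\<lambda>_. 0)"
  proof -
    have "ip n (b i) (b j) = (\<Sum>k<n. if k = i then (if i = j then 1 else 0) else 0)" for i j
      unfolding ip_def by (intro sum.cong) (auto simp: b_def)
    then have "onb n b" by (intro orthonormal_imp_onb) simp
    then show ?thesis by (simp add: eigenbasis_def mv_def smat_def)
  qed
  from pieces_near[OF n part _ _ _ this, of "topspace (Euclidean_space (n * (n + 1) div 2))" "nat \<lfloor>log 2 (real n)\<rfloor>"]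
  obtain F where F: "F \<subseteq> \<Delta>" "finite F" "card F = Suc (nat \<lfloor>log 2 (real n)\<rfloor>)"
    using cont log2_floor(1)[OF n] by (auto simp: topspace_Euclidean_space_iff)
  show "enat (nat \<lfloor>log 2 (real n)\<rfloor> + 1) \<le> ecard \<Delta>"
    using card_mono[OF _ F(1)] F(3) by (simp add: ecard_def)
qed

section \<open>Names of reals\<close>

definition enc :: "(nat \<Rightarrow> nat) \<Rightarrow> nat \<Rightarrow> bool list" where
  "enc u m = concat (map (\<lambda>i. replicate (u i) True @ [False]) [0..<m])"

lemma enc_0 [simp]: "enc u 0 = []"
  by (simp add: enc_def)

lemma enc_Suc: "enc u (Suc m) = enc u m @ replicate (u m) True @ [False]"
  by (simp add: enc_def)

lemma encodes_iff: "encodes p u \<longleftrightarrow> (\<forall>m. map p [0..<length (enc u m)] = enc u m)"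
  by (simp add: encodes_def enc_def Let_def)

lemma encodes_nth: "encodes p u \<Longrightarrow> k < length (enc u m) \<Longrightarrow> p k = enc u m ! k"
  unfolding encodes_iff by (metis add_cancel_left_left diff_zero length_upt nth_map nth_upt)

lemma length_enc_mono: "m \<le> m' \<Longrightarrow> length (enc u m) \<le> length (enc u m')"
  by (induction m' rule: dec_induct) (auto simp: enc_Suc)

lemma length_enc_ge: "m \<le> length (enc u m)"
  by (induction m) (auto simp: enc_Suc)

lemma enc_nth_mono: "m \<le> m' \<Longrightarrow> k < length (enc u m) \<Longrightarrow> enc u m' ! k = enc u m ! k"
proof (induction m' rule: dec_induct)
  case (step m')
  then have "k < length (enc u m')" using length_enc_mono[of m m' u] by simp
  then show ?case using step by (simp add: enc_Suc nth_append)
qed simp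

lemma enc_cong: "(\<And>i. i < m \<Longrightarrow> u i = u' i) \<Longrightarrow> enc u m = enc u' m"
  by (induction m) (auto simp: enc_Suc)

text \<open>Every block contributes at least one symbol, so symbol \<open>k\<close> lies within the
  first \<open>k + 1\<close> blocks and can be read off there.\<close>

lemma encodes_exists: "\<exists>p. encodes p u"
proof -
  have "map (\<lambda>k. enc u (Suc k) ! k) [0..<length (enc u m)] = enc u m" for m
  proof (intro nth_equalityI)
    fix k assume "k < length (map (\<lambda>k. enc u (Suc k) ! k) [0..<length (enc u m)])"
    then have k: "k < length (enc u m)" by simp
    have k': "k < length (enc u (Suc k))" using length_enc_ge[of "Suc k" u] by simp
    have "enc u (Suc k) ! k = enc u m ! k"
      using enc_nth_mono[of m "Suc k" k u] enc_nth_mono[of "Suc k" m k u] k k' by (metis nat_le_linear)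
    then show "map (\<lambda>k. enc u (Suc k) ! k) [0..<length (enc u m)] ! k = enc u m ! k" using k by simp
  qed simp
  then show ?thesis unfolding encodes_iff by blast
qed

lemma encodes_block:
  assumes "encodes p u"
  shows "j < u m \<Longrightarrow> p (length (enc u m) + j)" "\<not> p (length (enc u m) + u m)"
  using encodes_nth[OF assms, of "length (enc u m) + j" "Suc m"]
    encodes_nth[OF assms, of "length (enc u m) + u m" "Suc m"]
  by (auto simp: enc_Suc nth_append)

text \<open>Blocks are self-delimiting: where two sequences first differ, the shorter block shows a
  0 at a position where the longer one still has a 1.\<close>

lemma encodes_prefix:
  assumes p: "encodes p u" "encodes p' u'" and "\<And>i. i < length (enc u m) \<Longrightarrow> p' i = p i"
  shows "i < m \<Longrightarrow> u' i = u i"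
  using assms(3)
proof (induction m arbitrary: i)
  case (Suc m)
  have IH: "u' i = u i" if "i < m" for i
    by (rule Suc.IH[OF that]) (auto simp: enc_Suc Suc.prems(2))
  have eq: "enc u' m = enc u m" using IH by (intro enc_cong) auto
  have ag: "p' (length (enc u m) + j) = p (length (enc u m) + j)" if "j \<le> u m" for j
    using that by (intro Suc.prems(2)) (simp add: enc_Suc)
  have "u' m = u m"
  proof (rule linorder_cases[of "u' m" "u m"])
    assume "u' m < u m"
    then show ?thesis
      using ag[of "u' m"] encodes_block(1)[OF p(1), of "u' m" m] encodes_block(2)[OF p(2), of m] eq by simp
  next
    assume "u' m > u m"
    then show ?thesis
      using ag[of "u m"] encodes_block(2)[OF p(1), of m] encodes_block(1)[OF p(2), of "u m" m] eq by simp
  qed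
  then show ?case using IH Suc.prems(1) by (auto simp: less_Suc_eq)
qed simp

section \<open>Rational approximations and prefixes of Cauchy names\<close>

lemma abs_triangle: "\<bar>a - b\<bar> \<le> e \<Longrightarrow> \<bar>b - c\<bar> \<le> e' \<Longrightarrow> \<bar>a - c\<bar> \<le> e + e'" for a b c :: real
  by linarith

definition frac :: "nat \<Rightarrow> nat \<Rightarrow> nat \<Rightarrow> real" where
  "frac a b c = (real a - real b) / (real c + 1)"

lemma of_rat_rat_at: "real_of_rat (rat_at u k) = frac (u (3 * k)) (u (3 * k + 1)) (u (3 * k + 2))"
  by (simp add: rat_at_def frac_def of_rat_divide of_rat_diff of_rat_add)

lemma frac_approx: "\<exists>a b c. \<bar>x - frac a b c\<bar> \<le> 1 / 2 ^ Suc k"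
proof -
  define c :: nat where "c = 2 ^ Suc k"
  define p where "p = \<lfloor>x * (real c + 1)\<rfloor>"
  have "real (nat p) - real (nat (- p)) = of_int p" by (cases "p \<ge> 0") auto
  then have "x - frac (nat p) (nat (- p)) c = (x * (real c + 1) - of_int p) / (real c + 1)"
    by (simp add: frac_def field_simps)
  moreover have "0 \<le> x * (real c + 1) - of_int p" "x * (real c + 1) - of_int p \<le> 1"
    unfolding p_def by linarith+
  ultimately have "\<bar>x - frac (nat p) (nat (- p)) c\<bar> \<le> 1 / (real c + 1)"
    by (simp add: divide_right_mono)
  also have "\<dots> \<le> 1 / 2 ^ Suc k" by (simp add: c_def frac_le)
  finally show ?thesis by blast
qed

lemma approx_seq: "\<exists>u. \<forall>k. \<bar>x - real_of_rat (rat_at u k)\<bar> \<le> 1 / 2 ^ Suc k"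
proof -
  obtain a b c where abc: "\<And>k. \<bar>x - frac (a k) (b k) (c k)\<bar> \<le> 1 / 2 ^ Suc k"
    using frac_approx[of x] by metis
  define u where "u i = (if i mod 3 = 0 then a (i div 3) else if i mod 3 = 1 then b (i div 3) else c (i div 3))" for i
  have "(3 * k + 2) mod 3 = 2" "(3 * k + 2) div 3 = k" "(3 * k + 1) mod 3 = 1" "(3 * k + 1) div 3 = k" for k :: nat
    by presburger+
  then have "u (3 * k) = a k \<and> u (3 * k + 1) = b k \<and> u (3 * k + 2) = c k" for k
    by (simp add: u_def)
  then show ?thesis using abc by (intro exI[of _ u]) (simp add: of_rat_rat_at)
qed

text \<open>A name that uses only half of the admissible tolerance shares every prefix with names of
  all nearby reals.\<close>

lemma robust_name:
  "\<exists>p. cauchy_rep p x \<and> (\<forall>T. \<exists>e>0. \<forall>z. \<bar>z - x\<bar> < e \<longrightarrow>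
     (\<exists>p'. cauchy_rep p' z \<and> (\<forall>i<T. p' i = p i)))"
proof -
  obtain u where u: "\<And>k. \<bar>x - real_of_rat (rat_at u k)\<bar> \<le> 1 / 2 ^ Suc k" using approx_seq by blast
  obtain p where p: "encodes p u" using encodes_exists by blast
  have "(1::real) / 2 ^ Suc k \<le> 1 / 2 ^ k" for k by (simp add: frac_le)
  then have "cauchy_rep p x"
    unfolding cauchy_rep_def using p u by (meson order.trans)
  \<comment> \<open>The first \<open>T\<close> triples are kept from \<open>x\<close> and the others
    taken from \<open>z\<close>. For \<open>k < T\<close> the distance from \<open>z\<close> to
    \<open>x\<close> uses up the spare half of the tolerance.\<close>
  moreover have "\<exists>p'. cauchy_rep p' z \<and> (\<forall>i<T. p' i = p i)" if z: "\<bar>z - x\<bar> < 1 / 2 ^ Suc T" for T z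
  proof -
    obtain v where v: "\<And>k. \<bar>z - real_of_rat (rat_at v k)\<bar> \<le> 1 / 2 ^ Suc k" using approx_seq by blast
    define u' where "u' i = (if i < 3 * T then u i else v i)" for i
    obtain p' where p': "encodes p' u'" using encodes_exists by blast
    have "\<bar>z - real_of_rat (rat_at u' k)\<bar> \<le> 1 / 2 ^ k" for k
    proof (cases "k < T")
      case True
      then have "rat_at u' k = rat_at u k" by (simp add: rat_at_def u'_def)
      moreover have "(1::real) / 2 ^ Suc T \<le> 1 / 2 ^ Suc k"
        using True by (intro divide_left_mono power_increasing) auto
      then have "\<bar>z - x\<bar> \<le> 1 / 2 ^ Suc k" using z by (meson less_imp_le order.trans)
      ultimately have "\<bar>z - real_of_rat (rat_at u' k)\<bar> \<le> 1 / 2 ^ Suc k + 1 / 2 ^ Suc k"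
        using abs_triangle[OF _ u[of k]] by metis
      then show ?thesis by simp
    next
      case False
      then have "rat_at u' k = rat_at v k" by (simp add: rat_at_def u'_def)
      moreover have "(1::real) / 2 ^ Suc k \<le> 1 / 2 ^ k" by (simp add: frac_le)
      ultimately show ?thesis using v[of k] by (metis order.trans)
    qed
    then have "cauchy_rep p' z" using p' unfolding cauchy_rep_def by blast
    moreover have "p' i = p i" if "i < T" for i
    proof -
      have "enc u' T = enc u T" by (intro enc_cong) (simp add: u'_def)
      moreover have "i < length (enc u T)" using that length_enc_ge[of T u] by simp
      ultimately show ?thesis using encodes_nth[OF p, of i T] encodes_nth[OF p', of i T] by simp
    qed
    ultimately show ?thesis by blast
  qed
  ultimately show ?thesis
    by (intro exI[of _ p] conjI allI) (auto intro!: exI[of _ "1 / 2 ^ Suc _"])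
qed

lemma robust_name_pow:
  assumes d: "d \<ge> 1" and x: "x \<in> topspace (Euclidean_space d)"
  shows "\<exists>p. cauchy_rep_pow d p x \<and> (\<forall>T. \<exists>e>0. \<forall>z\<in>topspace (Euclidean_space d).
     (\<forall>k<d. \<bar>z k - x k\<bar> < e) \<longrightarrow> (\<exists>p'. cauchy_rep_pow d p' z \<and> (\<forall>i<T. p' i = p i)))"
proof -
  obtain P where P: "\<forall>k. cauchy_rep (P k) (x k) \<and> (\<forall>T. \<exists>e>0. \<forall>z. \<bar>z - x k\<bar> < e \<longrightarrow>
      (\<exists>p'. cauchy_rep p' z \<and> (\<forall>i<T. p' i = P k i)))"
    using choice[of "\<lambda>k p. cauchy_rep p (x k) \<and> (\<forall>T. \<exists>e>0. \<forall>z. \<bar>z - x k\<bar> < e \<longrightarrow>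
      (\<exists>p'. cauchy_rep p' z \<and> (\<forall>i<T. p' i = p i)))"] robust_name by blast
  then have P: "\<And>k. cauchy_rep (P k) (x k)"
    "\<And>k T. \<exists>e>0. \<forall>z. \<bar>z - x k\<bar> < e \<longrightarrow> (\<exists>p'. cauchy_rep p' z \<and> (\<forall>i<T. p' i = P k i))"
    by blast+
  obtain e where e: "\<And>k T. e k T > (0::real)"
    "\<And>k T z. \<bar>z - x k\<bar> < e k T \<Longrightarrow> \<exists>p'. cauchy_rep p' z \<and> (\<forall>i<T. p' i = P k i)"
    using P(2) by metis
  have merge: "cauchy_rep_pow d (\<lambda>i. Q (i mod d) (i div d)) y"
    if "y \<in> topspace (Euclidean_space d)" "\<And>k. k < d \<Longrightarrow> cauchy_rep (Q k) (y k)" for Q y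
    using that by (simp add: cauchy_rep_pow_def)
  show ?thesis
  proof (intro exI[of _ "\<lambda>i. P (i mod d) (i div d)"] conjI allI)
    show "cauchy_rep_pow d (\<lambda>i. P (i mod d) (i div d)) x" using merge[of x P] P(1) x by blast
    fix T
    define r where "r = Min (insert 1 ((\<lambda>k. e k T) ` {..<d}))"
    have r: "r > 0" "\<And>k. k < d \<Longrightarrow> r \<le> e k T" using e(1) by (auto simp: r_def)
    have "\<exists>p'. cauchy_rep_pow d p' z \<and> (\<forall>i<T. p' i = P (i mod d) (i div d))"
      if z: "z \<in> topspace (Euclidean_space d)" "\<forall>k<d. \<bar>z k - x k\<bar> < r" for z
    proof -
      have "\<exists>p'. k < d \<longrightarrow> cauchy_rep p' (z k) \<and> (\<forall>i<T. p' i = P k i)" for k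
        using e(2)[of "z k" k T] r(2)[of k] z(2) by force
      then obtain Q where Q: "\<And>k. k < d \<Longrightarrow> cauchy_rep (Q k) (z k)" "\<And>k i. k < d \<Longrightarrow> i < T \<Longrightarrow> Q k i = P k i"
        by metis
      have "Q (i mod d) (i div d) = P (i mod d) (i div d)" if "i < T" for i
        using d that by (intro Q(2)) (auto intro: le_less_trans[OF div_le_dividend])
      then show ?thesis using merge[OF z(1) Q(1)] by blast
    qed
    then show "\<exists>e>0. \<forall>z\<in>topspace (Euclidean_space d). (\<forall>k<d. \<bar>z k - x k\<bar> < e) \<longrightarrow>
        (\<exists>p'. cauchy_rep_pow d p' z \<and> (\<forall>i<T. p' i = P (i mod d) (i div d)))"
      using r(1) by blast
  qed
qed

text \<open>A prefix covering the first \<open>3 * K + 3\<close> blocks fixes the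
  \<open>K\<close>-th rational, which is within \<open>1 / 2 ^ K\<close> of both reals.\<close>

lemma name_prefix_determines:
  assumes "cauchy_rep q b"
  shows "\<exists>T. \<forall>q' b'. cauchy_rep q' b' \<and> (\<forall>i<T. q' i = q i) \<longrightarrow> \<bar>b' - b\<bar> \<le> 2 / 2 ^ K"
proof -
  obtain u where u: "encodes q u" "\<And>k. \<bar>b - real_of_rat (rat_at u k)\<bar> \<le> 1 / 2 ^ k"
    using assms by (auto simp: cauchy_rep_def)
  have "\<bar>b' - b\<bar> \<le> 2 / 2 ^ K" if q': "cauchy_rep q' b'" "\<forall>i<length (enc u (3 * K + 3)). q' i = q i" for q' b'
  proof -
    obtain u' where u': "encodes q' u'" "\<And>k. \<bar>b' - real_of_rat (rat_at u' k)\<bar> \<le> 1 / 2 ^ k"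
      using q'(1) by (auto simp: cauchy_rep_def)
    have "u' i = u i" if "i < 3 * K + 3" for i
      using encodes_prefix[OF u(1) u'(1) _ that] q'(2) by blast
    then have "rat_at u' K = rat_at u K" by (simp add: rat_at_def)
    then have "\<bar>b' - b\<bar> \<le> 1 / 2 ^ K + 1 / 2 ^ K"
      using abs_triangle[OF u'(2)[of K], of b "1 / 2 ^ K"] u(2)[of K] by (simp add: abs_minus_commute)
    then show ?thesis by simp
  qed
  then show ?thesis by blast
qed

lemma name_prefix_determines_pow:
  assumes "cauchy_rep_pow n q b"
  shows "\<exists>T. \<forall>q' b'. cauchy_rep_pow n q' b' \<and> (\<forall>i<T. q' i = q i) \<longrightarrow> (\<forall>k<n. \<bar>b' k - b k\<bar> \<le> 2 / 2 ^ K)"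
proof -
  have "\<exists>T. k < n \<longrightarrow> (\<forall>q' b'. cauchy_rep q' b' \<and> (\<forall>i<T. q' i = q (n * i + k)) \<longrightarrow> \<bar>b' - b k\<bar> \<le> 2 / 2 ^ K)" for k
    using assms name_prefix_determines[of "\<lambda>i. q (n * i + k)" "b k" K] by (auto simp: cauchy_rep_pow_def)
  then obtain T where T: "\<And>k q' b'. k < n \<Longrightarrow> cauchy_rep q' b' \<Longrightarrow> (\<forall>i<T k. q' i = q (n * i + k)) \<Longrightarrow> \<bar>b' - b k\<bar> \<le> 2 / 2 ^ K"
    by metis
  \<comment> \<open>Symbol \<open>i\<close> of component \<open>k\<close> sits at position
    \<open>n * i + k\<close>; this bound covers all positions with \<open>i < T k\<close>.\<close>
  define S where "S = n * (\<Sum>k<n. T k) + n"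
  have "\<bar>b' k - b k\<bar> \<le> 2 / 2 ^ K" if q': "cauchy_rep_pow n q' b'" "\<forall>i<S. q' i = q i" and k: "k < n" for q' b' k
  proof (rule T[OF k, of "\<lambda>i. q' (n * i + k)"])
    show "cauchy_rep (\<lambda>i. q' (n * i + k)) (b' k)" using q'(1) k by (simp add: cauchy_rep_pow_def)
    have "n * i + k < S" if "i < T k" for i
    proof -
      have "T k \<le> (\<Sum>k<n. T k)" using k by (intro member_le_sum) auto
      then have "n * i \<le> n * (\<Sum>k<n. T k)" using that by (intro mult_le_mono2) simp
      then show ?thesis using k unfolding S_def by linarith
    qed
    then show "\<forall>i<T k. q' (n * i + k) = q (n * i + k)" using q'(2) by blast
  qed
  then show ?thesis by blast
qed

section \<open>Computable multivalued maps are continuous on each piece\<close>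

lemma t2_run_Suc: "t2_run M xs (Suc t) = t2_step M xs (t2_run M xs t)"
  by (simp add: t2_run_def)

lemma t2_step_written: "\<exists>zs. written (t2_step M xs c) = written c @ zs"
  by (auto simp: t2_step_def split: prod.splits)

lemma t2_written_mono: "t \<le> t' \<Longrightarrow> \<exists>zs. written (t2_run M xs t') = written (t2_run M xs t) @ zs"
proof (induction t' rule: dec_induct)
  case (step t')
  then show ?case using t2_step_written[of M xs "t2_run M xs t'"] by (auto simp: t2_run_Suc)
qed simp

lemma t2_written_nth_mono:
  assumes "t \<le> t'" "i < length (written (t2_run M xs t))"
  shows "i < length (written (t2_run M xs t'))" "written (t2_run M xs t') ! i = written (t2_run M xs t) ! i"
  using t2_written_mono[OF assms(1), of M xs] assms(2) by (auto simp: nth_append)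

lemma t2_outputs_prefix:
  assumes "t2_outputs M xs q"
  shows "\<exists>t. \<forall>i<T. i < length (written (t2_run M xs t)) \<and> written (t2_run M xs t) ! i = q i"
proof -
  obtain f where f: "\<And>i. i < length (written (t2_run M xs (f i)))" "\<And>i. written (t2_run M xs (f i)) ! i = q i"
    using assms unfolding t2_outputs_def by metis
  have "i < length (written (t2_run M xs (\<Sum>i<T. f i))) \<and> written (t2_run M xs (\<Sum>i<T. f i)) ! i = q i"
    if "i < T" for i
  proof -
    have "f i \<le> (\<Sum>i<T. f i)" using that by (intro member_le_sum) auto
    from t2_written_nth_mono[OF this f(1)] show ?thesis using f(2)[of i] by simp
  qed
  then show ?thesis by blast
qed

lemma t2_in_pos_le: "i \<in> set (in_pos (t2_run M xs t)) \<Longrightarrow> i \<le> t"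
proof (induction t arbitrary: i)
  case 0
  then show ?case by (simp add: t2_run_def t2_init_def)
next
  case (Suc t)
  obtain s' adv acts e where tr: "trans M (state (t2_run M xs t))
      (map2 (\<lambda>x i. x i) xs (in_pos (t2_run M xs t))) (map (\<lambda>(t, h). t h) (work (t2_run M xs t))) = (s', adv, acts, e)"
    by (metis prod_cases4)
  then have "i \<in> set (map2 (\<lambda>i b. if b then Suc i else i) (in_pos (t2_run M xs t)) adv)"
    using Suc.prems by (simp add: t2_run_Suc t2_step_def)
  then obtain j b where "j \<in> set (in_pos (t2_run M xs t))" "i = (if b then Suc j else j)"
    by (auto dest: set_zip_leftD)
  then show ?case using Suc.IH[of j] by auto
qed

text \<open>Heads advance at most one cell per step, so \<open>T\<close> steps see no input symbol
  from position \<open>T\<close> on.\<close>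

lemma t2_run_cong:
  assumes "\<And>i. i < T \<Longrightarrow> p' i = p i" "t \<le> T"
  shows "t2_run M [omega_tape p', w] t = t2_run M [omega_tape p, w] t"
  using \<open>t \<le> T\<close>
proof (induction t)
  case (Suc t)
  let ?c = "t2_run M [omega_tape p, w] t"
  have "map2 (\<lambda>x i. x i) [omega_tape p', w] (in_pos ?c) = map2 (\<lambda>x i. x i) [omega_tape p, w] (in_pos ?c)"
  proof (cases "in_pos ?c")
    case (Cons i js)
    then have "i \<le> t" using t2_in_pos_le[of i M _ t] by (metis list.set_intros(1))
    then have "i < T" using Suc.prems by simp
    then show ?thesis using assms(1) by (cases js) (auto simp: Cons omega_tape_def)
  qed simp
  then show ?case using Suc by (simp add: t2_run_Suc t2_step_def)
qed (simp add: t2_run_def)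

text \<open>The witness is the value \<open>b\<close> computed from a robust name of
  \<open>a\<close>. A prefix of the output that fixes \<open>b\<close> up to \<open>e\<close> is
  written after finitely many steps and depends on a prefix of the name only. Points of
  \<open>D\<close> near \<open>a\<close> have names with that prefix and share the advice word
  \<open>w\<close>, so the machine writes the same prefix for them.\<close>

lemma computable_imp_continuous:
  assumes d: "d \<ge> 1"
    and part: "partition_on (mv_dom f) \<Delta>" and dom: "mv_dom f \<subseteq> topspace (Euclidean_space d)"
    and comp: "computable_with_advice f (cauchy_rep_pow d) (cauchy_rep_pow n) \<Delta>"
    and D: "D \<in> \<Delta>"
  shows "mv_continuous (Euclidean_space d) (Euclidean_space n) (mv_restrict f D)"
proof -
  obtain \<delta> M where \<delta>: "notation_of \<delta> \<Delta>" and M: "\<And>D a p w. D \<in> \<Delta> \<Longrightarrow> a \<in> D \<Longrightarrow> cauchy_rep_pow d p a \<Longrightarrow>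
      \<delta> w = Some D \<Longrightarrow> \<exists>q. t2_outputs M [omega_tape p, word_tape w] q \<and> (\<exists>b\<in>f a. cauchy_rep_pow n q b)"
    using comp unfolding computable_with_advice_def by metis
  obtain w where w: "\<delta> w = Some D" using \<delta> D by (auto simp: notation_of_def ran_def)
  have Dsub: "D \<subseteq> mv_dom f" using part D by (auto simp: partition_on_def)
  then have domD: "mv_dom (mv_restrict f D) = D" by (auto simp: mv_dom_def mv_restrict_def)
  have "mv_continuous_at (Euclidean_space d) (Euclidean_space n) (mv_restrict f D) a" if a: "a \<in> D" for a
  proof -
    have at: "a \<in> topspace (Euclidean_space d)" using a Dsub dom by blast
    obtain p where p: "cauchy_rep_pow d p a" and rob: "\<And>T. \<exists>e>0. \<forall>z\<in>topspace (Euclidean_space d).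
     (\<forall>k<d. \<bar>z k - a k\<bar> < e) \<longrightarrow> (\<exists>p'. cauchy_rep_pow d p' z \<and> (\<forall>i<T. p' i = p i))"
      using robust_name_pow[OF d at] by blast
    obtain q b where q: "t2_outputs M [omega_tape p, word_tape w] q" "b \<in> f a" "cauchy_rep_pow n q b"
      using M[OF D a p w] by blast
    have "\<exists>U. openin (Euclidean_space d) U \<and> a \<in> U \<and> (\<forall>z\<in>U \<inter> D. f z \<inter> V \<noteq> {})"
      if V: "openin (Euclidean_space n) V" "b \<in> V" for V
    proof -
      obtain e where e: "e > 0" "\<And>y. y \<in> topspace (Euclidean_space n) \<Longrightarrow> \<forall>k<n. \<bar>y k - b k\<bar> < e \<Longrightarrow> y \<in> V"
        using openin_contains_box[OF V] by blast
      obtain K where "(1 / 2) ^ K < e / 2"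
        using real_arch_pow_inv[of "e / 2" "1 / 2"] e(1) by auto
      moreover have "2 / 2 ^ K = 2 * (1 / 2 :: real) ^ K" by (simp add: power_one_over)
      ultimately have K: "2 / 2 ^ K < e" by linarith
      obtain T where T: "\<forall>q' b'. cauchy_rep_pow n q' b' \<and> (\<forall>i<T. q' i = q i) \<longrightarrow> (\<forall>k<n. \<bar>b' k - b k\<bar> \<le> 2 / 2 ^ K)"
        using name_prefix_determines_pow[OF q(3), of K] by (rule exE)
      obtain t where t: "\<forall>i<T. i < length (written (t2_run M [omega_tape p, word_tape w] t)) \<and>
          written (t2_run M [omega_tape p, word_tape w] t) ! i = q i"
        using t2_outputs_prefix[OF q(1), of T] by (rule exE)
      obtain r where r: "r > 0" "\<forall>z\<in>topspace (Euclidean_space d).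
         (\<forall>k<d. \<bar>z k - a k\<bar> < r) \<longrightarrow> (\<exists>p'. cauchy_rep_pow d p' z \<and> (\<forall>i<t. p' i = p i))"
        using rob[of t] by (elim exE conjE)
      define U where "U = {z \<in> topspace (Euclidean_space d). \<forall>k<d. \<bar>z k - a k\<bar> < r}"
      have "f z \<inter> V \<noteq> {}" if z: "z \<in> U" "z \<in> D" for z
      proof -
        have "z \<in> topspace (Euclidean_space d)" "\<forall>k<d. \<bar>z k - a k\<bar> < r" using z(1) by (auto simp: U_def)
        with r(2) obtain p' where p': "cauchy_rep_pow d p' z" "\<forall>i<t. p' i = p i" by metis
        obtain q' b' where q': "t2_outputs M [omega_tape p', word_tape w] q'" "b' \<in> f z" "cauchy_rep_pow n q' b'"
          using M[OF D z(2) p'(1) w] by blast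
        obtain t' where t': "\<forall>i<T. i < length (written (t2_run M [omega_tape p', word_tape w] t')) \<and>
          written (t2_run M [omega_tape p', word_tape w] t') ! i = q' i"
          using t2_outputs_prefix[OF q'(1), of T] by (rule exE)
        have run: "t2_run M [omega_tape p', word_tape w] t = t2_run M [omega_tape p, word_tape w] t"
          using p'(2) by (intro t2_run_cong[of t]) auto
        have "q' i = q i" if "i < T" for i
        proof (cases "t \<le> t'")
          case True
          then show ?thesis
            using t2_written_nth_mono(2)[OF True, of i M "[omega_tape p', word_tape w]"] t t' that run by simp
        next
          case False
          then show ?thesis
            using t2_written_nth_mono(2)[of t' t i M "[omega_tape p', word_tape w]"] t t' that run by simp
        qed
        then have "\<forall>k<n. \<bar>b' k - b k\<bar> \<le> 2 / 2 ^ K" using T q'(3) by blast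
        then have "b' \<in> V" using K q'(3) by (intro e(2)) (auto simp: cauchy_rep_pow_def intro: le_less_trans)
        then show ?thesis using q'(2) by blast
      qed
      then show ?thesis
        using openin_box at r(1) by (intro exI[of _ U]) (auto simp: U_def)
    qed
    then show ?thesis
      unfolding mv_continuous_at_def domD using q(2) a
      by (intro bexI[of _ b]) (auto simp: mv_restrict_def)
  qed
  then show ?thesis unfolding mv_continuous_def domD by blast
qed

text \<open>Every partition admissible for \<open>C_c\<close> is admissible for \<open>C_t\<close>,
  so the latter is an infimum over a larger set.\<close>

theorem C_t_le_C_c:
  assumes "d \<ge> 1" "mv_dom f \<subseteq> topspace (Euclidean_space d)"
  shows "C_t (Euclidean_space d) (Euclidean_space n) f \<le> C_c f (cauchy_rep_pow d) (cauchy_rep_pow n)"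
  unfolding C_t_def C_c_def
  using computable_imp_continuous[OF assms(1) _ assms(2)] by (intro INF_superset_mono) auto

section \<open>Certified approximate eigenvectors\<close>

text \<open>An entry of the matrix \<open>R (A - mu) + V^T V - 1\<close>, where \<open>V\<close>
  consists of the first \<open>kk\<close> rows of \<open>U\<close>.\<close>

definition cert :: "nat \<Rightarrow> (nat \<Rightarrow> real) \<Rightarrow> nat \<Rightarrow> real \<Rightarrow> (nat \<Rightarrow> nat \<Rightarrow> real) \<Rightarrow> (nat \<Rightarrow> nat \<Rightarrow> real) \<Rightarrow> nat \<Rightarrow> nat \<Rightarrow> real" where
  "cert n a kk mu R U i l = (\<Sum>m<n. R i m * (smat a m l - mu * (if m = l then 1 else 0)))
     + (\<Sum>r<n. (if r < kk then 1 else 0) * (U r i * U r l)) - (if i = l then 1 else 0)"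

text \<open>A bound for the absolute row sums of \<open>R\<close>. Since \<open>1 + x * x\<close>
  replaces the absolute value of \<open>x\<close>, ring operations suffice, and the program can
  evaluate it exactly.\<close>

definition rho :: "nat \<Rightarrow> (nat \<Rightarrow> nat \<Rightarrow> real) \<Rightarrow> real" where
  "rho n R = (\<Sum>i<n. \<Sum>m<n. 1 + R i m * R i m)"

definition resid :: "nat \<Rightarrow> (nat \<Rightarrow> real) \<Rightarrow> real \<Rightarrow> (nat \<Rightarrow> real) \<Rightarrow> nat \<Rightarrow> real" where
  "resid n a mu v i = (\<Sum>l<n. (smat a i l - mu * (if i = l then 1 else 0)) * v l)"

definition bulk :: "nat \<Rightarrow> (nat \<Rightarrow> real) \<Rightarrow> real" where
  "bulk n v = (\<Sum>l<n. 1 + v l * v l)"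

text \<open>\<open>R\<close> and the first \<open>kk\<close> rows of \<open>U\<close> certify that at most \<open>kk\<close> eigenvalues of the matrix are near
  \<open>mu\<close>, since a vector annihilated by these rows and almost annihilated by \<open>smat a - mu\<close> is zero.
  The vector \<open>v\<close> is almost annihilated by \<open>smat a - mu\<close> and close to its predecessor \<open>y\<close>.
  \<open>P = 0\<close> stands for the first step, which has no predecessor, and \<open>a k\<close> is the \<open>k\<close>-th entry up to
  an error of \<open>1 / W k\<close>.\<close>

definition accept :: "nat \<Rightarrow> (nat \<Rightarrow> real) \<Rightarrow> (nat \<Rightarrow> nat) \<Rightarrow> nat \<Rightarrow> nat \<Rightarrow> (nat \<Rightarrow> real) \<Rightarrow> real \<Rightarrow>
    (nat \<Rightarrow> real) \<Rightarrow> (nat \<Rightarrow> nat \<Rightarrow> real) \<Rightarrow> (nat \<Rightarrow> nat \<Rightarrow> real) \<Rightarrow> nat \<Rightarrow> bool" where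
  "accept n a W kk P y mu v R U E \<longleftrightarrow>
     (\<forall>k<n * (n + 1) div 2. Suc E \<le> W k) \<and>
     (\<forall>s\<in>{1, -1}. \<forall>i<n. \<forall>l<n. s * cert n a kk mu R U i l + rho n R * (1 / (real E + 1)) \<le> 1 / (4 * real n)) \<and>
     (\<forall>s\<in>{1, -1}. \<forall>i<n. (real P + 1) * (128 * real n ^ 3) * rho n R *
        (s * resid n a mu v i + bulk n v * (1 / (real E + 1))) \<le> 1) \<and>
     (\<forall>s\<in>{1, -1}. \<forall>i<n. 4 * real P * (s * (v i - y i)) \<le> 1) \<and>
     real n \<le> real n * real P + (\<Sum>i<n. v i * v i)"

lemma abs_le_one_plus_square: "\<bar>x\<bar> \<le> 1 + x * x" for x :: real
proof -
  have "0 \<le> (\<bar>x\<bar> - 1)\<^sup>2" by simp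
  then have "2 * \<bar>x\<bar> \<le> 1 + x * x" by (simp add: power2_eq_square algebra_simps)
  then show ?thesis by linarith
qed

lemma rho_row: "i < n \<Longrightarrow> (\<Sum>m<n. \<bar>R i m\<bar>) \<le> rho n R"
proof -
  assume "i < n"
  have "(\<Sum>m<n. \<bar>R i m\<bar>) \<le> (\<Sum>m<n. 1 + R i m * R i m)"
    by (intro sum_mono abs_le_one_plus_square)
  also have "\<dots> \<le> rho n R"
    unfolding rho_def using \<open>i < n\<close> by (intro member_le_sum[where f = "\<lambda>i. \<Sum>m<n. 1 + R i m * R i m"] sum_nonneg) auto
  finally show ?thesis .
qed

lemma rho_pos: "n \<ge> 1 \<Longrightarrow> 0 < rho n R"
  unfolding rho_def by (intro sum_pos) (auto simp: add_pos_nonneg lessThan_empty_iff)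

lemma cert_diff:
  assumes "\<And>i j. i < n \<Longrightarrow> j < n \<Longrightarrow> \<bar>smat a i j - smat A i j\<bar> \<le> \<epsilon>" "i < n" "l < n"
  shows "\<bar>cert n a kk mu R U i l - cert n A kk mu R U i l\<bar> \<le> rho n R * \<epsilon>"
proof -
  have "cert n a kk mu R U i l - cert n A kk mu R U i l = (\<Sum>m<n. R i m * (smat a m l - smat A m l))"
    unfolding cert_def by (simp add: sum_subtractf algebra_simps)
  also have "\<bar>\<dots>\<bar> \<le> (\<Sum>m<n. \<bar>R i m\<bar> * \<epsilon>)"
    using assms by (intro order.trans[OF sum_abs] sum_mono) (auto simp: abs_mult intro: mult_left_mono)
  also have "\<dots> = (\<Sum>m<n. \<bar>R i m\<bar>) * \<epsilon>" by (simp add: sum_distrib_right)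
  also have "\<dots> \<le> rho n R * \<epsilon>"
    using rho_row[OF assms(2)] assms(1)[OF assms(2) assms(2)] by (intro mult_right_mono) auto
  finally show ?thesis .
qed

lemma resid_diff:
  assumes "\<And>i j. i < n \<Longrightarrow> j < n \<Longrightarrow> \<bar>smat a i j - smat A i j\<bar> \<le> \<epsilon>" "i < n"
  shows "\<bar>resid n a mu v i - resid n A mu v i\<bar> \<le> bulk n v * \<epsilon>"
proof -
  have "resid n a mu v i - resid n A mu v i = (\<Sum>l<n. (smat a i l - smat A i l) * v l)"
    unfolding resid_def by (simp add: sum_subtractf[symmetric] algebra_simps)
  also have "\<bar>\<dots>\<bar> \<le> (\<Sum>l<n. (1 + v l * v l) * \<epsilon>)"
  proof (intro order.trans[OF sum_abs] sum_mono)
    fix l assume "l \<in> {..<n}"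
    then have "\<bar>smat a i l - smat A i l\<bar> * \<bar>v l\<bar> \<le> \<epsilon> * (1 + v l * v l)"
      using assms by (intro mult_mono abs_le_one_plus_square) (auto intro: order.trans[OF abs_ge_zero])
    then show "\<bar>(smat a i l - smat A i l) * v l\<bar> \<le> (1 + v l * v l) * \<epsilon>" by (simp add: abs_mult mult.commute)
  qed
  finally show ?thesis by (simp add: bulk_def sum_distrib_right)
qed

lemma smat_near:
  assumes "\<And>k. k < n * (n + 1) div 2 \<Longrightarrow> \<bar>a k - A k\<bar> * real (W k) \<le> 1 \<and> Suc E \<le> W k" "i < n" "j < n"
  shows "\<bar>smat a i j - smat A i j\<bar> \<le> 1 / (real E + 1)"
proof -
  let ?k = "upper_index (min i j) (max i j)"
  have k: "?k < n * (n + 1) div 2" using assms(2,3) by (intro upper_index_less) auto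
  have "\<bar>a ?k - A ?k\<bar> * (real E + 1) \<le> \<bar>a ?k - A ?k\<bar> * real (W ?k)"
    using assms(1)[OF k] by (intro mult_left_mono) auto
  then have "\<bar>a ?k - A ?k\<bar> * (real E + 1) \<le> 1" using assms(1)[OF k] by linarith
  then show ?thesis by (simp add: smat_def field_simps)
qed

text \<open>The tests are run on approximate entries \<open>a\<close>; the error terms in
  \<open>accept\<close> absorb the distance to the true entries \<open>A\<close>, so the bounds
  carry over to \<open>A\<close>.\<close>

lemma accept_exact:
  assumes n: "n \<ge> 1" and acc: "accept n a W kk P y mu v R U E"
    and near: "\<forall>k<n * (n + 1) div 2. \<bar>a k - A k\<bar> * real (W k) \<le> 1"
  shows "\<And>i l. i < n \<Longrightarrow> l < n \<Longrightarrow> \<bar>cert n A kk mu R U i l\<bar> \<le> 1 / (4 * real n)"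
    and "\<And>i. i < n \<Longrightarrow> (real P + 1) * (128 * real n ^ 3) * rho n R * \<bar>resid n A mu v i\<bar> \<le> 1"
    and "\<And>i. i < n \<Longrightarrow> 4 * real P * \<bar>v i - y i\<bar> \<le> 1"
    and "real n \<le> real n * real P + (\<Sum>i<n. v i * v i)"
proof -
  define \<epsilon> where "\<epsilon> = 1 / (real E + 1)"
  have sm: "\<And>i j. i < n \<Longrightarrow> j < n \<Longrightarrow> \<bar>smat a i j - smat A i j\<bar> \<le> \<epsilon>"
    unfolding \<epsilon>_def using near acc by (intro smat_near[where W = W]) (auto simp: accept_def)
  show "\<bar>cert n A kk mu R U i l\<bar> \<le> 1 / (4 * real n)" if i: "i < n" "l < n" for i l
  proof -
    have c: "s * cert n a kk mu R U i l + rho n R * \<epsilon> \<le> 1 / (4 * real n)" if "s \<in> {1, -1}" for s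
      using acc i that unfolding accept_def \<epsilon>_def by blast
    show ?thesis using c[of 1] c[of "-1"] cert_diff[OF sm i, of kk mu R U] by simp
  qed
  show "(real P + 1) * (128 * real n ^ 3) * rho n R * \<bar>resid n A mu v i\<bar> \<le> 1" if i: "i < n" for i
  proof -
    let ?F = "(real P + 1) * (128 * real n ^ 3) * rho n R"
    have c: "?F * (s * resid n a mu v i + bulk n v * \<epsilon>) \<le> 1" if "s \<in> {1, -1}" for s
      using acc i that unfolding accept_def \<epsilon>_def by blast
    have F: "?F \<ge> 0" using rho_pos[OF n, of R] by simp
    have "\<bar>resid n A mu v i\<bar> \<le> max (resid n a mu v i + bulk n v * \<epsilon>) (- resid n a mu v i + bulk n v * \<epsilon>)"
      using resid_diff[OF sm i, of mu v] by linarith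
    then have "?F * \<bar>resid n A mu v i\<bar> \<le> ?F * max (resid n a mu v i + bulk n v * \<epsilon>) (- resid n a mu v i + bulk n v * \<epsilon>)"
      using F by (rule mult_left_mono)
    also have "\<dots> \<le> 1" using c[of 1] c[of "-1"] by (simp add: max_def)
    finally show ?thesis .
  qed
  show "4 * real P * \<bar>v i - y i\<bar> \<le> 1" if i: "i < n" for i
  proof -
    have c: "4 * real P * (s * (v i - y i)) \<le> 1" if "s \<in> {1, -1}" for s
      using acc i that unfolding accept_def by blast
    show ?thesis using c[of 1] c[of "-1"] by (simp add: abs_if)
  qed
  show "real n \<le> real n * real P + (\<Sum>i<n. v i * v i)" using acc unfolding accept_def by blast
qed

lemma eigen_resid:
  assumes e: "eigenbasis n (smat A) b lam" and "i < n"
  shows "ip n (b i) (resid n A mu x) = (lam i - mu) * ip n (b i) x"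
proof -
  have "resid n A mu x k = mv n (smat A) x k - mu * x k" if "k < n" for k
    using that by (simp add: resid_def mv_def algebra_simps sum_subtractf if_distrib[of "\<lambda>c. _ * (_ * c)"] cong: if_cong)
  then have "ip n (b i) (resid n A mu x) = ip n (b i) (\<lambda>k. mv n (smat A) x k - mu * x k)"
    by (intro ip_cong) auto
  then show ?thesis
    using eigenbasis_ip_mv[OF e _ \<open>i < n\<close>, of x] smat_sym by (simp add: ip_simps algebra_simps)
qed

lemma cert_apply:
  "(\<Sum>l<n. cert n A kk mu R U i l * x l) =
     (\<Sum>m<n. R i m * resid n A mu x m) + (\<Sum>r<n. (if r < kk then 1 else 0) * (U r i * ip n (U r) x))
     - (if i < n then x i else 0)"
proof -
  have "(\<Sum>l<n. (\<Sum>m<n. R i m * (smat A m l - mu * (if m = l then 1 else 0))) * x l) = (\<Sum>m<n. R i m * resid n A mu x m)"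
    unfolding resid_def sum_distrib_left sum_distrib_right by (subst sum.swap) (simp add: mult.assoc)
  moreover have "(\<Sum>l<n. (\<Sum>r<n. (if r < kk then 1 else 0) * (U r i * U r l)) * x l) =
      (\<Sum>r<n. (if r < kk then 1 else 0) * (U r i * ip n (U r) x))"
    unfolding ip_def sum_distrib_left sum_distrib_right by (subst sum.swap) (simp add: mult.assoc)
  moreover have "(\<Sum>l<n. (if i = l then 1 else 0) * x l) = (if i < n then x i else 0)"
  proof -
    have "(\<Sum>l<n. (if i = l then 1 else 0) * x l) = (\<Sum>l<n. if l = i then x l else 0)" by (intro sum.cong) auto
    then show ?thesis by simp
  qed
  ultimately show ?thesis
    unfolding cert_def by (simp add: algebra_simps sum.distrib sum_subtractf)
qed

text \<open>The natural bound \<open>n * h * h\<close> is weakened to a perfect square, so that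
  later comparisons of norms need no square roots.\<close>

lemma ip_self_le:
  assumes "\<And>i. i < n \<Longrightarrow> \<bar>x i\<bar> \<le> h" "0 \<le> h"
  shows "ip n x x \<le> (real n * h)\<^sup>2"
proof -
  have "x i * x i \<le> h * h" if "i < n" for i
    using mult_mono[OF assms(1)[OF that] assms(1)[OF that]] assms(2) by simp
  then have "ip n x x \<le> (\<Sum>i<n. h * h)" unfolding ip_def by (intro sum_mono) auto
  also have "\<dots> = real n * (h * h)" by simp
  also have "\<dots> \<le> real (n * n) * (h * h)"
    by (intro mult_right_mono) (auto simp del: of_nat_mult)
  finally show ?thesis by (simp add: power2_eq_square mult_ac)
qed

text \<open>With more than \<open>kk\<close> eigenvalues near \<open>mu\<close>, their eigenvectors
  span a nonzero \<open>x\<close> annihilated by the first \<open>kk\<close> rows of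
  \<open>U\<close>. Its residual is small, so the certificate nearly reads \<open>x = 0\<close>; at
  the largest entry of \<open>x\<close> this is a contradiction.\<close>

lemma few_near_eigenvalues:
  assumes n: "n \<ge> 1" and e: "eigenbasis n (smat A) b lam"
    and cert: "\<And>i l. i < n \<Longrightarrow> l < n \<Longrightarrow> \<bar>cert n A kk mu R U i l\<bar> \<le> 1 / (4 * real n)"
    and J: "J \<subseteq> {..<n}" "\<And>i. i \<in> J \<Longrightarrow> \<bar>lam i - mu\<bar> \<le> 1 / (4 * real n ^ 2 * rho n R)"
  shows "card J \<le> kk"
proof (rule ccontr)
  assume "\<not> card J \<le> kk"
  define \<delta> where "\<delta> = 1 / (4 * real n ^ 2 * rho n R)"
  have \<rho>: "rho n R > 0" by (rule rho_pos[OF n])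
  have \<delta>: "\<delta> > 0" using \<rho> n by (simp add: \<delta>_def)
  have o: "onb n b" using e by (simp add: eigenbasis_def)
  have finJ: "finite J" using J(1) finite_subset by blast
  have cJ: "card J \<le> n" using card_mono[OF _ J(1)] by simp
  have cC: "card ({..<n} - J) = n - card J" using J(1) finJ by (simp add: card_Diff_subset)
  obtain g where g: "bij_betw g {0..<n - card J} ({..<n} - J)"
    using ex_bij_betw_nat_finite[of "{..<n} - J"] unfolding cC by auto
  \<comment> \<open>The unknowns are coordinates in the eigenbasis: \<open>kk\<close> equations
    express orthogonality to the rows of \<open>U\<close>, and \<open>n - card J\<close> equations
    remove the coordinates outside \<open>J\<close>; together they are fewer than
    \<open>n\<close>.\<close>
  define row where "row r i = (if r < kk then ip n (U r) (b i) else if i = g (r - kk) then 1 else 0)" for r i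
  have "kk + (n - card J) < n" using \<open>\<not> card J \<le> kk\<close> cJ by simp
  then obtain c where c: "\<exists>i<n. c i \<noteq> 0" "\<And>r. r < kk + (n - card J) \<Longrightarrow> ip n (row r) c = 0"
    using homogeneous_system[of "kk + (n - card J)" n row] by blast
  have cU: "(\<Sum>i<n. ip n (U r) (b i) * c i) = 0" if "r < kk" for r
    using c(2)[of r] that by (simp add: ip_def row_def)
  have cJ0: "c i = 0" if "i < n" "i \<notin> J" for i
  proof -
    have "i \<in> g ` {0..<n - card J}" using that g by (simp add: bij_betw_def)
    then obtain s where s: "s < n - card J" "g s = i" by auto
    have "ip n (row (kk + s)) c = (\<Sum>j<n. if j = i then c j else 0)"
      unfolding ip_def using s by (intro sum.cong) (auto simp: row_def)
    then show ?thesis using c(2)[of "kk + s"] s(1) that(1) by simp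
  qed
  define x where "x = (\<lambda>k. \<Sum>i<n. c i * b i k)"
  have xc: "ip n (b i) x = c i" if "i < n" for i
  proof -
    have "ip n (b i) x = (\<Sum>j<n. c j * ip n (b i) (b j))"
      unfolding x_def by (simp add: ip_sum_right ip_scale_right)
    also have "\<dots> = (\<Sum>j<n. if j = i then c j else 0)"
      using that by (intro sum.cong refl) (simp add: onb_ip[OF o])
    finally show ?thesis using that by simp
  qed
  have xU: "ip n (U r) x = 0" if "r < kk" for r
    using cU[OF that] unfolding x_def by (simp add: ip_sum_right ip_scale_right mult.commute)
  define z where "z = resid n A mu x"
  have zz: "ip n z z \<le> \<delta>\<^sup>2 * ip n x x"
  proof -
    have "(ip n (b i) z)\<^sup>2 \<le> \<delta>\<^sup>2 * (c i)\<^sup>2" if "i < n" for i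
    proof (cases "i \<in> J")
      case True
      have "\<bar>lam i - mu\<bar>\<^sup>2 \<le> \<delta>\<^sup>2" using J(2)[OF True] by (intro power_mono) (auto simp: \<delta>_def)
      then show ?thesis using eigen_resid[OF e that] xc[OF that]
        by (simp add: z_def power_mult_distrib mult_right_mono)
    next
      case False
      then show ?thesis using eigen_resid[OF e that] xc[OF that] cJ0[OF that] by (simp add: z_def)
    qed
    then have "(\<Sum>i<n. (ip n (b i) z)\<^sup>2) \<le> (\<Sum>i<n. \<delta>\<^sup>2 * (c i)\<^sup>2)" by (intro sum_mono) auto
    also have "\<dots> = \<delta>\<^sup>2 * ip n x x"
      unfolding onb_parseval[OF o, of x] sum_distrib_left using xc by (intro sum.cong) auto
    finally show ?thesis unfolding onb_parseval[OF o, of z] .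
  qed
  obtain i0 where i0: "i0 < n" "\<And>i. i < n \<Longrightarrow> \<bar>x i\<bar> \<le> \<bar>x i0\<bar>"
  proof -
    define S where "S = (\<lambda>i. \<bar>x i\<bar>) ` {..<n}"
    have S: "finite S" "S \<noteq> {}" using n by (auto simp: S_def lessThan_empty_iff)
    then have "\<exists>m\<in>S. \<forall>y\<in>S. y \<le> m" using Max_in[OF S] Max_ge[OF S(1)] by blast
    then show ?thesis using that by (auto simp: S_def)
  qed
  define X where "X = \<bar>x i0\<bar>"
  have "ip n x x \<le> (real n * X)\<^sup>2" using i0(2) by (intro ip_self_le) (auto simp: X_def)
  then have zz': "ip n z z \<le> (\<delta> * (real n * X))\<^sup>2"
  proof -
    have "\<delta>\<^sup>2 * ip n x x \<le> \<delta>\<^sup>2 * (real n * X)\<^sup>2" using \<open>ip n x x \<le> (real n * X)\<^sup>2\<close> by (intro mult_left_mono) auto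
    then show ?thesis using zz unfolding power_mult_distrib[of \<delta>] by linarith
  qed
  have zm: "\<bar>z m\<bar> \<le> \<delta> * (real n * X)" if "m < n" for m
  proof -
    have "(z m)\<^sup>2 \<le> (\<delta> * (real n * X))\<^sup>2" using sq_le_ip_self[OF that, of z] zz' by linarith
    then have "\<bar>z m\<bar> \<le> \<bar>\<delta> * (real n * X)\<bar>" by (simp only: abs_le_square_iff)
    also have "\<dots> = \<delta> * (real n * X)" using \<delta> by (simp add: X_def abs_mult)
    finally show ?thesis .
  qed
  \<comment> \<open>One quarter comes from the certificate, \<open>n\<close> entries of size at most
    \<open>1 / (4 * n)\<close>; the other comes from \<open>R\<close> applied to the residual, where
    \<delta> cancels \<open>rho n R\<close>.\<close>
  have "X \<le> X / 2"
  proof -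
    have "(\<Sum>l<n. cert n A kk mu R U i0 l * x l) = (\<Sum>m<n. R i0 m * z m) - x i0"
    proof -
      have "(\<Sum>r<n. (if r < kk then 1 else 0) * (U r i0 * ip n (U r) x)) = 0" using xU by (intro sum.neutral) auto
      then show ?thesis using i0(1) by (simp add: cert_apply z_def)
    qed
    then have "X \<le> \<bar>\<Sum>l<n. cert n A kk mu R U i0 l * x l\<bar> + \<bar>\<Sum>m<n. R i0 m * z m\<bar>"
      unfolding X_def by linarith
    moreover have "\<bar>\<Sum>l<n. cert n A kk mu R U i0 l * x l\<bar> \<le> (\<Sum>l<n. 1 / (4 * real n) * X)"
    proof (intro order.trans[OF sum_abs] sum_mono)
      fix l assume "l \<in> {..<n}"
      then show "\<bar>cert n A kk mu R U i0 l * x l\<bar> \<le> 1 / (4 * real n) * X"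
        unfolding abs_mult X_def using cert[OF i0(1)] i0(2) by (intro mult_mono) auto
    qed
    moreover have "(\<Sum>l<n. 1 / (4 * real n) * X) = X / 4" using n by simp
    moreover have "\<bar>\<Sum>m<n. R i0 m * z m\<bar> \<le> X / 4"
    proof -
      have "\<bar>\<Sum>m<n. R i0 m * z m\<bar> \<le> (\<Sum>m<n. \<bar>R i0 m\<bar> * (\<delta> * (real n * X)))"
        using zm by (intro order.trans[OF sum_abs] sum_mono) (auto simp: abs_mult intro: mult_left_mono)
      also have "\<dots> = (\<Sum>m<n. \<bar>R i0 m\<bar>) * (\<delta> * (real n * X))" by (simp add: sum_distrib_right)
      also have "\<dots> \<le> rho n R * (\<delta> * (real n * X))"
        using \<delta> by (intro mult_right_mono rho_row i0) (auto simp: X_def)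
      also have "\<dots> = X / (4 * real n)" using \<rho> n by (simp add: \<delta>_def power2_eq_square)
      also have "\<dots> \<le> X / 4" using n by (intro divide_left_mono) (auto simp: X_def)
      finally show ?thesis .
    qed
    ultimately show ?thesis by linarith
  qed
  then have "X = 0" by (simp add: X_def)
  then have "x i = 0" if "i < n" for i using i0(2)[OF that] by (simp add: X_def)
  then have "c i = 0" if "i < n" for i using xc[OF that] by (simp add: ip_def)
  then show False using c(1) by blast
qed

text \<open>The invariant of the search. An accepted step moves an entry by at most
  \<open>1 / (4 * P)\<close> while \<open>P\<close> doubles, so the bound
  \<open>1 / 2 + 1 / (2 * P)\<close> renews itself and keeps the vector away from 0. The exact
  eigenvector \<open>w\<close> nearby, of multiplicity at most \<open>kk\<close>, is what makes a
  further step possible.\<close>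

definition tracked :: "nat \<Rightarrow> (nat \<Rightarrow> real) \<Rightarrow> (nat \<Rightarrow> real) \<Rightarrow> nat \<Rightarrow> nat \<Rightarrow> (nat \<Rightarrow> real) \<Rightarrow> bool" where
  "tracked n A lam kk P y \<longleftrightarrow> P = 0 \<or>
     ((\<exists>i<n. 1 / 2 + 1 / (2 * real P) \<le> \<bar>y i\<bar>) \<and>
      (\<exists>w i0. i0 < n \<and> card {i. i < n \<and> lam i = lam i0} \<le> kk \<and> (\<forall>k<n. mv n (smat A) w k = lam i0 * w k) \<and>
         (\<forall>k<n. \<bar>w k - y k\<bar> \<le> 1 / (16 * real P))))"

lemma sum_squares_entry:
  assumes "n \<ge> 1" "real n \<le> (\<Sum>i<n. v i * v i)"
  shows "\<exists>i<n. 1 \<le> \<bar>v i\<bar>"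
proof (rule ccontr)
  assume "\<not> ?thesis"
  then have "v i * v i < 1" if "i < n" for i
    using that by (metis abs_square_less_1 not_le power2_eq_square)
  then have "(\<Sum>i<n. v i * v i) < (\<Sum>i<n. 1)" using assms(1) by (intro sum_strict_mono) (auto simp: lessThan_empty_iff)
  then show False using assms(2) by simp
qed

text \<open>The new exact eigenvector is the projection of \<open>v\<close> onto the eigenvectors
  with eigenvalue near \<open>mu\<close>. Their number is at most \<open>kk < 2 * q\<close>, too few
  for two eigenvalues of multiplicity at least \<open>q\<close>. Here \<open>kk\<close> stands for
  the part of the advice read so far and \<open>kk'\<close> for all of it.\<close>

lemma accept_tracked:
  assumes n: "n \<ge> 1" and e: "eigenbasis n (smat A) b lam"
    and mult: "\<And>i. i < n \<Longrightarrow> q \<le> card {i'. i' < n \<and> lam i' = lam i}" and kk: "kk < 2 * q" "kk \<le> kk'"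
    and acc: "accept n a W kk P y mu v R U E"
    and near: "\<forall>k<n * (n + 1) div 2. \<bar>a k - A k\<bar> * real (W k) \<le> 1"
    and tr: "tracked n A lam kk' P y"
  shows "tracked n A lam kk' (2 * P + (1 - P)) v"
proof -
  note ex = accept_exact[OF n acc near]
  have o: "onb n b" using e by (simp add: eigenbasis_def)
  \<comment> \<open>With truncated subtraction this turns 0 into 1 and doubles every positive
    \<open>P\<close>; the bound \<open>P' \<le> 2 * (P + 1)\<close> covers both cases.\<close>
  define P' where "P' = 2 * P + (1 - P)"
  have P': "P' \<ge> 1" "real P' \<le> 2 * (real P + 1)" by (auto simp: P'_def)
  define \<delta> where "\<delta> = 1 / (4 * real n ^ 2 * rho n R)"
  have \<rho>: "rho n R > 0" by (rule rho_pos[OF n])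
  have \<delta>: "\<delta> > 0" using \<rho> n by (simp add: \<delta>_def)
  define J where "J = {i. i < n \<and> \<bar>lam i - mu\<bar> \<le> \<delta>}"
  have Jn: "J \<subseteq> {..<n}" "finite J" by (auto simp: J_def)
  have cJ: "card J \<le> kk"
    by (rule few_near_eigenvalues[OF n e ex(1) Jn(1)]) (auto simp: J_def \<delta>_def)
  have classJ: "{i'. i' < n \<and> lam i' = lam i} \<subseteq> J" if "i \<in> J" for i using that by (auto simp: J_def)
  have same: "lam i = lam i'" if "i \<in> J" "i' \<in> J" for i i'
  proof (rule ccontr)
    assume ne: "lam i \<noteq> lam i'"
    let ?C = "\<lambda>i. {i'. i' < n \<and> lam i' = lam i}"
    have "card (?C i) + card (?C i') = card (?C i \<union> ?C i')"
      using ne by (intro card_Un_disjoint[symmetric]) auto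
    also have "\<dots> \<le> card J" using classJ[OF that(1)] classJ[OF that(2)] Jn(2) by (intro card_mono) auto
    finally show False using mult[of i] mult[of i'] that cJ kk(1) by (auto simp: J_def)
  qed
  define c where "c i = ip n (b i) v" for i
  define w where "w = (\<lambda>k. \<Sum>i\<in>J. c i * b i k)"
  define h where "h = 1 / ((real P + 1) * (128 * real n ^ 3) * rho n R)"
  have F: "(real P + 1) * (128 * real n ^ 3) * rho n R > 0" using \<rho> n by simp
  have h: "\<bar>resid n A mu v i\<bar> \<le> h" if "i < n" for i
    using ex(2)[OF that] F unfolding h_def by (simp add: pos_le_divide_eq mult.commute)
  have h0: "h > 0" using F by (simp add: h_def)
  have zz: "ip n (resid n A mu v) (resid n A mu v) \<le> (real n * h)\<^sup>2"
    using h h0 by (intro ip_self_le) auto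
  have vw: "\<bar>v k - w k\<bar> \<le> 1 / (16 * real P')" if k: "k < n" for k
  proof -
    define y' where "y' = (\<lambda>k. \<Sum>i\<in>{..<n} - J. c i * b i k)"
    have "v k = w k + y' k"
      using onb_expand[OF o k, of v] sum.subset_diff[OF Jn(1), of "\<lambda>i. c i * b i k"]
      by (simp add: w_def y'_def c_def add.commute)
    then have "v k - w k = y' k" by simp
    have yc: "ip n (b i) y' = (if i \<in> J then 0 else c i)" if "i < n" for i
    proof -
      have "ip n (b i) y' = (\<Sum>j\<in>{..<n} - J. c j * ip n (b i) (b j))"
        unfolding y'_def by (simp add: ip_sum_right ip_scale_right)
      also have "\<dots> = (\<Sum>j\<in>{..<n} - J. if j = i then c j else 0)"
        using that by (intro sum.cong refl) (simp add: onb_ip[OF o])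
      finally show ?thesis using that by simp
    qed
    have "\<delta>\<^sup>2 * ip n y' y' \<le> ip n (resid n A mu v) (resid n A mu v)"
      unfolding onb_parseval[OF o, of y'] onb_parseval[OF o, of "resid n A mu v"] sum_distrib_left
    proof (intro sum_mono)
      fix i assume "i \<in> {..<n}"
      then have i: "i < n" by simp
      show "\<delta>\<^sup>2 * (ip n (b i) y')\<^sup>2 \<le> (ip n (b i) (resid n A mu v))\<^sup>2"
      proof (cases "i \<in> J")
        case False
        \<comment> \<open>Outside \<open>J\<close> the residual multiplies coordinates by at least
          \<delta>, so the discarded part \<open>y'\<close> is at most the residual divided by
          \<delta>.\<close>
        then have "\<delta> \<le> \<bar>lam i - mu\<bar>" using i by (auto simp: J_def)
        then have "\<delta>\<^sup>2 \<le> \<bar>lam i - mu\<bar>\<^sup>2" using \<delta> by (intro power_mono) auto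
        then show ?thesis using yc[OF i] False eigen_resid[OF e i]
          by (simp add: c_def power_mult_distrib mult_right_mono)
      qed (simp add: yc[OF i])
    qed
    also have "\<dots> \<le> (real n * h)\<^sup>2" by (rule zz)
    finally have "\<delta>\<^sup>2 * ip n y' y' \<le> (real n * h)\<^sup>2" .
    moreover have "\<delta>\<^sup>2 * (y' k)\<^sup>2 \<le> \<delta>\<^sup>2 * ip n y' y'" using sq_le_ip_self[OF k, of y'] by (intro mult_left_mono) auto
    ultimately have "(\<delta> * \<bar>y' k\<bar>)\<^sup>2 \<le> (real n * h)\<^sup>2" by (simp add: power_mult_distrib)
    moreover have "0 \<le> real n * h" using h0 by simp
    ultimately have "\<delta> * \<bar>y' k\<bar> \<le> real n * h" by (rule power2_le_imp_le)
    then have "\<bar>y' k\<bar> \<le> real n * h / \<delta>" using \<delta> by (simp add: pos_le_divide_eq mult.commute)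
    \<comment> \<open>The origin of 128: \<open>n * h / \<delta>\<close> carries the factor
      \<open>4 * n ^ 3 / (128 * n ^ 3) = 1 / 32\<close>, and \<open>P' \<le> 2 * (P + 1)\<close>
      turns 32 into the 16 of \<open>tracked\<close>.\<close>
    also have "\<dots> = 1 / (32 * (real P + 1))"
    proof -
      have "N * (1 / (p * (128 * N ^ 3) * q)) / (1 / (4 * N ^ 2 * q)) = 1 / (32 * p)"
        if "p > 0" "N > 0" "q > 0" for p N q :: real
        using that by (simp add: field_simps power2_eq_square power3_eq_cube)
      then show ?thesis using \<rho> n unfolding h_def \<delta>_def by simp
    qed
    also have "\<dots> \<le> 1 / (16 * real P')" using P' by (intro divide_left_mono) auto
    finally show ?thesis using \<open>v k - w k = y' k\<close> by simp
  qed
  have entry: "\<exists>i<n. 1 / 2 + 1 / (2 * real P') \<le> \<bar>v i\<bar>"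
  proof (cases "P = 0")
    case True
    have "\<exists>i<n. 1 \<le> \<bar>v i\<bar>" using ex(4) True by (intro sum_squares_entry[OF n]) simp
    then show ?thesis using True by (simp add: P'_def)
  next
    case False
    then obtain i where i: "i < n" "1 / 2 + 1 / (2 * real P) \<le> \<bar>y i\<bar>" using tr by (auto simp: tracked_def)
    have "\<bar>v i - y i\<bar> \<le> 1 / (4 * real P)" using ex(3)[OF i(1)] False by (simp add: field_simps)
    moreover have "1 / (2 * real P) = 1 / (4 * real P) + 1 / (4 * real P)" by simp
    moreover have "1 / (2 * real P') = 1 / (4 * real P)" using False by (simp add: P'_def)
    ultimately have "1 / 2 + 1 / (2 * real P') \<le> \<bar>v i\<bar>" using i(2) by linarith
    then show ?thesis using i(1) by blast
  qed
  \<comment> \<open>An empty \<open>J\<close> would give \<open>w = 0\<close> and make all entries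
    of \<open>v\<close> at most \<open>1 / (16 * P')\<close>, against \<open>entry\<close>.\<close>
  have "J \<noteq> {}"
  proof
    assume "J = {}"
    then have "w k = 0" for k by (simp add: w_def)
    moreover obtain i where "i < n" "1 / 2 + 1 / (2 * real P') \<le> \<bar>v i\<bar>" using entry by blast
    moreover have "1 / (16 * real P') \<le> 1 / (2 * real P')" using P' by (intro divide_left_mono) auto
    ultimately show False using vw[of i] by simp
  qed
  then obtain i0 where i0: "i0 \<in> J" by blast
  have "card {i. i < n \<and> lam i = lam i0} \<le> kk'"
    using card_mono[OF Jn(2) classJ[OF i0]] cJ kk(2) by linarith
  moreover have "mv n (smat A) w k = lam i0 * w k" if "k < n" for k
  proof -
    have "mv n (smat A) w k = (\<Sum>i\<in>J. c i * mv n (smat A) (b i) k)"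
      unfolding w_def by (simp add: mv_sum mv_scale)
    also have "\<dots> = (\<Sum>i\<in>J. lam i0 * (c i * b i k))"
    proof (intro sum.cong refl)
      fix i assume "i \<in> J"
      then have "i < n" "lam i = lam i0" using Jn(1) same[OF _ i0] by blast+
      then show "c i * mv n (smat A) (b i) k = lam i0 * (c i * b i k)"
        using e that by (simp add: eigenbasis_def)
    qed
    finally show ?thesis by (simp add: w_def sum_distrib_left)
  qed
  moreover have "\<bar>w k - v k\<bar> \<le> 1 / (16 * real P')" if "k < n" for k
    using vw[OF that] by (simp add: abs_minus_commute)
  moreover have "i0 < n" using i0 Jn(1) by auto
  ultimately show ?thesis
    unfolding tracked_def P'_def[symmetric] using entry by blast
qed

section \<open>Candidates\<close>

lemma resid_eq: "k < n \<Longrightarrow> resid n A mu x k = mv n (smat A) x k - mu * x k"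
  by (simp add: resid_def mv_def algebra_simps sum_subtractf if_distrib[of "\<lambda>c. _ * (_ * c)"] cong: if_cong)

text \<open>\<open>R\<close> inverts \<open>A - lam i0\<close> on the orthogonal complement of the
  eigenspace and is 0 on the eigenspace; the nonzero rows of \<open>U\<close> are an orthonormal
  basis of the eigenspace. The two products are complementary projections.\<close>

lemma exact_certificate:
  assumes e: "eigenbasis n (smat A) b lam" and i0: "i0 < n" "card {i. i < n \<and> lam i = lam i0} \<le> kk"
  shows "\<exists>R U. \<forall>i<n. \<forall>l<n. cert n A kk (lam i0) R U i l = 0"
proof -
  define J where "J = {i. i < n \<and> lam i = lam i0}"
  have J: "J \<subseteq> {..<n}" "finite J" by (auto simp: J_def)
  have cJ: "card J \<le> n" "card J \<le> kk" using card_mono[OF _ J(1)] i0 by (auto simp: J_def)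
  obtain g where g: "bij_betw g {0..<card J} J" using ex_bij_betw_nat_finite[OF J(2)] by blast
  define R where "R i m = (\<Sum>r\<in>{..<n} - J. b r i / (lam r - lam i0) * b r m)" for i m
  define U where "U r i = (if r < card J then b (g r) i else 0)" for r i
  have "cert n A kk (lam i0) R U i l = 0" if il: "i < n" "l < n" for i l
  proof -
    have sym: "(\<Sum>m<n. b r m * (smat A m l - lam i0 * (if m = l then 1 else 0))) = (lam r - lam i0) * b r l"
      if "r < n" for r
    proof -
      have "(\<Sum>m<n. b r m * (smat A m l - lam i0 * (if m = l then 1 else 0))) = resid n A (lam i0) (b r) l"
        unfolding resid_def by (intro sum.cong refl) (simp add: smat_sym[of A _ l] mult.commute)
      then show ?thesis using e that il(2) by (simp add: resid_eq eigenbasis_def algebra_simps)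
    qed
    have "(\<Sum>m<n. R i m * (smat A m l - lam i0 * (if m = l then 1 else 0))) =
      (\<Sum>r\<in>{..<n} - J. b r i / (lam r - lam i0) * (\<Sum>m<n. b r m * (smat A m l - lam i0 * (if m = l then 1 else 0))))"
      unfolding R_def sum_distrib_left sum_distrib_right by (subst sum.swap) (simp only: mult.assoc)
    also have "\<dots> = (\<Sum>r\<in>{..<n} - J. b r i * b r l)"
      by (intro sum.cong refl) (auto simp: sym J_def)
    finally have 1: "(\<Sum>m<n. R i m * (smat A m l - lam i0 * (if m = l then 1 else 0))) = (\<Sum>r\<in>{..<n} - J. b r i * b r l)" .
    have "(\<Sum>r<n. (if r < kk then 1 else 0) * (U r i * U r l)) = (\<Sum>r\<in>{0..<card J}. b (g r) i * b (g r) l)"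
      using cJ by (intro sum.mono_neutral_cong_right) (auto simp: U_def)
    also have "\<dots> = (\<Sum>s\<in>J. b s i * b s l)" by (rule sum.reindex_bij_betw[OF g])
    finally have 2: "(\<Sum>r<n. (if r < kk then 1 else 0) * (U r i * U r l)) = (\<Sum>s\<in>J. b s i * b s l)" .
    have "(\<Sum>r\<in>{..<n} - J. b r i * b r l) + (\<Sum>s\<in>J. b s i * b s l) = (\<Sum>r<n. b r i * b r l)"
      using sum.subset_diff[OF J(1), of "\<lambda>r. b r i * b r l"] by simp
    also have "\<dots> = (if i = l then 1 else 0)" using e il by (auto simp: eigenbasis_def onb_complete)
    finally show ?thesis unfolding cert_def 1 2 by simp
  qed
  then show ?thesis by blast
qed

text \<open>A candidate is a sequence of natural numbers. Its \<open>s\<close>-th triple denotes a rational; the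
  triples are in turn \<open>mu\<close>, \<open>v\<close>, \<open>R\<close> and \<open>U\<close>, followed by the precision and the common sum of the
  triples of \<open>v\<close>.\<close>

definition cval :: "(nat \<Rightarrow> nat) \<Rightarrow> nat \<Rightarrow> real" where
  "cval c s = frac (c (3 * s)) (c (3 * s + 1)) (c (3 * s + 2))"

abbreviation slots :: "nat \<Rightarrow> nat" where
  "slots n \<equiv> 1 + n + 2 * (n * n)"

abbreviation cmu :: "(nat \<Rightarrow> nat) \<Rightarrow> real" where "cmu c \<equiv> cval c 0"
abbreviation cv :: "(nat \<Rightarrow> nat) \<Rightarrow> nat \<Rightarrow> real" where "cv c i \<equiv> cval c (1 + i)"
abbreviation cR :: "nat \<Rightarrow> (nat \<Rightarrow> nat) \<Rightarrow> nat \<Rightarrow> nat \<Rightarrow> real" where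
  "cR n c i m \<equiv> cval c (1 + n + (i * n + m))"
abbreviation cU :: "nat \<Rightarrow> (nat \<Rightarrow> nat) \<Rightarrow> nat \<Rightarrow> nat \<Rightarrow> real" where
  "cU n c i m \<equiv> cval c (1 + n + n * n + (i * n + m))"
abbreviation cE :: "nat \<Rightarrow> (nat \<Rightarrow> nat) \<Rightarrow> nat" where "cE n c \<equiv> c (3 * slots n)"
abbreviation cK :: "nat \<Rightarrow> (nat \<Rightarrow> nat) \<Rightarrow> nat" where "cK n c \<equiv> c (3 * slots n + 1)"

lemma slot_less: "i < n \<Longrightarrow> m < n \<Longrightarrow> i * n + m < n * n" for i n m :: nat
proof -
  assume "i < n" "m < n"
  then have "i * n + m < Suc i * n" "Suc i * n \<le> n * n" using mult_le_mono1[of "Suc i" n n] by auto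
  then show ?thesis by linarith
qed

lemma floor_approx_tendsto: "(\<lambda>k. of_int \<lfloor>x * (real k + 1)\<rfloor> / (real k + 1)) \<longlonglongrightarrow> x"
proof (rule tendsto_sandwich[where h = "\<lambda>_. x"])
  have "(\<lambda>k. inverse (real (Suc k))) \<longlonglongrightarrow> 0" by (rule LIMSEQ_inverse_real_of_nat)
  then have "(\<lambda>k. x - inverse (real (Suc k))) \<longlonglongrightarrow> x - 0" by (intro tendsto_diff tendsto_const)
  then show "(\<lambda>k. x - inverse (real k + 1)) \<longlonglongrightarrow> x" by (simp add: add.commute)
  have "x - inverse (real k + 1) \<le> of_int \<lfloor>x * (real k + 1)\<rfloor> / (real k + 1)" for k
  proof -
    have "x - inverse (real k + 1) = (x * (real k + 1) - 1) / (real k + 1)" by (simp add: field_simps)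
    also have "\<dots> \<le> of_int \<lfloor>x * (real k + 1)\<rfloor> / (real k + 1)"
      by (intro divide_right_mono) linarith+
    finally show ?thesis .
  qed
  then show "\<forall>\<^sub>F k in sequentially. x - inverse (real k + 1) \<le> of_int \<lfloor>x * (real k + 1)\<rfloor> / (real k + 1)" by simp
  have "of_int \<lfloor>x * (real k + 1)\<rfloor> / (real k + 1) \<le> x" for k by (simp add: pos_divide_le_eq)
  then show "\<forall>\<^sub>F k in sequentially. of_int \<lfloor>x * (real k + 1)\<rfloor> / (real k + 1) \<le> x" by simp
qed simp

text \<open>Each approximation \<open>p / (k + 1)\<close> is written as
  \<open>((M + p) - (M - p)) / (2 * k + 2)\<close> with one \<open>M\<close> for all slots. All
  triples then have the same sum \<open>2 * M + 2 * k + 1\<close>, so their encodings have equal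
  length and can be interleaved.\<close>

lemma candidates_dense:
  "\<exists>c. (\<forall>s<S. (\<lambda>k. cval (c k) s) \<longlonglongrightarrow> x s) \<and>
     (\<forall>k. \<forall>s<S. c k (3 * s) + c k (3 * s + 1) + c k (3 * s + 2) = c k (3 * S + 1)) \<and>
     (\<forall>k. c k (3 * S) = k) \<and> (\<forall>k. \<forall>r\<ge>3 * S + 2. c k r = 0)"
proof -
  define p where "p s k = \<lfloor>x s * (real k + 1)\<rfloor>" for s k
  define M where "M k = (\<Sum>s<S. \<bar>p s k\<bar>)" for k
  have M: "\<bar>p s k\<bar> \<le> M k" if "s < S" for s k
    unfolding M_def using that by (intro member_le_sum[where f = "\<lambda>s. \<bar>p s k\<bar>"]) auto
  define c where "c k r = (if r < 3 * S then
      (if r mod 3 = 0 then nat (M k + p (r div 3) k) else if r mod 3 = 1 then nat (M k - p (r div 3) k) else 2 * k + 1)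
      else if r = 3 * S then k else if r = 3 * S + 1 then nat (2 * M k) + 2 * k + 1 else 0)" for k r
  have md: "(3 * s + 2) mod 3 = 2" "(3 * s + 2) div 3 = s" "(3 * s + 1) mod 3 = 1" "(3 * s + 1) div 3 = s" for s :: nat
    by presburger+
  have c: "c k (3 * s) = nat (M k + p s k)" "c k (3 * s + 1) = nat (M k - p s k)" "c k (3 * s + 2) = 2 * k + 1"
    if "s < S" for k s
  proof -
    have "3 * s < 3 * S" "3 * s + 1 < 3 * S" "3 * s + 2 < 3 * S" using that by auto
    then show "c k (3 * s) = nat (M k + p s k)" "c k (3 * s + 1) = nat (M k - p s k)" "c k (3 * s + 2) = 2 * k + 1"
      unfolding c_def md by simp_all
  qed
  have "cval (c k) s = of_int (p s k) / (real k + 1)" if "s < S" for k s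
  proof -
    have "real (nat (M k + p s k)) - real (nat (M k - p s k)) = 2 * of_int (p s k)"
      using M[OF that, of k] by (simp add: of_nat_nat)
    then have "cval (c k) s = (2 * of_int (p s k)) / (2 * (real k + 1))"
      unfolding cval_def frac_def c[OF that] by (simp add: algebra_simps)
    then show ?thesis by (metis mult_divide_mult_cancel_left zero_neq_numeral)
  qed
  then have "(\<lambda>k. cval (c k) s) \<longlonglongrightarrow> x s" if "s < S" for s
    using floor_approx_tendsto[of "x s"] that by (simp add: p_def)
  moreover have "c k (3 * s) + c k (3 * s + 1) + c k (3 * s + 2) = c k (3 * S + 1)" if "s < S" for k s
    unfolding c[OF that] using M[OF that, of k] by (simp add: c_def)
  moreover have "c k (3 * S) = k" for k by (simp add: c_def)
  moreover have "c k r = 0" if "r \<ge> 3 * S + 2" for k r using that by (simp add: c_def)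
  ultimately show ?thesis by blast
qed

lemma tendsto_cert:
  assumes "(mu' \<longlongrightarrow> mu) F" "\<And>i m. i < n \<Longrightarrow> m < n \<Longrightarrow> ((\<lambda>k. R' k i m) \<longlongrightarrow> R i m) F"
    "\<And>i m. i < n \<Longrightarrow> m < n \<Longrightarrow> ((\<lambda>k. U' k i m) \<longlongrightarrow> U i m) F" "i < n" "l < n"
  shows "((\<lambda>k. cert n A kk (mu' k) (R' k) (U' k) i l) \<longlongrightarrow> cert n A kk mu R U i l) F"
  unfolding cert_def using assms by (intro tendsto_intros) auto

lemma tendsto_rho:
  assumes "\<And>i m. i < n \<Longrightarrow> m < n \<Longrightarrow> ((\<lambda>k. R' k i m) \<longlongrightarrow> R i m) F"
  shows "((\<lambda>k. rho n (R' k)) \<longlongrightarrow> rho n R) F"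
  unfolding rho_def using assms by (intro tendsto_intros) auto

lemma tendsto_bulk:
  assumes "\<And>i. i < n \<Longrightarrow> ((\<lambda>k. v' k i) \<longlongrightarrow> v i) F"
  shows "((\<lambda>k. bulk n (v' k)) \<longlongrightarrow> bulk n v) F"
  unfolding bulk_def using assms by (intro tendsto_intros) auto

lemma tendsto_resid:
  assumes "(mu' \<longlongrightarrow> mu) F" "\<And>i. i < n \<Longrightarrow> ((\<lambda>k. v' k i) \<longlongrightarrow> v i) F"
  shows "((\<lambda>k. resid n A (mu' k) (v' k) i) \<longlongrightarrow> resid n A mu v i) F"
  unfolding resid_def using assms by (intro tendsto_intros) auto

lemma eventually_less2:
  fixes n :: nat
  assumes "\<And>s i. s \<in> {1, -1} \<Longrightarrow> i < n \<Longrightarrow> (f s i \<longlongrightarrow> l s i) F" "\<And>s i. s \<in> {1, -1} \<Longrightarrow> i < n \<Longrightarrow> l s i < (u :: real)"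
  shows "\<forall>\<^sub>F k in F. \<forall>s\<in>{1, -1 :: real}. \<forall>i<n. f s i k < u"
proof -
  have "\<forall>\<^sub>F k in F. \<forall>s\<in>{1, -1}. \<forall>i\<in>{..<n}. f s i k < u"
    by (intro eventually_ball_finite ballI order_tendstoD(2)[OF assms(1) assms(2)]) auto
  then show ?thesis by (rule eventually_mono) auto
qed

text \<open>The tracked eigenvector and an exact certificate have vanishing residual and certificate
  error, so they pass the tests with room to spare. All quantities depend continuously on the data,
  hence a fine enough rational candidate passes for every sufficiently precise input.\<close>

lemma accepting_candidate:
  assumes n: "n \<ge> 1" and e: "eigenbasis n (smat A) b lam" and tr: "tracked n A lam kk P y"
    and start: "P = 0 \<Longrightarrow> \<exists>i0<n. card {i. i < n \<and> lam i = lam i0} \<le> kk"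
  shows "\<exists>c. (\<forall>r\<ge>3 * slots n + 2. c r = 0) \<and>
    (\<forall>i<n. c (3 * (1 + i)) + c (3 * (1 + i) + 1) + c (3 * (1 + i) + 2) = cK n c) \<and>
    (\<forall>a W. (\<forall>k<n * (n + 1) div 2. \<bar>a k - A k\<bar> * real (W k) \<le> 1 \<and> Suc (cE n c) \<le> W k) \<longrightarrow>
       accept n a W kk P y (cmu c) (cv c) (cR n c) (cU n c) (cE n c))"
proof -
  have o: "onb n b" using e by (simp add: eigenbasis_def)
  obtain i0 w where i0: "i0 < n" "card {i. i < n \<and> lam i = lam i0} \<le> kk"
    and w: "\<forall>k<n. mv n (smat A) w k = lam i0 * w k"
    and wy: "\<forall>k<n. 4 * real P * \<bar>w k - y k\<bar> \<le> 1 / 4"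
    and big: "P = 0 \<Longrightarrow> real n < (\<Sum>i<n. w i * w i)"
  proof (cases "P = 0")
    case True
    then obtain i0 where i0: "i0 < n" "card {i. i < n \<and> lam i = lam i0} \<le> kk" using start by blast
    \<comment> \<open>The factor \<open>n + 1\<close> makes the squared norm exceed \<open>n\<close>
      strictly, so that the requirement of the first step survives approximation.\<close>
    define w where "w = (\<lambda>k. (real n + 1) * b i0 k)"
    have "ip n w w = (real n + 1) * (real n + 1)" using o i0 by (simp add: w_def ip_simps onb_ip)
    then have ww: "(\<Sum>i<n. w i * w i) = (real n + 1) * (real n + 1)" by (simp only: ip_def)
    have "real n < (real n + 1) * 1" by simp
    also have "\<dots> \<le> (real n + 1) * (real n + 1)" by (intro mult_left_mono) auto
    finally have "real n < (\<Sum>i<n. w i * w i)" unfolding ww .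
    moreover have "\<forall>k<n. mv n (smat A) w k = lam i0 * w k"
      using e i0 by (simp add: w_def mv_scale eigenbasis_def)
    ultimately show ?thesis using that[OF i0] True by simp
  next
    case False
    then obtain w i0 where "i0 < n" "card {i. i < n \<and> lam i = lam i0} \<le> kk" "\<forall>k<n. mv n (smat A) w k = lam i0 * w k"
      "\<forall>k<n. \<bar>w k - y k\<bar> \<le> 1 / (16 * real P)" using tr by (auto simp: tracked_def)
    then show ?thesis using that[of i0 w] False by (simp add: field_simps)
  qed
  define mu where "mu = lam i0"
  obtain R U where RU: "\<And>i l. i < n \<Longrightarrow> l < n \<Longrightarrow> cert n A kk mu R U i l = 0"
    using exact_certificate[OF e i0] unfolding mu_def by blast
  have res0: "resid n A mu w i = 0" if "i < n" for i using w that by (simp add: resid_eq mu_def)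
  define x where "x s = (if s = 0 then mu else if s < 1 + n then w (s - 1)
     else if s < 1 + n + n * n then R ((s - (1 + n)) div n) ((s - (1 + n)) mod n)
     else U ((s - (1 + n + n * n)) div n) ((s - (1 + n + n * n)) mod n))" for s
  obtain c where c: "\<forall>s<slots n. (\<lambda>k. cval (c k) s) \<longlonglongrightarrow> x s"
     "\<forall>k. \<forall>s<slots n. c k (3 * s) + c k (3 * s + 1) + c k (3 * s + 2) = c k (3 * slots n + 1)"
     "\<forall>k. c k (3 * slots n) = k" "\<forall>k. \<forall>r\<ge>3 * slots n + 2. c k r = 0"
    using candidates_dense[of "slots n" x] by blast
  have lmu: "(\<lambda>k. cmu (c k)) \<longlonglongrightarrow> mu" using c(1)[rule_format, of 0] by (simp add: x_def)
  have lv: "(\<lambda>k. cv (c k) i) \<longlonglongrightarrow> w i" if "i < n" for i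
    using c(1)[rule_format, of "1 + i"] that by (simp add: x_def)
  have dm: "(i * n + m) div n = i" "(i * n + m) mod n = m" if "m < n" for i m using that by auto
  have lR: "(\<lambda>k. cR n (c k) i m) \<longlonglongrightarrow> R i m" if "i < n" "m < n" for i m
  proof -
    have "x (1 + n + (i * n + m)) = R i m" using slot_less[OF that] dm[OF that(2), of i] by (simp add: x_def)
    then show ?thesis using c(1)[rule_format, of "1 + n + (i * n + m)"] slot_less[OF that] by simp
  qed
  have lU: "(\<lambda>k. cU n (c k) i m) \<longlonglongrightarrow> U i m" if "i < n" "m < n" for i m
  proof -
    have "x (1 + n + n * n + (i * n + m)) = U i m" using slot_less[OF that] dm[OF that(2), of i] by (simp add: x_def)
    then show ?thesis using c(1)[rule_format, of "1 + n + n * n + (i * n + m)"] slot_less[OF that] by simp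
  qed
  have le: "(\<lambda>k. 1 / (real k + 1)) \<longlonglongrightarrow> 0"
    using LIMSEQ_inverse_real_of_nat by (simp add: inverse_eq_divide add.commute)
  have l\<rho>: "(\<lambda>k. rho n (cR n (c k))) \<longlonglongrightarrow> rho n R" using lR by (rule tendsto_rho)
  have ls: "(\<lambda>k. bulk n (cv (c k))) \<longlonglongrightarrow> bulk n w" using lv by (rule tendsto_bulk)
  \<comment> \<open>The error term is doubled: one copy belongs to the test, the other pays for
    replacing \<open>A\<close> by its approximation \<open>a\<close>.\<close>
  have E1: "\<forall>\<^sub>F k in sequentially. \<forall>s\<in>{1, -1}. \<forall>i<n. \<forall>l<n.
     s * cert n A kk (cmu (c k)) (cR n (c k)) (cU n (c k)) i l + 2 * (rho n (cR n (c k)) * (1 / (real k + 1))) < 1 / (4 * real n)"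
  proof -
    have "(\<lambda>k. s * cert n A kk (cmu (c k)) (cR n (c k)) (cU n (c k)) i l + 2 * (rho n (cR n (c k)) * (1 / (real k + 1))))
       \<longlonglongrightarrow> s * cert n A kk mu R U i l + 2 * (rho n R * 0)" if "i < n" "l < n" for s i l
      using that by (intro tendsto_intros tendsto_cert lmu lR lU l\<rho> le)
    then have "\<forall>\<^sub>F k in sequentially. \<forall>l\<in>{..<n}. \<forall>s\<in>{1, -1}. \<forall>i<n.
     s * cert n A kk (cmu (c k)) (cR n (c k)) (cU n (c k)) i l + 2 * (rho n (cR n (c k)) * (1 / (real k + 1))) < 1 / (4 * real n)"
      using n by (intro eventually_ball_finite ballI eventually_less2[where l = "\<lambda>_ _. 0"]) (auto simp: RU)
    then show ?thesis by (rule eventually_mono) auto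
  qed
  let ?F = "\<lambda>k. (real P + 1) * (128 * real n ^ 3) * rho n (cR n (c k))"
  have E2: "\<forall>\<^sub>F k in sequentially. \<forall>s\<in>{1, -1}. \<forall>i<n.
     ?F k * (s * resid n A (cmu (c k)) (cv (c k)) i + 2 * (bulk n (cv (c k)) * (1 / (real k + 1)))) < 1"
  proof (rule eventually_less2)
    fix s :: real and i assume i: "i < n"
    show "(\<lambda>k. ?F k * (s * resid n A (cmu (c k)) (cv (c k)) i + 2 * (bulk n (cv (c k)) * (1 / (real k + 1)))))
       \<longlonglongrightarrow> (real P + 1) * (128 * real n ^ 3) * rho n R * (s * resid n A mu w i + 2 * (bulk n w * 0))"
      using i by (intro tendsto_intros tendsto_resid lmu lv l\<rho> ls le)
    show "(real P + 1) * (128 * real n ^ 3) * rho n R * (s * resid n A mu w i + 2 * (bulk n w * 0)) < 1"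
      using res0[OF i] by simp
  qed
  have E3: "\<forall>\<^sub>F k in sequentially. \<forall>s\<in>{1, -1}. \<forall>i<n. 4 * real P * (s * (cv (c k) i - y i)) < 1"
  proof (rule eventually_less2)
    fix s :: real and i assume i: "i < n" "s \<in> {1, -1}"
    show "(\<lambda>k. 4 * real P * (s * (cv (c k) i - y i))) \<longlonglongrightarrow> 4 * real P * (s * (w i - y i))"
      using i by (intro tendsto_intros lv)
    have "s * (w i - y i) \<le> \<bar>w i - y i\<bar>" using i(2) by auto
    then have "4 * real P * (s * (w i - y i)) \<le> 4 * real P * \<bar>w i - y i\<bar>" by (intro mult_left_mono) auto
    then show "4 * real P * (s * (w i - y i)) < 1" using wy[rule_format, OF i(1)] by linarith
  qed
  have E4: "\<forall>\<^sub>F k in sequentially. real n \<le> real n * real P + (\<Sum>i<n. cv (c k) i * cv (c k) i)"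
  proof (cases "P = 0")
    case True
    have "(\<lambda>k. \<Sum>i<n. cv (c k) i * cv (c k) i) \<longlonglongrightarrow> (\<Sum>i<n. w i * w i)"
      by (intro tendsto_intros lv) auto
    then have "\<forall>\<^sub>F k in sequentially. real n < (\<Sum>i<n. cv (c k) i * cv (c k) i)"
      using big[OF True] by (rule order_tendstoD(1))
    then show ?thesis using True by (auto elim: eventually_mono)
  next
    case False
    then have "real n * 1 \<le> real n * real P" by (intro mult_left_mono) auto
    then have "real n \<le> real n * real P + (\<Sum>i<n. cv (c k) i * cv (c k) i)" for k
      using sum_nonneg[of "{..<n}" "\<lambda>i. cv (c k) i * cv (c k) i"] by simp
    then show ?thesis by simp
  qed
  obtain k where
    k1: "\<forall>s\<in>{1, -1}. \<forall>i<n. \<forall>l<n.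
     s * cert n A kk (cmu (c k)) (cR n (c k)) (cU n (c k)) i l + 2 * (rho n (cR n (c k)) * (1 / (real k + 1))) < 1 / (4 * real n)" and
    k2: "\<forall>s\<in>{1, -1}. \<forall>i<n.
     ?F k * (s * resid n A (cmu (c k)) (cv (c k)) i + 2 * (bulk n (cv (c k)) * (1 / (real k + 1)))) < 1" and
    k3: "\<forall>s\<in>{1, -1}. \<forall>i<n. 4 * real P * (s * (cv (c k) i - y i)) < 1" and
    k4: "real n \<le> real n * real P + (\<Sum>i<n. cv (c k) i * cv (c k) i)"
    using eventually_happens'[OF sequentially_bot eventually_conj[OF E1 eventually_conj[OF E2 eventually_conj[OF E3 E4]]]]
    by (elim exE conjE) (rule that)
  have "accept n a W kk P y (cmu (c k)) (cv (c k)) (cR n (c k)) (cU n (c k)) (cE n (c k))"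
    if aW: "\<forall>j<n * (n + 1) div 2. \<bar>a j - A j\<bar> * real (W j) \<le> 1 \<and> Suc (cE n (c k)) \<le> W j" for a W
  proof -
    have ck: "cE n (c k) = k" using c(3) by blast
    have sm: "\<bar>smat a i j - smat A i j\<bar> \<le> 1 / (real k + 1)" if "i < n" "j < n" for i j
      using aW that unfolding ck by (intro smat_near[where W = W]) auto
    have A1: "s * cert n a kk (cmu (c k)) (cR n (c k)) (cU n (c k)) i l + rho n (cR n (c k)) * (1 / (real k + 1)) \<le> 1 / (4 * real n)"
      if "s \<in> {1, -1}" "i < n" "l < n" for s i l
    proof -
      have "s * cert n a kk (cmu (c k)) (cR n (c k)) (cU n (c k)) i l \<le>
         s * cert n A kk (cmu (c k)) (cR n (c k)) (cU n (c k)) i l + rho n (cR n (c k)) * (1 / (real k + 1))"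
        using cert_diff[OF sm that(2,3), of kk "cmu (c k)" "cR n (c k)" "cU n (c k)"] that(1) by (auto simp: abs_le_iff)
      then show ?thesis using k1[rule_format, OF that] by linarith
    qed
    have A2: "?F k * (s * resid n a (cmu (c k)) (cv (c k)) i + bulk n (cv (c k)) * (1 / (real k + 1))) \<le> 1"
      if "s \<in> {1, -1}" "i < n" for s i
    proof -
      have "s * resid n a (cmu (c k)) (cv (c k)) i \<le> s * resid n A (cmu (c k)) (cv (c k)) i + bulk n (cv (c k)) * (1 / (real k + 1))"
        using resid_diff[OF sm that(2), of "cmu (c k)" "cv (c k)"] that(1) by (auto simp: abs_le_iff)
      then have "s * resid n a (cmu (c k)) (cv (c k)) i + bulk n (cv (c k)) * (1 / (real k + 1)) \<le>
         s * resid n A (cmu (c k)) (cv (c k)) i + 2 * (bulk n (cv (c k)) * (1 / (real k + 1)))" by linarith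
      moreover have "?F k \<ge> 0" using rho_pos[OF n, of "cR n (c k)"] by simp
      ultimately have "?F k * (s * resid n a (cmu (c k)) (cv (c k)) i + bulk n (cv (c k)) * (1 / (real k + 1))) \<le>
        ?F k * (s * resid n A (cmu (c k)) (cv (c k)) i + 2 * (bulk n (cv (c k)) * (1 / (real k + 1))))"
        by (rule mult_left_mono)
      then show ?thesis using k2[rule_format, OF that] by linarith
    qed
    show ?thesis
      unfolding accept_def ck
    proof (intro conjI ballI allI impI)
      show "Suc k \<le> W j" if "j < n * (n + 1) div 2" for j using aW[unfolded ck] that by blast
    qed (use A1 A2 k3 k4 in \<open>auto simp only: less_imp_le\<close>)
  qed
  then show ?thesis
    using c(4)
  proof (intro exI[of _ "c k"] conjI allI impI)
    show "c k (3 * (1 + i)) + c k (3 * (1 + i) + 1) + c k (3 * (1 + i) + 2) = cK n (c k)" if "i < n" for i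
      using c(2)[rule_format, of "1 + i" k] that by simp
  qed auto
qed

text \<open>The steps are dominated by a geometric series with sum 1 / 2, so an entry of size 1
  stays nonzero in the limit. Dividing by this entry shows that the \<open>mu\<close> converge as
  well, because the residuals tend to 0.\<close>

lemma limit_eigenvector:
  assumes A: "A \<in> topspace (Euclidean_space (n * (n + 1) div 2))"
    and step: "\<And>m i. i < n \<Longrightarrow> 4 * 2 ^ m * \<bar>v (Suc m) i - v m i\<bar> \<le> (1 :: real)"
    and start: "\<exists>i<n. 1 \<le> \<bar>v 0 i\<bar>"
    and res: "\<And>m i. i < n \<Longrightarrow> \<bar>resid n A (mu m) (v m) i\<bar> \<le> 2 / 2 ^ m"
  shows "\<exists>w\<in>EVec n A. \<forall>m. \<forall>i<n. \<bar>w i - v m i\<bar> \<le> 1 / 2 ^ m"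
proof -
  \<comment> \<open>The subtracted term makes the induction telescope: consecutive differences of
    the bound equal the bound on a single step.\<close>
  have dist: "\<bar>v (m + j) i - v m i\<bar> \<le> 1 / (2 * 2 ^ m) - 1 / (2 * 2 ^ (m + j))" if "i < n" for m j i
  proof (induction j)
    case (Suc j)
    have "\<bar>v (m + Suc j) i - v (m + j) i\<bar> \<le> 1 / (4 * 2 ^ (m + j))"
      using step[OF that, of "m + j"] by (simp add: field_simps)
    moreover have "1 / (2 * 2 ^ (m + j)) - 1 / (2 * 2 ^ (m + Suc j)) = 1 / (4 * (2 :: real) ^ (m + j))"
      by (simp add: field_simps)
    ultimately show ?case using Suc by linarith
  qed simp
  have near: "\<bar>v k i - v m i\<bar> \<le> 1 / (2 * 2 ^ m)" if "i < n" "m \<le> k" for k m i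
  proof -
    have "\<bar>v k i - v m i\<bar> \<le> 1 / (2 * 2 ^ m) - 1 / (2 * 2 ^ k)" using dist[OF that(1), of m "k - m"] that(2) by simp
    moreover have "0 \<le> 1 / (2 * 2 ^ k :: real)" by simp
    ultimately show ?thesis by linarith
  qed
  have half: "(\<lambda>m. C / 2 ^ m) \<longlonglongrightarrow> 0" for C :: real
    using tendsto_mult[OF tendsto_const[of C] LIMSEQ_realpow_zero[of "1 / 2 :: real"]] by (simp add: power_divide)
  have "convergent (\<lambda>m. v m i)" if i: "i < n" for i
  proof (intro Cauchy_convergent CauchyI)
    fix r :: real assume "r > 0"
    then obtain M where M: "1 / 2 ^ M < r"
      using order_tendstoD(2)[OF half[of 1]] by (auto simp: eventually_sequentially)
    have "norm (v m i - v k i) < r" if "m \<ge> M" "k \<ge> M" for m k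
    proof -
      have "\<bar>v m i - v k i\<bar> \<le> 1 / (2 * 2 ^ M) + 1 / (2 * 2 ^ M)"
        using near[OF i that(1)] near[OF i that(2)] by linarith
      then show ?thesis using M by simp
    qed
    then show "\<exists>M. \<forall>m\<ge>M. \<forall>k\<ge>M. norm (v m i - v k i) < r" by blast
  qed
  then obtain w' where w': "\<And>i. i < n \<Longrightarrow> (\<lambda>m. v m i) \<longlonglongrightarrow> w' i"
    unfolding convergent_def by metis
  define w where "w i = (if i < n then w' i else 0)" for i
  have lw: "(\<lambda>m. v m i) \<longlonglongrightarrow> w i" if "i < n" for i using w'[OF that] that by (simp add: w_def)
  have bound: "\<bar>w i - v m i\<bar> \<le> 1 / (2 * 2 ^ m)" if "i < n" for m i
  proof (rule LIMSEQ_le_const2)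
    show "(\<lambda>k. \<bar>v k i - v m i\<bar>) \<longlonglongrightarrow> \<bar>w i - v m i\<bar>" by (intro tendsto_intros lw that)
    show "\<exists>N. \<forall>k\<ge>N. \<bar>v k i - v m i\<bar> \<le> 1 / (2 * 2 ^ m)" using near[OF that] by blast
  qed
  obtain i0 where i0: "i0 < n" "1 \<le> \<bar>v 0 i0\<bar>" using start by blast
  have w0: "w i0 \<noteq> 0" using bound[OF i0(1), of 0] i0(2) by auto
  have mvl: "(\<lambda>m. mv n (smat A) (v m) i) \<longlonglongrightarrow> mv n (smat A) w i" for i
    unfolding mv_def by (intro tendsto_intros lw) auto
  have "(\<lambda>m. resid n A (mu m) (v m) i) \<longlonglongrightarrow> 0" if "i < n" for i
    using res[OF that] by (intro Lim_null_comparison[OF _ half[of 2]]) auto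
  then have r0: "(\<lambda>m. mv n (smat A) (v m) i - mu m * v m i) \<longlonglongrightarrow> 0" if "i < n" for i
    using that by (simp add: resid_eq)
  have muv: "(\<lambda>m. mu m * v m i) \<longlonglongrightarrow> mv n (smat A) w i" if "i < n" for i
    using tendsto_diff[OF mvl[of i] r0[OF that]] by simp
  define l where "l = mv n (smat A) w i0 / w i0"
  have "(\<lambda>m. mu m * v m i0 / v m i0) \<longlonglongrightarrow> l"
    unfolding l_def by (intro tendsto_divide muv lw i0 w0)
  moreover have "\<forall>\<^sub>F m in sequentially. v m i0 \<noteq> 0" using lw[OF i0(1)] w0 by (rule tendsto_imp_eventually_ne)
  then have "\<forall>\<^sub>F m in sequentially. mu m * v m i0 / v m i0 = mu m" by (rule eventually_mono) simp
  ultimately have lmu: "mu \<longlonglongrightarrow> l" by (rule Lim_transform_eventually)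
  have "mv n (smat A) w i = l * w i" if "i < n" for i
    using LIMSEQ_unique[OF muv[OF that] tendsto_mult[OF lmu lw[OF that]]] .
  then have "w \<in> EVec n A"
    using w0 i0(1) unfolding EVec_iff[OF A] by (auto simp: topspace_Euclidean_space_iff w_def)
  moreover have "\<bar>w i - v m i\<bar> \<le> 1 / 2 ^ m" if "i < n" for m i
  proof -
    have "1 / (2 * 2 ^ m) \<le> 1 / (2 :: real) ^ m" by (simp add: frac_le)
    then show ?thesis using bound[OF that, of m] by linarith
  qed
  ultimately show ?thesis by blast
qed

section \<open>Loop programs on Type-2 machines\<close>

type_synonym pstate = "(nat \<Rightarrow> nat) \<times> (bool \<Rightarrow> nat) \<times> bool list"

text \<open>In a state \<open>(\<sigma>, \<pi>, w)\<close> the registers hold \<open>\<sigma>\<close>, the heads on the two input tapes are at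
  \<open>\<pi> False\<close> and \<open>\<pi> True\<close>, and \<open>w\<close> has been written.\<close>

datatype lcom = LSkip | LInc nat | LDec nat | LRead bool nat | LOut bool | LSeq lcom lcom | LLoop nat lcom

primrec lexec :: "(bool \<Rightarrow> nat \<Rightarrow> symbol) \<Rightarrow> lcom \<Rightarrow> pstate \<Rightarrow> pstate" where
  "lexec X LSkip = (\<lambda>s. s)"
| "lexec X (LInc r) = (\<lambda>(\<sigma>, \<pi>, w). (\<sigma>(r := Suc (\<sigma> r)), \<pi>, w))"
| "lexec X (LDec r) = (\<lambda>(\<sigma>, \<pi>, w). (\<sigma>(r := \<sigma> r - 1), \<pi>, w))"
| "lexec X (LRead b r) = (\<lambda>(\<sigma>, \<pi>, w).
     (\<sigma>(r := \<sigma> r + (if X b (\<pi> b) = Some True then 1 else 0)), \<pi>(b := Suc (\<pi> b)), w))"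
| "lexec X (LOut b) = (\<lambda>(\<sigma>, \<pi>, w). (\<sigma>, \<pi>, w @ [b]))"
| "lexec X (LSeq c d) = (\<lambda>s. lexec X d (lexec X c s))"
| "lexec X (LLoop r c) = (\<lambda>s. ((\<lambda>(\<sigma>, \<pi>, w). lexec X c (\<sigma>(r := \<sigma> r - 1), \<pi>, w)) ^^ (fst s r)) s)"

primrec lregs :: "lcom \<Rightarrow> nat set" where
  "lregs LSkip = {}"
| "lregs (LInc r) = {r}"
| "lregs (LDec r) = {r}"
| "lregs (LRead b r) = {r}"
| "lregs (LOut b) = {}"
| "lregs (LSeq c d) = lregs c \<union> lregs d"
| "lregs (LLoop r c) = insert r (lregs c)"

text \<open>The counter of a loop must not occur in its body: the compiled loop tests the counter itself,
  whereas \<^const>\<open>lexec\<close> fixes the number of iterations in advance.\<close>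

primrec lok :: "lcom \<Rightarrow> bool" where
  "lok LSkip \<longleftrightarrow> True"
| "lok (LInc r) \<longleftrightarrow> True"
| "lok (LDec r) \<longleftrightarrow> True"
| "lok (LRead b r) \<longleftrightarrow> True"
| "lok (LOut b) \<longleftrightarrow> True"
| "lok (LSeq c d) \<longleftrightarrow> lok c \<and> lok d"
| "lok (LLoop r c) \<longleftrightarrow> r \<notin> lregs c \<and> lok c"

lemma finite_lregs: "finite (lregs c)"
  by (induction c) auto

lemma lexec_unchanged: "r \<notin> lregs c \<Longrightarrow> fst (lexec X c s) r = fst s r"
proof (induction c arbitrary: s)
  case (LLoop q c)
  have "fst (((\<lambda>(\<sigma>, \<pi>, w). lexec X c (\<sigma>(q := \<sigma> q - 1), \<pi>, w)) ^^ k) s) r = fst s r" for k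
    using LLoop by (induction k) (auto split: prod.splits)
  then show ?case by simp
qed (auto split: prod.splits)

section \<open>Compilation of loops to jumps and machine states\<close>

datatype instr = IInc nat | IDec nat | IJz nat nat | IJmp nat | IRead bool nat | IOut bool

text \<open>\<open>p\<close> is the absolute address of the first instruction. A loop adds a test, a
  decrement and a jump to its body, hence the offsets 2 and 3.\<close>

primrec code :: "lcom \<Rightarrow> nat \<Rightarrow> instr list" where
  "code LSkip p = []"
| "code (LInc r) p = [IInc r]"
| "code (LDec r) p = [IDec r]"
| "code (LRead b r) p = [IRead b r]"
| "code (LOut b) p = [IOut b]"
| "code (LSeq c d) p = code c p @ code d (p + length (code c p))"
| "code (LLoop r c) p = [IJz r (p + length (code c (p + 2)) + 3), IDec r] @ code c (p + 2) @ [IJmp p]"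

text \<open>A register is the head position on a work tape whose cell \<open>0\<close> alone is marked. State \<open>0\<close> of
  the machine sets the marks, and state \<open>Suc p\<close> executes instruction \<open>p\<close>.\<close>

abbreviation still :: "symbol list \<Rightarrow> (symbol \<times> move) list" where
  "still vs \<equiv> map (\<lambda>v. (v, Stay)) vs"

primrec act :: "instr \<Rightarrow> nat \<Rightarrow> symbol list \<Rightarrow> symbol list \<Rightarrow>
    nat \<times> bool list \<times> (symbol \<times> move) list \<times> bool option" where
  "act (IInc r) s us vs = (Suc s, [False, False], (still vs)[r := (vs ! r, Move_Right)], None)"
| "act (IDec r) s us vs = (Suc s, [False, False],
     (still vs)[r := (vs ! r, if vs ! r = Some True then Stay else Move_Left)], None)"
| "act (IJz r p) s us vs = (if vs ! r = Some True then Suc p else Suc s, [False, False], still vs, None)"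
| "act (IJmp p) s us vs = (Suc p, [False, False], still vs, None)"
| "act (IRead b r) s us vs = (Suc s, [\<not> b, b],
     (still vs)[r := (vs ! r, if us ! (if b then 1 else 0) = Some True then Move_Right else Stay)], None)"
| "act (IOut b) s us vs = (Suc s, [False, False], still vs, Some b)"

text \<open>Sending states beyond the program to 0 secures \<open>t2_wf\<close> for arbitrary
  instruction lists; compiled code keeps its jumps inside.\<close>

definition machine :: "instr list \<Rightarrow> nat \<Rightarrow> t2machine" where
  "machine P m = \<lparr>num_states = Suc (length P), num_inputs = 2, num_works = m,
     trans = (\<lambda>s us vs.
       case (if s = 0 then (1, [False, False], replicate m (Some True, Stay), None)
             else act (P ! (s - 1)) s us vs) of
         (s', adv, acts, e) \<Rightarrow> (if s' \<le> length P then s' else 0, adv, acts, e))\<rparr>"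

lemma length_act:
  "act i s us vs = (s', adv, acts, e) \<Longrightarrow> length adv = 2 \<and> length acts = length vs"
  by (cases i) (auto split: if_splits)

lemma machine_wf: "t2_wf (machine P m)"
  unfolding t2_wf_def
proof (intro conjI allI impI)
  fix s :: nat and us vs :: "symbol list"
  assume vs: "s < num_states (machine P m) \<and> length us = num_inputs (machine P m) \<and> length vs = num_works (machine P m)"
  obtain s' adv acts e where r: "(if s = 0 then (1, [False, False], replicate m (Some True, Stay), None)
      else act (P ! (s - 1)) s us vs) = (s', adv, acts, e)"
    by (metis prod_cases4)
  have "length adv = 2 \<and> length acts = m"
    using r vs length_act[of "P ! (s - 1)" s us vs s' adv acts e] by (auto simp: machine_def split: if_splits)
  then show "case trans (machine P m) s us vs of (s', adv, acts, e) \<Rightarrow>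
      s' < num_states (machine P m) \<and> length adv = num_inputs (machine P m) \<and> length acts = num_works (machine P m)"
    unfolding machine_def t2machine.simps r prod.case by simp
qed (simp add: machine_def)

definition mark :: "int \<Rightarrow> symbol" where
  "mark = (\<lambda>_. None)(0 := Some True)"

lemma mark_eq: "mark (int k) = Some True \<longleftrightarrow> k = 0"
  by (simp add: mark_def)

definition cfg :: "nat \<Rightarrow> nat \<Rightarrow> pstate \<Rightarrow> t2config" where
  "cfg m p = (\<lambda>(\<sigma>, \<pi>, w). \<lparr>state = Suc p, in_pos = [\<pi> False, \<pi> True],
     work = map (\<lambda>r. (mark, int (\<sigma> r))) [0..<m], written = w\<rparr>)"

primrec istep :: "(bool \<Rightarrow> nat \<Rightarrow> symbol) \<Rightarrow> instr \<Rightarrow> nat \<Rightarrow> pstate \<Rightarrow> nat \<times> pstate" where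
  "istep X (IInc r) p s = (Suc p, lexec X (LInc r) s)"
| "istep X (IDec r) p s = (Suc p, lexec X (LDec r) s)"
| "istep X (IJz r q) p s = (if fst s r = 0 then q else Suc p, s)"
| "istep X (IJmp q) p s = (q, s)"
| "istep X (IRead b r) p s = (Suc p, lexec X (LRead b r) s)"
| "istep X (IOut b) p s = (Suc p, lexec X (LOut b) s)"

primrec iregs :: "instr \<Rightarrow> nat set" where
  "iregs (IInc r) = {r}" | "iregs (IDec r) = {r}" | "iregs (IJz r q) = {r}"
| "iregs (IJmp q) = {}" | "iregs (IRead b r) = {r}" | "iregs (IOut b) = {}"

definition scan :: "nat \<Rightarrow> (nat \<Rightarrow> nat) \<Rightarrow> symbol list" where
  "scan m \<sigma> = map (\<lambda>r. mark (int (\<sigma> r))) [0..<m]"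

lemma length_scan [simp]: "length (scan m \<sigma>) = m"
  by (simp add: scan_def)

lemma scan_nth [simp]: "r < m \<Longrightarrow> scan m \<sigma> ! r = mark (int (\<sigma> r))"
  by (simp add: scan_def)

lemma work_still:
  "map2 (\<lambda>(t, h) (a, d). (t(h := a), move_head d h)) (map (\<lambda>r. (mark, int (\<sigma> r))) [0..<m])
     (still (scan m \<sigma>)) = map (\<lambda>r. (mark, int (\<sigma> r))) [0..<m]"
  by (intro nth_equalityI) auto

lemma work_move:
  "r < m \<Longrightarrow> move_head d (int (\<sigma> r)) = int k \<Longrightarrow>
   map2 (\<lambda>(t, h) (a, d). (t(h := a), move_head d h)) (map (\<lambda>r. (mark, int (\<sigma> r))) [0..<m])
     ((still (scan m \<sigma>))[r := (mark (int (\<sigma> r)), d)]) =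
   map (\<lambda>i. (mark, int ((\<sigma>(r := k)) i))) [0..<m]"
  by (intro nth_equalityI) (auto simp: nth_list_update)

lemma machine_step_act:
  assumes "p < length P" "q \<le> length P"
    "act (P ! p) (Suc p) [X False (\<pi> False), X True (\<pi> True)] (scan m \<sigma>) = (q, adv, acts, e)"
  shows "t2_step (machine P m) [X False, X True] (cfg m p (\<sigma>, \<pi>, w)) =
    \<lparr>state = q, in_pos = map2 (\<lambda>i b. if b then Suc i else i) [\<pi> False, \<pi> True] adv,
     work = map2 (\<lambda>(t, h) (a, d). (t(h := a), move_head d h)) (map (\<lambda>r. (mark, int (\<sigma> r))) [0..<m]) acts,
     written = w @ (case e of None \<Rightarrow> [] | Some b \<Rightarrow> [b])\<rparr>"
proof -
  have "map (\<lambda>(t, h). t h) (map (\<lambda>r. (mark, int (\<sigma> r))) [0..<m]) = scan m \<sigma>"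
    by (simp add: scan_def)
  then show ?thesis using assms unfolding t2_step_def cfg_def machine_def by (simp del: map_map)
qed

lemma machine_step:
  assumes p: "p < length P" "iregs (P ! p) \<subseteq> {..<m}" and s': "istep X (P ! p) p s = (p', s')" and p': "p' < length P"
  shows "t2_step (machine P m) [X False, X True] (cfg m p s) = cfg m p' s'"
proof -
  obtain \<sigma> \<pi> w where s: "s = (\<sigma>, \<pi>, w)" by (cases s)
  note step = machine_step_act[where X = X and \<pi> = \<pi> and w = w, OF p(1)]
  show ?thesis
  proof (cases "P ! p")
    case (IInc r)
    then have r: "r < m" using p by simp
    have "act (P ! p) (Suc p) [X False (\<pi> False), X True (\<pi> True)] (scan m \<sigma>) =
      (Suc (Suc p), [False, False], (still (scan m \<sigma>))[r := (mark (int (\<sigma> r)), Move_Right)], None)"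
      using r by (simp add: IInc)
    from step[OF _ this] show ?thesis
      using s' p' unfolding s by (auto simp add: IInc work_move[OF r, where k = "Suc (\<sigma> r)"] cfg_def)
  next
    case (IDec r)
    then have r: "r < m" using p by simp
    let ?d = "if \<sigma> r = 0 then Stay else Move_Left"
    have "act (P ! p) (Suc p) [X False (\<pi> False), X True (\<pi> True)] (scan m \<sigma>) =
      (Suc (Suc p), [False, False], (still (scan m \<sigma>))[r := (mark (int (\<sigma> r)), ?d)], None)"
      using r by (simp add: IDec mark_eq)
    moreover have "move_head ?d (int (\<sigma> r)) = int (\<sigma> r - 1)" by simp
    ultimately show ?thesis
      using step[of "Suc (Suc p)"] s' p' work_move[OF r, of ?d \<sigma> "\<sigma> r - 1"] unfolding s
      by (auto simp add: IDec cfg_def)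
  next
    case (IJz r q)
    then have r: "r < m" using p by simp
    have "act (P ! p) (Suc p) [X False (\<pi> False), X True (\<pi> True)] (scan m \<sigma>) =
      (Suc p', [False, False], still (scan m \<sigma>), None)"
      using r s' by (auto simp add: IJz mark_eq s)
    from step[OF _ this] show ?thesis
      using s' p' unfolding s by (auto simp add: IJz work_still cfg_def)
  next
    case (IJmp q)
    have "act (P ! p) (Suc p) [X False (\<pi> False), X True (\<pi> True)] (scan m \<sigma>) =
      (Suc q, [False, False], still (scan m \<sigma>), None)"
      by (simp add: IJmp)
    from step[OF _ this] show ?thesis
      using s' p' unfolding s by (auto simp add: IJmp work_still cfg_def)
  next
    case (IRead b r)
    then have r: "r < m" using p by simp
    let ?B = "X b (\<pi> b) = Some True"
    let ?d = "if ?B then Move_Right else Stay"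
    have "act (P ! p) (Suc p) [X False (\<pi> False), X True (\<pi> True)] (scan m \<sigma>) =
      (Suc (Suc p), [\<not> b, b], (still (scan m \<sigma>))[r := (mark (int (\<sigma> r)), ?d)], None)"
      using r by (cases b) (simp_all add: IRead)
    moreover have "move_head ?d (int (\<sigma> r)) = int (\<sigma> r + (if ?B then 1 else 0))" by simp
    ultimately show ?thesis
      using step[of "Suc (Suc p)"] s' p' work_move[OF r, of ?d \<sigma> "\<sigma> r + (if ?B then 1 else 0)"] unfolding s
      by (cases b) (auto simp add: IRead cfg_def)
  next
    case (IOut b)
    have "act (P ! p) (Suc p) [X False (\<pi> False), X True (\<pi> True)] (scan m \<sigma>) =
      (Suc (Suc p), [False, False], still (scan m \<sigma>), Some b)"
      by (simp add: IOut)
    from step[OF _ this] show ?thesis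
      using s' p' unfolding s by (auto simp add: IOut work_still cfg_def)
  qed
qed

definition reaches :: "t2machine \<Rightarrow> (nat \<Rightarrow> symbol) list \<Rightarrow> t2config \<Rightarrow> t2config \<Rightarrow> bool" where
  "reaches M xs c c' \<longleftrightarrow> (\<exists>t. (t2_step M xs ^^ t) c = c')"

lemma reaches_refl: "reaches M xs c c"
  unfolding reaches_def by (metis funpow_0)

lemma reaches_trans: "reaches M xs a b \<Longrightarrow> reaches M xs b c \<Longrightarrow> reaches M xs a c"
  unfolding reaches_def by (metis add.commute comp_apply funpow_add)

lemma reaches_step: "t2_step M xs c = c' \<Longrightarrow> reaches M xs c c'"
  unfolding reaches_def by (intro exI[of _ 1]) simp

definition segment :: "'a list \<Rightarrow> nat \<Rightarrow> 'a list \<Rightarrow> bool" where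
  "segment P p cs \<longleftrightarrow> (\<exists>xs ys. P = xs @ cs @ ys \<and> length xs = p)"

lemma segment_append: "segment P p (cs @ ds) \<longleftrightarrow> segment P p cs \<and> segment P (p + length cs) ds"
proof
  assume "segment P p cs \<and> segment P (p + length cs) ds"
  then obtain xs ys xs' ys' where 1: "P = xs @ cs @ ys" "length xs = p" "P = xs' @ ds @ ys'" "length xs' = p + length cs"
    unfolding segment_def by blast
  then have "(xs @ cs) @ ys = xs' @ (ds @ ys')" "length (xs @ cs) = length xs'" by simp_all
  then have "ys = ds @ ys'" by (metis append_eq_append_conv)
  then show "segment P p (cs @ ds)" using 1 by (auto simp: segment_def)
next
  assume "segment P p (cs @ ds)"
  then obtain xs ys where "P = xs @ (cs @ ds) @ ys" "length xs = p" by (auto simp: segment_def)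
  then show "segment P p cs \<and> segment P (p + length cs) ds"
    unfolding segment_def by (metis append.assoc length_append)
qed

lemma segment_Cons: "segment P p (c # cs) \<longleftrightarrow> p < length P \<and> P ! p = c \<and> segment P (Suc p) cs"
proof -
  have "segment P p [c] \<longleftrightarrow> p < length P \<and> P ! p = c"
  proof
    assume "p < length P \<and> P ! p = c"
    then have "P = take p P @ [c] @ drop (Suc p) P" "length (take p P) = p"
      using id_take_nth_drop[of p P] by auto
    then show "segment P p [c]" unfolding segment_def by blast
  qed (auto simp: segment_def)
  then show ?thesis using segment_append[of P p "[c]" cs] by simp
qed

text \<open>The strict bound keeps the exit address inside the program, where no state is reset to
  0.\<close>

lemma code_correct:
  assumes "segment P p (code c p)" "p + length (code c p) < length P" "lok c" "lregs c \<subseteq> {..<m}"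
  shows "reaches (machine P m) [X False, X True] (cfg m p s) (cfg m (p + length (code c p)) (lexec X c s))"
  using assms
proof (induction c arbitrary: p s)
  case LSkip
  then show ?case by (simp add: reaches_refl)
next
  case (LInc r)
  then show ?case by (intro reaches_step machine_step) (auto simp: segment_Cons)
next
  case (LDec r)
  then show ?case by (intro reaches_step machine_step) (auto simp: segment_Cons)
next
  case (LRead b r)
  then show ?case by (intro reaches_step machine_step) (auto simp: segment_Cons)
next
  case (LOut b)
  then show ?case by (intro reaches_step machine_step) (auto simp: segment_Cons)
next
  case (LSeq c d)
  have "reaches (machine P m) [X False, X True] (cfg m p s) (cfg m (p + length (code c p)) (lexec X c s))"
    using LSeq.prems by (intro LSeq.IH(1)) (auto simp: segment_append)
  moreover have "reaches (machine P m) [X False, X True] (cfg m (p + length (code c p)) (lexec X c s))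
     (cfg m (p + length (code c p) + length (code d (p + length (code c p)))) (lexec X d (lexec X c s)))"
    using LSeq.prems by (intro LSeq.IH(2)) (auto simp: segment_append)
  ultimately show ?case by (simp add: add.assoc) (rule reaches_trans)
next
  case (LLoop r c)
  let ?M = "machine P m" and ?xs = "[X False, X True]" and ?n = "length (code c (p + 2))"
  let ?f = "\<lambda>(\<sigma>, \<pi>, w). lexec X c (\<sigma>(r := \<sigma> r - 1), \<pi>, w)"
  have P: "p + ?n + 3 < length P" "P ! p = IJz r (p + ?n + 3)" "P ! Suc p = IDec r"
    "segment P (p + 2) (code c (p + 2))" "P ! (p + ?n + 2) = IJmp p"
    using LLoop.prems by (auto simp: segment_append segment_Cons numeral_3_eq_3 add.assoc)
  have rm: "r < m" using LLoop.prems by simp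
  have "reaches ?M ?xs (cfg m p s) (cfg m (p + ?n + 3) ((?f ^^ k) s))" if "fst s r = k" for k s
    using that
  proof (induction k arbitrary: s)
    case 0
    then show ?case using P rm by (auto intro!: reaches_step machine_step)
  next
    case (Suc k)
    obtain \<sigma> \<pi> w where s: "s = (\<sigma>, \<pi>, w)" by (cases s)
    have "reaches ?M ?xs (cfg m p s) (cfg m (Suc p) s)"
      using P rm Suc.prems by (intro reaches_step machine_step) auto
    moreover have "reaches ?M ?xs (cfg m (Suc p) s) (cfg m (p + 2) (\<sigma>(r := \<sigma> r - 1), \<pi>, w))"
      using P rm by (intro reaches_step machine_step) (auto simp: s)
    moreover have "reaches ?M ?xs (cfg m (p + 2) (\<sigma>(r := \<sigma> r - 1), \<pi>, w)) (cfg m (p + 2 + ?n) (?f s))"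
      using P LLoop.prems unfolding s prod.case by (intro LLoop.IH) auto
    moreover have "reaches ?M ?xs (cfg m (p + 2 + ?n) (?f s)) (cfg m p (?f s))"
      using P rm by (intro reaches_step machine_step) (auto simp: add_ac)
    \<comment> \<open>Here \<open>lok\<close> enters: the body does not touch the counter, so it has
      dropped by exactly one.\<close>
    moreover have "fst (?f s) r = k"
      using LLoop.prems Suc.prems lexec_unchanged[of r c X "(\<sigma>(r := \<sigma> r - 1), \<pi>, w)"] by (simp add: s)
    then have "reaches ?M ?xs (cfg m p (?f s)) (cfg m (p + ?n + 3) ((?f ^^ k) (?f s)))" by (rule Suc.IH)
    ultimately show ?case unfolding funpow_Suc_right comp_def by (blast intro: reaches_trans)
  qed
  from this[OF refl] show ?case by (simp add: numeral_3_eq_3)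
qed

abbreviation pinit :: pstate where
  "pinit \<equiv> (\<lambda>_. 0, \<lambda>_. 0, [])"

theorem loop_program_computable:
  assumes "lok c"
  shows "\<exists>M. t2_wf M \<and> num_inputs M = 2 \<and> (\<forall>X q.
    (\<forall>i. \<exists>k. i < length (snd (snd ((lexec X c ^^ k) pinit))) \<and> snd (snd ((lexec X c ^^ k) pinit)) ! i = q i) \<longrightarrow>
    t2_outputs M [X False, X True] q)"
proof -
  obtain m where m: "lregs c \<subseteq> {..<m}"
    using finite_lregs[of c] finite_nat_iff_bounded by blast
  \<comment> \<open>The jump back to address 0 repeats the program for ever; an infinite output is
    the limit of the words written so far.\<close>
  define P where "P = code c 0 @ [IJmp 0]"
  define M where "M = machine P m"
  have seg: "segment P 0 (code c 0)" unfolding segment_def P_def by (metis append_Nil list.size(3))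
  have "t2_outputs M [X False, X True] q"
    if q: "\<forall>i. \<exists>k. i < length (snd (snd ((lexec X c ^^ k) pinit))) \<and> snd (snd ((lexec X c ^^ k) pinit)) ! i = q i"
    for X q
  proof -
    let ?xs = "[X False, X True]"
    have "t2_step M ?xs (t2_init M) = cfg m 0 pinit"
      unfolding t2_step_def t2_init_def M_def machine_def cfg_def
      by (auto simp: P_def mark_def map_replicate_const numeral_2_eq_2 intro!: nth_equalityI)
    then have init: "reaches M ?xs (t2_init M) (cfg m 0 pinit)" by (rule reaches_step)
    have iter: "reaches M ?xs (t2_init M) (cfg m 0 ((lexec X c ^^ k) pinit))" for k
    proof (induction k)
      case (Suc k)
      let ?s = "(lexec X c ^^ k) pinit"
      have 1: "reaches M ?xs (cfg m 0 ?s) (cfg m (length (code c 0)) (lexec X c ?s))"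
        using code_correct[OF seg _ assms m, of X ?s] by (simp add: P_def M_def)
      have 2: "reaches M ?xs (cfg m (length (code c 0)) (lexec X c ?s)) (cfg m 0 (lexec X c ?s))"
        unfolding M_def by (intro reaches_step machine_step) (auto simp: P_def nth_append)
      show ?case using reaches_trans[OF Suc reaches_trans[OF 1 2]] by simp
    qed (simp add: init)
    have "\<exists>t. i < length (written (t2_run M ?xs t)) \<and> written (t2_run M ?xs t) ! i = q i" for i
    proof -
      obtain k where k: "i < length (snd (snd ((lexec X c ^^ k) pinit)))"
        "snd (snd ((lexec X c ^^ k) pinit)) ! i = q i" using q by blast
      obtain t where "t2_run M ?xs t = cfg m 0 ((lexec X c ^^ k) pinit)"
        using iter[of k] by (auto simp: reaches_def t2_run_def)
      then show ?thesis using k by (intro exI[of _ t]) (auto simp: cfg_def split: prod.splits)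
    qed
    then show ?thesis unfolding t2_outputs_def by (simp add: M_def machine_def)
  qed
  moreover have "t2_wf M" "num_inputs M = 2" unfolding M_def by (simp_all add: machine_wf) (simp add: machine_def)
  ultimately show ?thesis by blast
qed

section \<open>Programs with arithmetic expressions\<close>

datatype ex = C nat | V nat | Plus ex ex | Times ex ex | Minus ex ex

primrec eval :: "ex \<Rightarrow> (nat \<Rightarrow> nat) \<Rightarrow> nat" where
  "eval (C k) \<sigma> = k"
| "eval (V x) \<sigma> = \<sigma> x"
| "eval (Plus e f) \<sigma> = eval e \<sigma> + eval f \<sigma>"
| "eval (Times e f) \<sigma> = eval e \<sigma> * eval f \<sigma>"
| "eval (Minus e f) \<sigma> = eval e \<sigma> - eval f \<sigma>"

primrec exvars :: "ex \<Rightarrow> nat set" where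
  "exvars (C k) = {}"
| "exvars (V x) = {x}"
| "exvars (Plus e f) = exvars e \<union> exvars f"
| "exvars (Times e f) = exvars e \<union> exvars f"
| "exvars (Minus e f) = exvars e \<union> exvars f"

datatype com = Skip | Assign nat ex (infix \<open>:=:\<close> 62) | Seq com com (infixr \<open>;;\<close> 60) | For ex com
  | Read bool nat | Out bool

primrec exec :: "(bool \<Rightarrow> nat \<Rightarrow> symbol) \<Rightarrow> com \<Rightarrow> pstate \<Rightarrow> pstate" where
  "exec X Skip = (\<lambda>s. s)"
| "exec X (x :=: e) = (\<lambda>(\<sigma>, \<pi>, w). (\<sigma>(x := eval e \<sigma>), \<pi>, w))"
| "exec X (c ;; d) = (\<lambda>s. exec X d (exec X c s))"
| "exec X (For e c) = (\<lambda>s. (exec X c ^^ (eval e (fst s))) s)"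
| "exec X (Read b x) = (\<lambda>(\<sigma>, \<pi>, w).
     (\<sigma>(x := \<sigma> x + (if X b (\<pi> b) = Some True then 1 else 0)), \<pi>(b := Suc (\<pi> b)), w))"
| "exec X (Out b) = (\<lambda>(\<sigma>, \<pi>, w). (\<sigma>, \<pi>, w @ [b]))"

primrec vars :: "com \<Rightarrow> nat set" where
  "vars Skip = {}"
| "vars (x :=: e) = insert x (exvars e)"
| "vars (c ;; d) = vars c \<union> vars d"
| "vars (For e c) = exvars e \<union> vars c"
| "vars (Read b x) = {x}"
| "vars (Out b) = {}"

lemma finite_vars: "finite (vars c)"
proof -
  have "finite (exvars e)" for e by (induction e) auto
  then show ?thesis by (induction c) auto
qed

lemma eval_upd: "x \<notin> exvars e \<Longrightarrow> eval e (\<sigma>(x := k)) = eval e \<sigma>"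
  by (induction e) auto

abbreviation set_reg :: "nat \<Rightarrow> nat \<Rightarrow> pstate \<Rightarrow> pstate" where
  "set_reg x k \<equiv> (\<lambda>(\<sigma>, \<pi>, w). (\<sigma>(x := k), \<pi>, w))"

text \<open>A register that the program does not mention can be set before or after it. This lets a
  compiled loop keep its counter in a register unknown to the source program.\<close>

lemma exec_frame: "x \<notin> vars c \<Longrightarrow> exec X c (set_reg x k s) = set_reg x k (exec X c s)"
proof (induction c arbitrary: s)
  case (For e c)
  have "(exec X c ^^ j) (set_reg x k s) = set_reg x k ((exec X c ^^ j) s)" for j
    using For by (induction j) auto
  moreover obtain \<sigma> \<pi> w where s: "s = (\<sigma>, \<pi>, w)" by (cases s)
  moreover have "eval e (\<sigma>(x := k)) = eval e \<sigma>" using For.prems by (simp add: eval_upd)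
  ultimately show ?case by (simp add: s del: fun_upd_apply)
qed (auto simp: eval_upd fun_upd_twist split: prod.splits)

lemma exec_unchanged:
  assumes "x \<notin> vars c"
  shows "fst (exec X c s) x = fst s x"
proof -
  have "set_reg x (fst s x) s = s" by (cases s) simp
  then have "exec X c s = set_reg x (fst s x) (exec X c s)" using exec_frame[OF assms, of X "fst s x" s] by simp
  then show ?thesis by (cases "exec X c s") (metis fst_conv fun_upd_same prod.case)
qed

text \<open>\<open>cex e t\<close> adds the value of \<open>e\<close> to register \<open>t\<close>
  and uses the higher registers as scratch, which are 0 before and after. A register is read by
  counting it down, so a variable is moved to \<open>Suc t\<close> and then restored.\<close>

primrec cex :: "ex \<Rightarrow> nat \<Rightarrow> lcom" where
  "cex (C k) t = ((LSeq (LInc t)) ^^ k) LSkip"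
| "cex (V x) t = LSeq (LLoop x (LInc (Suc t))) (LLoop (Suc t) (LSeq (LInc x) (LInc t)))"
| "cex (Plus e f) t = LSeq (cex e t) (cex f t)"
| "cex (Times e f) t = LSeq (cex e (t + 1)) (LLoop (t + 1) (LSeq (cex f (t + 2)) (LLoop (t + 2) (LInc t))))"
| "cex (Minus e f) t = LSeq (cex e (t + 1)) (LSeq (cex f (t + 2))
     (LSeq (LLoop (t + 2) (LDec (t + 1))) (LLoop (t + 1) (LInc t))))"

text \<open>\<open>t\<close> is the first free register. An assignment evaluates into it before
  clearing \<open>x\<close>, since \<open>e\<close> may contain \<open>x\<close>; a loop keeps its
  counter there.\<close>

primrec ccom :: "com \<Rightarrow> nat \<Rightarrow> lcom" where
  "ccom Skip t = LSkip"
| "ccom (x :=: e) t = LSeq (cex e t) (LSeq (LLoop x LSkip) (LLoop t (LInc x)))"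
| "ccom (c ;; d) t = LSeq (ccom c t) (ccom d t)"
| "ccom (For e c) t = LSeq (cex e t) (LLoop t (ccom c (Suc t)))"
| "ccom (Read b x) t = LRead b x"
| "ccom (Out b) t = LOut b"

lemma loop_inc: "r \<noteq> x \<Longrightarrow> lexec X (LLoop r (LInc x)) (\<sigma>, \<pi>, w) = (\<sigma>(x := \<sigma> x + \<sigma> r, r := 0), \<pi>, w)"
proof -
  assume "r \<noteq> x"
  then have "((\<lambda>(\<sigma>, \<pi>, w). lexec X (LInc x) (\<sigma>(r := \<sigma> r - 1), \<pi>, w)) ^^ k) (\<sigma>, \<pi>, w)
      = (\<sigma>(x := \<sigma> x + k, r := \<sigma> r - k), \<pi>, w)" for k
    by (induction k) (auto simp: fun_eq_iff)
  then show ?thesis by simp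
qed

lemma loop_dec: "r \<noteq> x \<Longrightarrow> lexec X (LLoop r (LDec x)) (\<sigma>, \<pi>, w) = (\<sigma>(x := \<sigma> x - \<sigma> r, r := 0), \<pi>, w)"
proof -
  assume "r \<noteq> x"
  then have "((\<lambda>(\<sigma>, \<pi>, w). lexec X (LDec x) (\<sigma>(r := \<sigma> r - 1), \<pi>, w)) ^^ k) (\<sigma>, \<pi>, w)
      = (\<sigma>(x := \<sigma> x - k, r := \<sigma> r - k), \<pi>, w)" for k
    by (induction k) (auto simp: fun_eq_iff)
  then show ?thesis by simp
qed

lemma loop_skip: "lexec X (LLoop r LSkip) (\<sigma>, \<pi>, w) = (\<sigma>(r := 0), \<pi>, w)"
proof -
  have "((\<lambda>(\<sigma>, \<pi>, w). lexec X LSkip (\<sigma>(r := \<sigma> r - 1), \<pi>, w)) ^^ k) (\<sigma>, \<pi>, w)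
      = (\<sigma>(r := \<sigma> r - k), \<pi>, w)" for k
    by (induction k) (auto simp: fun_eq_iff)
  then show ?thesis by simp
qed

lemma loop_inc2:
  "r \<noteq> x \<Longrightarrow> r \<noteq> y \<Longrightarrow> x \<noteq> y \<Longrightarrow> lexec X (LLoop r (LSeq (LInc x) (LInc y))) (\<sigma>, \<pi>, w)
     = (\<sigma>(x := \<sigma> x + \<sigma> r, y := \<sigma> y + \<sigma> r, r := 0), \<pi>, w)"
proof -
  assume "r \<noteq> x" "r \<noteq> y" "x \<noteq> y"
  then have "((\<lambda>(\<sigma>, \<pi>, w). lexec X (LSeq (LInc x) (LInc y)) (\<sigma>(r := \<sigma> r - 1), \<pi>, w)) ^^ k) (\<sigma>, \<pi>, w)
      = (\<sigma>(x := \<sigma> x + k, y := \<sigma> y + k, r := \<sigma> r - k), \<pi>, w)" for k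
    by (induction k) (auto simp: fun_eq_iff)
  then show ?thesis by simp
qed

lemma cex_correct:
  "exvars e \<subseteq> {..<t} \<Longrightarrow> (\<And>r. r > t \<Longrightarrow> \<sigma> r = 0) \<Longrightarrow>
   lexec X (cex e t) (\<sigma>, \<pi>, w) = (\<sigma>(t := \<sigma> t + eval e \<sigma>), \<pi>, w)"
proof (induction e arbitrary: t \<sigma>)
  case (C k)
  have "lexec X (((LSeq (LInc t)) ^^ k) LSkip) (\<sigma>, \<pi>, w) = (\<sigma>(t := \<sigma> t + k), \<pi>, w)" for \<sigma>
  proof (induction k arbitrary: \<sigma>)
    case (Suc k)
    have "\<sigma>(t := Suc (\<sigma> t) + k) = \<sigma>(t := \<sigma> t + Suc k)" by simp
    then show ?case using Suc[of "\<sigma>(t := Suc (\<sigma> t))"] by (simp del: fun_upd_apply add: fun_upd_same)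
  qed simp
  then show ?case by (simp del: fun_upd_apply)
next
  case (V x)
  then have "x < t" "\<sigma> (Suc t) = 0" by auto
  then show ?case by (simp add: loop_inc loop_inc2 del: lexec.simps(7)) (auto simp: fun_eq_iff)
next
  case (Plus e f)
  have nin: "t \<notin> exvars f" using Plus.prems by auto
  have 1: "lexec X (cex e t) (\<sigma>, \<pi>, w) = (\<sigma>(t := \<sigma> t + eval e \<sigma>), \<pi>, w)"
    using Plus.prems by (intro Plus.IH(1)) auto
  have 2: "lexec X (cex f t) (\<sigma>(t := j), \<pi>, w) = ((\<sigma>(t := j))(t := (\<sigma>(t := j)) t + eval f (\<sigma>(t := j))), \<pi>, w)" for j
    using Plus.prems by (intro Plus.IH(2)) auto
  show ?case
    by (simp only: cex.simps lexec.simps 1 2 fun_upd_same fun_upd_upd eval.simps add.assoc eval_upd[OF nin])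
next
  case (Times e f)
  have IH1: "lexec X (cex e t') (\<sigma>', \<pi>, w) = (\<sigma>'(t' := \<sigma>' t' + eval e \<sigma>'), \<pi>, w)"
    if "exvars e \<subseteq> {..<t'}" "\<And>r. r > t' \<Longrightarrow> \<sigma>' r = 0" for t' \<sigma>'
    by (rule Times.IH(1)[OF that])
  have IH2: "lexec X (cex f t') (\<sigma>', \<pi>, w) = (\<sigma>'(t' := \<sigma>' t' + eval f \<sigma>'), \<pi>, w)"
    if "exvars f \<subseteq> {..<t'}" "\<And>r. r > t' \<Longrightarrow> \<sigma>' r = 0" for t' \<sigma>'
    by (rule Times.IH(2)[OF that])
  have nin: "t \<notin> exvars f" "Suc t \<notin> exvars f" using Times.prems by auto
  have sub: "exvars e \<subseteq> {..<Suc t}" "exvars f \<subseteq> {..<Suc (Suc t)}" using Times.prems(1) by auto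
  let ?b = "LSeq (cex f (Suc (Suc t))) (LLoop (Suc (Suc t)) (LInc t))"
  have body: "lexec X ?b (\<sigma>(t := a, Suc t := j), \<pi>, w) = (\<sigma>(t := a + eval f \<sigma>, Suc t := j), \<pi>, w)" for a j
  proof -
    have "lexec X (cex f (Suc (Suc t))) (\<sigma>(t := a, Suc t := j), \<pi>, w) =
       ((\<sigma>(t := a, Suc t := j))(Suc (Suc t) := eval f \<sigma>), \<pi>, w)"
      using IH2[OF sub(2), of "\<sigma>(t := a, Suc t := j)"] Times.prems(2) nin by (simp add: eval_upd)
    then show ?thesis using Times.prems(2)[of "Suc (Suc t)"]
      by (simp add: loop_inc del: lexec.simps(7)) (auto simp: fun_eq_iff)
  qed
  have "((\<lambda>(\<sigma>, \<pi>, w). lexec X ?b (\<sigma>(Suc t := \<sigma> (Suc t) - 1), \<pi>, w)) ^^ k) (\<sigma>(t := a, Suc t := j), \<pi>, w)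
      = (\<sigma>(t := a + k * eval f \<sigma>, Suc t := j - k), \<pi>, w)" for k a j
  proof (induction k)
    case (Suc k)
    have u: "(\<sigma>(t := a + k * eval f \<sigma>, Suc t := j - k))(Suc t := (\<sigma>(t := a + k * eval f \<sigma>, Suc t := j - k)) (Suc t) - 1)
       = \<sigma>(t := a + k * eval f \<sigma>, Suc t := j - Suc k)"
      by auto
    have v: "a + k * eval f \<sigma> + eval f \<sigma> = a + Suc k * eval f \<sigma>" by simp
    show ?case unfolding funpow.simps comp_apply Suc prod.case u body v ..
  qed simp
  from this[of "eval e \<sigma>" "\<sigma> t" "eval e \<sigma>"]
  have "lexec X (LLoop (Suc t) ?b) (\<sigma>(Suc t := eval e \<sigma>), \<pi>, w) = (\<sigma>(t := \<sigma> t + eval e \<sigma> * eval f \<sigma>, Suc t := 0), \<pi>, w)"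
    unfolding lexec.simps(7) by (simp del: lexec.simps)
  moreover have "lexec X (cex e (Suc t)) (\<sigma>, \<pi>, w) = (\<sigma>(Suc t := eval e \<sigma>), \<pi>, w)"
    using IH1[OF sub(1), of \<sigma>] Times.prems(2) by simp
  ultimately have "lexec X (cex (Times e f) t) (\<sigma>, \<pi>, w) = (\<sigma>(t := \<sigma> t + eval e \<sigma> * eval f \<sigma>, Suc t := 0), \<pi>, w)"
    by (simp del: lexec.simps(7))
  then show ?case using Times.prems(2)[of "Suc t"] by (simp del: lexec.simps cex.simps) (auto simp: fun_eq_iff)
next
  case (Minus e f)
  have IH1: "lexec X (cex e t') (\<sigma>', \<pi>, w) = (\<sigma>'(t' := \<sigma>' t' + eval e \<sigma>'), \<pi>, w)"
    if "exvars e \<subseteq> {..<t'}" "\<And>r. r > t' \<Longrightarrow> \<sigma>' r = 0" for t' \<sigma>'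
    by (rule Minus.IH(1)[OF that])
  have IH2: "lexec X (cex f t') (\<sigma>', \<pi>, w) = (\<sigma>'(t' := \<sigma>' t' + eval f \<sigma>'), \<pi>, w)"
    if "exvars f \<subseteq> {..<t'}" "\<And>r. r > t' \<Longrightarrow> \<sigma>' r = 0" for t' \<sigma>'
    by (rule Minus.IH(2)[OF that])
  have nin: "Suc t \<notin> exvars f" using Minus.prems by auto
  have sub: "exvars e \<subseteq> {..<Suc t}" "exvars f \<subseteq> {..<Suc (Suc t)}" using Minus.prems(1) by auto
  have 1: "lexec X (cex e (Suc t)) (\<sigma>, \<pi>, w) = (\<sigma>(Suc t := eval e \<sigma>), \<pi>, w)"
    using IH1[OF sub(1), of \<sigma>] Minus.prems(2) by simp
  have 2: "lexec X (cex f (Suc (Suc t))) (\<sigma>(Suc t := eval e \<sigma>), \<pi>, w) = (\<sigma>(Suc t := eval e \<sigma>, Suc (Suc t) := eval f \<sigma>), \<pi>, w)"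
    using IH2[OF sub(2), of "\<sigma>(Suc t := eval e \<sigma>)"] Minus.prems(2) nin by (simp add: eval_upd)
  show ?case using Minus.prems(2)[of "Suc t"] Minus.prems(2)[of "Suc (Suc t)"]
    by (simp add: 1 2 loop_inc loop_dec del: lexec.simps(7)) (auto simp: fun_eq_iff)
qed

lemma lregs_cex: "lregs (cex e t) \<subseteq> exvars e \<union> {t..}"
proof (induction e arbitrary: t)
  case (C k)
  have "lregs (((LSeq (LInc t)) ^^ k) LSkip) \<subseteq> {t}" by (induction k) auto
  then show ?case by auto
next
  case (Plus e f)
  have "lregs (cex e t) \<subseteq> exvars e \<union> {t..}" "lregs (cex f t) \<subseteq> exvars f \<union> {t..}" by (rule Plus)+
  then show ?case by auto
next
  case (Times e f)
  have "lregs (cex e (Suc t)) \<subseteq> exvars e \<union> {Suc t..}"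
    "lregs (cex f (Suc (Suc t))) \<subseteq> exvars f \<union> {Suc (Suc t)..}" by (rule Times)+
  then show ?case by auto
next
  case (Minus e f)
  have "lregs (cex e (Suc t)) \<subseteq> exvars e \<union> {Suc t..}"
    "lregs (cex f (Suc (Suc t))) \<subseteq> exvars f \<union> {Suc (Suc t)..}" by (rule Minus)+
  then show ?case by auto
qed auto

lemma lok_cex: "exvars e \<subseteq> {..<t} \<Longrightarrow> lok (cex e t)"
proof (induction e arbitrary: t)
  case (C k)
  have "lok (((LSeq (LInc t)) ^^ k) LSkip)" by (induction k) auto
  then show ?case by simp
next
  case (Times e f)
  have "exvars e \<subseteq> {..<Suc t}" "exvars f \<subseteq> {..<Suc (Suc t)}" using Times.prems by auto
  moreover have "Suc t \<notin> exvars f" using Times.prems by auto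
  then have "Suc t \<notin> lregs (cex f (Suc (Suc t)))" using lregs_cex[of f "Suc (Suc t)"] by auto
  ultimately show ?case using Times.IH by simp
next
  case (Minus e f)
  have "exvars e \<subseteq> {..<Suc t}" "exvars f \<subseteq> {..<Suc (Suc t)}" using Minus.prems by auto
  then show ?case using Minus.IH by simp
qed auto

lemma lregs_ccom: "lregs (ccom c t) \<subseteq> vars c \<union> {t..}"
proof (induction c arbitrary: t)
  case (Assign x e)
  then show ?case using lregs_cex[of e t] by auto
next
  case (For e c)
  have "lregs (ccom c (Suc t)) \<subseteq> vars c \<union> {Suc t..}" by (rule For)
  then show ?case using lregs_cex[of e t] by auto
next
  case (Seq c d)
  have "lregs (ccom c t) \<subseteq> vars c \<union> {t..}" "lregs (ccom d t) \<subseteq> vars d \<union> {t..}" by (rule Seq)+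
  then show ?case by auto
qed auto

lemma lok_ccom: "vars c \<subseteq> {..<t} \<Longrightarrow> lok (ccom c t)"
proof (induction c arbitrary: t)
  case (Assign x e)
  then show ?case by (auto simp: lok_cex)
next
  case (For e c)
  then have "vars c \<subseteq> {..<Suc t}" "t \<notin> vars c" "exvars e \<subseteq> {..<t}" by auto
  moreover from this have "t \<notin> lregs (ccom c (Suc t))" using lregs_ccom[of c "Suc t"] by auto
  ultimately show ?case using For.IH by (simp add: lok_cex)
qed auto

lemma ccom_correct:
  "vars c \<subseteq> {..<t} \<Longrightarrow> (\<And>r. r \<ge> t \<Longrightarrow> \<sigma> r = 0) \<Longrightarrow> lexec X (ccom c t) (\<sigma>, \<pi>, w) = exec X c (\<sigma>, \<pi>, w)"
proof (induction c arbitrary: t \<sigma> \<pi> w)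
  case (Assign x e)
  then have "x < t" "\<sigma> t = 0" "exvars e \<subseteq> {..<t}" by auto
  then show ?case using Assign.prems
    by (simp add: cex_correct loop_inc loop_skip del: lexec.simps(7)) (auto simp: fun_eq_iff)
next
  case (Seq c d)
  obtain \<sigma>' \<pi>' w' where s: "exec X c (\<sigma>, \<pi>, w) = (\<sigma>', \<pi>', w')" by (cases "exec X c (\<sigma>, \<pi>, w)")
  have "\<sigma>' r = 0" if "r \<ge> t" for r
  proof -
    have "r \<notin> vars c" using Seq.prems(1) that by auto
    then show ?thesis using exec_unchanged[of r c X "(\<sigma>, \<pi>, w)"] Seq.prems(2) that by (simp add: s)
  qed
  then show ?case using Seq s by simp
next
  case (For e c)
  have t: "t \<notin> vars c" "vars c \<subseteq> {..<Suc t}" "exvars e \<subseteq> {..<t}" using For.prems by auto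
  \<comment> \<open>The counter \<open>t\<close> lies outside \<open>vars c\<close>, so the source
    semantics carries it along unchanged.\<close>
  have body: "lexec X (ccom c (Suc t)) (set_reg t j s) = set_reg t j (exec X c s)"
    if "\<forall>r>t. fst s r = 0" for s j
  proof -
    obtain \<sigma>' \<pi>' w' where s: "s = (\<sigma>', \<pi>', w')" by (cases s)
    have "lexec X (ccom c (Suc t)) (\<sigma>'(t := j), \<pi>', w') = exec X c (\<sigma>'(t := j), \<pi>', w')"
      using t that by (intro For.IH) (auto simp: s)
    then show ?thesis using exec_frame[OF t(1), of X j s] by (simp add: s)
  qed
  have zero: "\<forall>r>t. fst ((exec X c ^^ k) (\<sigma>, \<pi>, w)) r = 0" for k
  proof (induction k)
    case (Suc k)
    have "r \<notin> vars c" if "r > t" for r using t(2) that by auto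
    then show ?case using Suc exec_unchanged[of _ c X "(exec X c ^^ k) (\<sigma>, \<pi>, w)"] by auto
  qed (use For.prems in auto)
  have "((\<lambda>(\<sigma>, \<pi>, w). lexec X (ccom c (Suc t)) (\<sigma>(t := \<sigma> t - 1), \<pi>, w)) ^^ k) (set_reg t j (\<sigma>, \<pi>, w))
     = set_reg t (j - k) ((exec X c ^^ k) (\<sigma>, \<pi>, w))" for k j
  proof (induction k)
    case (Suc k)
    obtain a b v where e: "(exec X c ^^ k) (\<sigma>, \<pi>, w) = (a, b, v)"
      by (cases "(exec X c ^^ k) (\<sigma>, \<pi>, w)")
    have u: "(a(t := j - k))(t := (a(t := j - k)) t - 1) = a(t := j - Suc k)" by auto
    show ?case
      using body[OF zero[of k], of "j - Suc k"] unfolding funpow.simps comp_apply e prod.case Suc[unfolded e prod.case] u .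
  qed simp
  from this[of "eval e \<sigma>" "eval e \<sigma>"]
  have "lexec X (LLoop t (ccom c (Suc t))) (\<sigma>(t := eval e \<sigma>), \<pi>, w) = set_reg t 0 ((exec X c ^^ eval e \<sigma>) (\<sigma>, \<pi>, w))"
    by simp
  also have "\<dots> = (exec X c ^^ eval e \<sigma>) (\<sigma>, \<pi>, w)"
  proof -
    have "(exec X c ^^ k) (\<sigma>(t := 0), \<pi>, w) = set_reg t 0 ((exec X c ^^ k) (\<sigma>, \<pi>, w))" for k
      using exec_frame[OF t(1), of X 0] by (induction k) auto
    moreover have "\<sigma>(t := 0) = \<sigma>" using For.prems by auto
    ultimately show ?thesis by metis
  qed
  finally show ?case using t For.prems by (simp add: cex_correct del: lexec.simps(7))
qed auto

definition prints :: "(bool \<Rightarrow> nat \<Rightarrow> symbol) \<Rightarrow> com \<Rightarrow> (nat \<Rightarrow> bool) \<Rightarrow> bool" where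
  "prints X c q \<longleftrightarrow> (\<forall>i. \<exists>k. i < length (snd (snd ((exec X c ^^ k) pinit))) \<and>
     snd (snd ((exec X c ^^ k) pinit)) ! i = q i)"

text \<open>Between iterations all registers from \<open>t\<close> on are 0 again, as
  \<open>ccom_correct\<close> demands of its start state.\<close>

theorem program_computable:
  "\<exists>M. t2_wf M \<and> num_inputs M = 2 \<and> (\<forall>X q. prints X c q \<longrightarrow> t2_outputs M [X False, X True] q)"
proof -
  obtain t where t: "vars c \<subseteq> {..<t}" using finite_vars[of c] finite_nat_iff_bounded by blast
  have "(lexec X (ccom c t) ^^ k) pinit = (exec X c ^^ k) pinit \<and> (\<forall>r\<ge>t. fst ((exec X c ^^ k) pinit) r = 0)" for X k
  proof (induction k)
    case (Suc k)
    obtain \<sigma> \<pi> w where s: "(exec X c ^^ k) pinit = (\<sigma>, \<pi>, w)" by (cases "(exec X c ^^ k) pinit")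
    have "r \<notin> vars c" if "r \<ge> t" for r using t that by auto
    then show ?case using Suc s ccom_correct[OF t, of \<sigma> X \<pi> w] exec_unchanged[of _ c X "(\<sigma>, \<pi>, w)"] by auto
  qed auto
  then show ?thesis using loop_program_computable[OF lok_ccom[OF t]] by (simp add: prints_def)
qed

section \<open>Program fragments\<close>

text \<open>Pairing splits the registers into infinitely many disjoint infinite arrays.\<close>

definition rg :: "nat \<Rightarrow> nat \<Rightarrow> nat" where
  "rg k i = prod_encode (k, i)"

lemma rg_eq [simp]: "rg k i = rg k' j \<longleftrightarrow> k = k' \<and> i = j"
  by (simp add: rg_def)

primrec seqs :: "com list \<Rightarrow> com" where
  "seqs [] = Skip"
| "seqs (c # cs) = c ;; seqs cs"

lemma exec_seqs_append: "exec X (seqs (cs @ ds)) s = exec X (seqs ds) (exec X (seqs cs) s)"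
  by (induction cs arbitrary: s) auto

lemma exec_seqs_upt_Suc: "exec X (seqs (map f [0..<Suc n])) s = exec X (f n) (exec X (seqs (map f [0..<n])) s)"
  by (simp add: exec_seqs_append)

text \<open>\<open>1 - (1 - e)\<close> is the sign of \<open>e\<close> under truncated subtraction,
  so the loop runs at most once.\<close>

definition Cond :: "ex \<Rightarrow> com \<Rightarrow> com" where
  "Cond e c = For (Minus (C 1) (Minus (C 1) e)) c"

lemma exec_Cond: "exec X (Cond e c) s = (if eval e (fst s) = 0 then s else exec X c s)"
  by (simp add: Cond_def)

subsection \<open>Enumerating candidates\<close>

definition rU :: nat where "rU = rg 3 0"
definition rX :: nat where "rX = rg 3 1"
definition rY :: nat where "rY = rg 3 2"
definition rZ :: nat where "rZ = rg 3 3"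

lemmas r_defs = rU_def rX_def rY_def rZ_def

text \<open>The successor along the antidiagonals of the Cantor pairing. Iterating it from
  \<open>(0, 0)\<close> unpairs a number without any search.\<close>

fun walk :: "nat \<times> nat \<Rightarrow> nat \<times> nat" where
  "walk (x, y) = (if y = 0 then (0, Suc x) else (Suc x, y - 1))"

lemma prod_decode_Suc: "prod_decode (Suc c) = walk (prod_decode c)"
proof -
  obtain x y where xy: "prod_decode c = (x, y)" by force
  then have "c = prod_encode (x, y)" by (metis prod_decode_inverse)
  then have "prod_encode (walk (x, y)) = Suc c"
    by (cases y) (auto simp: prod_encode_def)
  then show ?thesis unfolding xy by (metis prod_encode_inverse)
qed

text \<open>\<open>walk\<close> without branching: sign factors select the case, and
  \<open>rZ\<close> saves \<open>x + 1\<close> because \<open>rX\<close> is overwritten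
  first.\<close>

definition wcode :: com where
  "wcode = (rZ :=: Plus (V rX) (C 1)) ;; (rX :=: Times (Minus (C 1) (Minus (C 1) (V rY))) (V rZ)) ;;
     (rY :=: Plus (Minus (V rY) (C 1)) (Times (Minus (C 1) (V rY)) (V rZ)))"

definition ucode :: com where
  "ucode = (rX :=: C 0) ;; (rY :=: C 0) ;; For (V rU) wcode"

lemma exec_wcode:
  "\<exists>\<sigma>'. exec X wcode (\<sigma>, \<pi>, w) = (\<sigma>', \<pi>, w) \<and> (\<sigma>' rX, \<sigma>' rY) = walk (\<sigma> rX, \<sigma> rY) \<and>
     (\<forall>r. r \<notin> {rX, rY, rZ} \<longrightarrow> \<sigma>' r = \<sigma> r)"
  by (cases "\<sigma> rY") (simp_all add: wcode_def r_defs)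

lemma exec_wcode_iter:
  "\<exists>\<sigma>'. (exec X wcode ^^ k) (\<sigma>, \<pi>, w) = (\<sigma>', \<pi>, w) \<and> (\<sigma>' rX, \<sigma>' rY) = (walk ^^ k) (\<sigma> rX, \<sigma> rY) \<and>
     (\<forall>r. r \<notin> {rX, rY, rZ} \<longrightarrow> \<sigma>' r = \<sigma> r)"
proof (induction k)
  case (Suc k)
  then obtain \<sigma>1 where 1: "(exec X wcode ^^ k) (\<sigma>, \<pi>, w) = (\<sigma>1, \<pi>, w)"
    "(\<sigma>1 rX, \<sigma>1 rY) = (walk ^^ k) (\<sigma> rX, \<sigma> rY)" "\<forall>r. r \<notin> {rX, rY, rZ} \<longrightarrow> \<sigma>1 r = \<sigma> r" by blast
  obtain \<sigma>2 where 2: "exec X wcode (\<sigma>1, \<pi>, w) = (\<sigma>2, \<pi>, w)"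
    "(\<sigma>2 rX, \<sigma>2 rY) = walk (\<sigma>1 rX, \<sigma>1 rY)" "\<forall>r. r \<notin> {rX, rY, rZ} \<longrightarrow> \<sigma>2 r = \<sigma>1 r"
    using exec_wcode by blast
  show ?case
    using 1 2 by (intro exI[of _ \<sigma>2]) (auto simp del: walk.simps)
qed auto

lemma exec_ucode:
  "\<exists>\<sigma>'. exec X ucode (\<sigma>, \<pi>, w) = (\<sigma>', \<pi>, w) \<and> (\<sigma>' rX, \<sigma>' rY) = prod_decode (\<sigma> rU) \<and>
     (\<forall>r. r \<notin> {rX, rY, rZ} \<longrightarrow> \<sigma>' r = \<sigma> r)"
proof -
  define \<sigma>0 where "\<sigma>0 = \<sigma>(rX := 0, rY := 0)"
  have 0: "prod_decode 0 = (0, 0)" by (simp add: prod_decode_def prod_decode_aux.simps)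
  have "(walk ^^ k) (0, 0) = prod_decode k" for k
    by (induction k) (simp_all add: 0 prod_decode_Suc del: walk.simps)
  moreover have "exec X ucode (\<sigma>, \<pi>, w) = (exec X wcode ^^ (\<sigma> rU)) (\<sigma>0, \<pi>, w)"
    by (simp add: ucode_def \<sigma>0_def r_defs)
  moreover have "\<sigma>0 rX = 0" "\<sigma>0 rY = 0" "\<And>r. r \<notin> {rX, rY, rZ} \<Longrightarrow> \<sigma>0 r = \<sigma> r" by (auto simp: \<sigma>0_def)
  ultimately show ?thesis using exec_wcode_iter[where k = "\<sigma> rU" and X = X and \<sigma> = \<sigma>0 and \<pi> = \<pi> and w = w]
    by (elim exE) (rule exI, auto simp del: walk.simps)
qed

definition cand :: "nat \<Rightarrow> nat \<Rightarrow> nat" where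
  "cand z r = fst (prod_decode (((\<lambda>z. snd (prod_decode z)) ^^ r) z))"

text \<open>Codes are right-nested pairs, and 0 unpairs to \<open>(0, 0)\<close>, so the zero
  sequence has code 0; a further entry in front is one more pairing.\<close>

lemma cand_surj: "(\<And>r. r \<ge> R \<Longrightarrow> c r = 0) \<Longrightarrow> \<exists>z. cand z = c"
proof (induction R arbitrary: c)
  case 0
  have 0: "prod_decode 0 = (0, 0)" by (simp add: prod_decode_def prod_decode_aux.simps)
  have "((\<lambda>z. snd (prod_decode z)) ^^ r) 0 = 0" for r by (induction r) (simp_all add: 0)
  then have "cand 0 = c" using "0.prems" by (auto simp: cand_def 0)
  then show ?case by blast
next
  case (Suc R)
  have "\<exists>z. cand z = (\<lambda>r. c (Suc r))" by (rule Suc.IH) (use Suc.prems in auto)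
  then obtain z where z: "cand z = (\<lambda>r. c (Suc r))" by (rule exE)
  have "cand (prod_encode (c 0, z)) r = c r" for r
  proof (cases r)
    case (Suc r')
    then show ?thesis using fun_cong[OF z, of r'] by (simp add: cand_def funpow_Suc_right del: funpow.simps)
  qed (simp add: cand_def)
  then show ?case by blast
qed

definition dcode :: "nat \<Rightarrow> com" where
  "dcode R = seqs (map (\<lambda>r. ucode ;; (rg 4 r :=: V rX) ;; (rU :=: V rY)) [0..<R])"

lemma exec_dcode:
  "\<exists>\<sigma>'. exec X (dcode R) (\<sigma>, \<pi>, w) = (\<sigma>', \<pi>, w) \<and> (\<forall>r<R. \<sigma>' (rg 4 r) = cand (\<sigma> rU) r) \<and>
     \<sigma>' rU = ((\<lambda>z. snd (prod_decode z)) ^^ R) (\<sigma> rU) \<and>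
     (\<forall>k j. k \<noteq> 3 \<and> (k \<noteq> 4 \<or> R \<le> j) \<longrightarrow> \<sigma>' (rg k j) = \<sigma> (rg k j))"
proof (induction R)
  case 0
  then show ?case by (simp add: dcode_def)
next
  case (Suc R)
  then obtain \<sigma>1 where 1: "exec X (dcode R) (\<sigma>, \<pi>, w) = (\<sigma>1, \<pi>, w)" "\<forall>r<R. \<sigma>1 (rg 4 r) = cand (\<sigma> rU) r"
    "\<sigma>1 rU = ((\<lambda>z. snd (prod_decode z)) ^^ R) (\<sigma> rU)"
    "\<forall>k j. k \<noteq> 3 \<and> (k \<noteq> 4 \<or> R \<le> j) \<longrightarrow> \<sigma>1 (rg k j) = \<sigma> (rg k j)" by blast
  obtain \<sigma>2 where 2: "exec X ucode (\<sigma>1, \<pi>, w) = (\<sigma>2, \<pi>, w)" "(\<sigma>2 rX, \<sigma>2 rY) = prod_decode (\<sigma>1 rU)"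
    "\<forall>r. r \<notin> {rX, rY, rZ} \<longrightarrow> \<sigma>2 r = \<sigma>1 r" using exec_ucode by blast
  have x: "\<sigma>2 rX = cand (\<sigma> rU) R" "\<sigma>2 rY = ((\<lambda>z. snd (prod_decode z)) ^^ Suc R) (\<sigma> rU)"
    using 2(2) 1(3) by (auto simp: cand_def dest: arg_cong[of _ _ fst] arg_cong[of _ _ snd])
  define \<sigma>3 where "\<sigma>3 = \<sigma>2(rg 4 R := \<sigma>2 rX, rU := \<sigma>2 rY)"
  have "rY \<noteq> rg 4 R" by (simp add: r_defs)
  then have "exec X (dcode (Suc R)) (\<sigma>, \<pi>, w) = (\<sigma>3, \<pi>, w)"
    using 1(1) 2(1) unfolding dcode_def exec_seqs_upt_Suc \<sigma>3_def by simp
  moreover have "\<sigma>3 (rg 4 r) = cand (\<sigma> rU) r" if "r < Suc R" for r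
    using that 1(2) 2(3) x(1) by (auto simp: \<sigma>3_def r_defs less_Suc_eq)
  moreover have "\<sigma>3 rU = ((\<lambda>z. snd (prod_decode z)) ^^ Suc R) (\<sigma> rU)" using x(2) by (simp add: \<sigma>3_def)
  moreover have "\<sigma>3 (rg k j) = \<sigma> (rg k j)" if "k \<noteq> 3 \<and> (k \<noteq> 4 \<or> Suc R \<le> j)" for k j
    using that 1(4) 2(3) by (auto simp: \<sigma>3_def r_defs)
  ultimately show ?case by blast
qed

subsection \<open>Parsing the input\<close>

text \<open>State of the parser for one component: length of the current block of ones, number of
  blocks read modulo 3, last two blocks, last complete triple, and \<open>2 ^ k\<close> if this triple is the
  \<open>k\<close>-th one (\<open>0\<close> if there is none yet).\<close>

type_synonym parser = "nat \<times> nat \<times> nat \<times> nat \<times> nat \<times> nat \<times> nat \<times> nat"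

text \<open>\<open>ph - 1 = 0\<close> holds in phases 0 and 1. In phase 2 the factor
  \<open>1 - (ph - 1)\<close> resets the phase to 0, and \<open>2 * W + (1 - W)\<close> starts the
  weight at 1 and doubles it afterwards.\<close>

fun pstep :: "parser \<Rightarrow> bool \<Rightarrow> parser" where
  "pstep (k, ph, z1, z2, a, b, c, W) True = (Suc k, ph, z1, z2, a, b, c, W)"
| "pstep (k, ph, z1, z2, a, b, c, W) False =
     (if ph - 1 = 0 then (0, Suc ph, z2, k, a, b, c, W)
      else (0, (1 - (ph - 1)) * Suc ph, z2, k, z1, z2, k, 2 * W + (1 - W)))"

primrec parse :: "(nat \<Rightarrow> bool) \<Rightarrow> nat \<Rightarrow> parser" where
  "parse p 0 = (0, 0, 0, 0, 0, 0, 0, 0)"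
| "parse p (Suc t) = pstep (parse p t) (p t)"

text \<open>\<open>m\<close> is the number of completed blocks; the first triple is complete at
  \<open>m = 3\<close>, hence the index \<open>m div 3 - 1\<close>.\<close>

lemma parse_encodes:
  assumes p: "encodes p u"
  shows "\<exists>m k z1 z2 a b c W. parse p t = (k, m mod 3, z1, z2, a, b, c, W) \<and> t = length (enc u m) + k \<and> k \<le> u m \<and>
    (m mod 3 \<noteq> 0 \<longrightarrow> z2 = u (m - 1)) \<and> (m mod 3 = 2 \<longrightarrow> z1 = u (m - 2)) \<and>
    (if m < 3 then W = 0 else W = 2 ^ (m div 3 - 1) \<and> a = u (3 * (m div 3 - 1)) \<and>
       b = u (3 * (m div 3 - 1) + 1) \<and> c = u (3 * (m div 3 - 1) + 2))"
proof (induction t)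
  case 0
  show ?case by (rule exI[of _ 0]) simp
next
  case (Suc t)
  then obtain m k z1 z2 a b c W where IH: "parse p t = (k, m mod 3, z1, z2, a, b, c, W)" "t = length (enc u m) + k" "k \<le> u m"
    "m mod 3 \<noteq> 0 \<longrightarrow> z2 = u (m - 1)" "m mod 3 = 2 \<longrightarrow> z1 = u (m - 2)"
    "if m < 3 then W = 0 else W = 2 ^ (m div 3 - 1) \<and> a = u (3 * (m div 3 - 1)) \<and>
       b = u (3 * (m div 3 - 1) + 1) \<and> c = u (3 * (m div 3 - 1) + 2)" by blast
  show ?case
  proof (cases "k < u m")
    case True
    then have "p t" using encodes_block(1)[OF p True] IH(2) by simp
    then have e: "parse p (Suc t) = (Suc k, m mod 3, z1, z2, a, b, c, W)" by (simp add: IH(1))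
    have "Suc t = length (enc u m) + Suc k" "Suc k \<le> u m" using IH(2) True by simp_all
    with e IH(4-6) show ?thesis by blast
  next
    case False
    then have k: "k = u m" using IH(3) by simp
    then have np: "\<not> p t" using encodes_block(2)[OF p, of m] IH(2) by simp
    have len: "Suc t = length (enc u (Suc m)) + 0" using IH(2) k by (simp add: enc_Suc)
    show ?thesis
    proof (cases "m mod 3 = 2")
      case True
      then have m: "Suc m mod 3 = 0" "Suc m div 3 = Suc (m div 3)" "3 * (m div 3) = m - 2" "m \<ge> 2" by presburger+
      have e: "parse p (Suc t) = (0, 0, z2, k, z1, z2, k, 2 * W + (1 - W))"
        using np True by (simp add: IH(1))
      have W: "2 * W + (1 - W) = 2 ^ (m div 3)"
      proof (cases "m < 3")
        case False
        then obtain j where "m div 3 = Suc j" by (metis div_greater_zero_iff gr0_conv_Suc not_less zero_less_numeral)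
        then show ?thesis using IH(6) False by simp
      qed (use IH(6) in auto)
      have u: "z1 = u (m - 2)" "z2 = u (m - 2 + 1)" "k = u (m - 2 + 2)"
        using IH(4,5) True k m(4) by (auto simp: numeral_2_eq_2 Suc_diff_Suc)
      have e': "parse p (Suc t) = (0, Suc m mod 3, z2, k, z1, z2, k, 2 ^ (Suc m div 3 - 1))"
        unfolding e W m(1) m(2) by simp
      have c: "if Suc m < 3 then (2::nat) ^ (Suc m div 3 - 1) = 0
        else (2::nat) ^ (Suc m div 3 - 1) = 2 ^ (Suc m div 3 - 1) \<and> z1 = u (3 * (Suc m div 3 - 1)) \<and>
          z2 = u (3 * (Suc m div 3 - 1) + 1) \<and> k = u (3 * (Suc m div 3 - 1) + 2)"
        using m(4) u unfolding m(2) diff_Suc_1 m(3) by simp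
      have "Suc m mod 3 \<noteq> 0 \<longrightarrow> k = u (Suc m - 1)" "Suc m mod 3 = 2 \<longrightarrow> z2 = u (Suc m - 2)" using m(1) by simp_all
      with e' len c show ?thesis by (intro exI conjI) (assumption | simp)+
    next
      case False
      then have m: "Suc m mod 3 = Suc (m mod 3)" "Suc m div 3 = m div 3" "m mod 3 - 1 = 0" "m < 3 \<longleftrightarrow> Suc m < 3" by presburger+
      have e: "parse p (Suc t) = (0, Suc (m mod 3), z2, k, a, b, c, W)"
        using np m(3) by (simp add: IH(1))
      have e': "parse p (Suc t) = (0, Suc m mod 3, z2, k, a, b, c, W)" unfolding e m(1) by simp
      have "Suc m mod 3 \<noteq> 0 \<longrightarrow> k = u (Suc m - 1)" using k by simp
      moreover have "Suc m mod 3 = 2 \<longrightarrow> z2 = u (Suc m - 2)" using IH(4) m(1) by (simp add: numeral_2_eq_2)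
      moreover have "if Suc m < 3 then W = 0 else W = 2 ^ (Suc m div 3 - 1) \<and> a = u (3 * (Suc m div 3 - 1)) \<and>
       b = u (3 * (Suc m div 3 - 1) + 1) \<and> c = u (3 * (Suc m div 3 - 1) + 2)"
        using IH(6) unfolding m(2) m(4) .
      ultimately show ?thesis using e' len by (intro exI conjI) (assumption | simp)+
    qed
  qed
qed

definition pfrac :: "parser \<Rightarrow> real" where
  "pfrac = (\<lambda>(k, ph, z1, z2, a, b, c, W). frac a b c)"

definition pweight :: "parser \<Rightarrow> nat" where
  "pweight = (\<lambda>(k, ph, z1, z2, a, b, c, W). W)"

text \<open>Before the first complete triple the weight is 0 and the bound holds trivially;
  afterwards the weight \<open>2 ^ k\<close> belongs to the \<open>k\<close>-th rational. Since
  blocks are finite, the weights exceed every bound from some point on.\<close>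

lemma parse_approx:
  assumes "cauchy_rep p x"
  shows "\<bar>pfrac (parse p t) - x\<bar> * real (pweight (parse p t)) \<le> 1"
    and "\<exists>t0. \<forall>t\<ge>t0. E \<le> pweight (parse p t)"
proof -
  obtain u where u: "encodes p u" "\<And>k. \<bar>x - of_rat (rat_at u k)\<bar> \<le> 1 / 2 ^ k"
    using assms by (auto simp: cauchy_rep_def)
  obtain m k z1 z2 a b c W where *: "parse p t = (k, m mod 3, z1, z2, a, b, c, W)"
    "if m < 3 then W = 0 else W = 2 ^ (m div 3 - 1) \<and> a = u (3 * (m div 3 - 1)) \<and>
       b = u (3 * (m div 3 - 1) + 1) \<and> c = u (3 * (m div 3 - 1) + 2)"
    using parse_encodes[OF u(1), of t] by blast
  show "\<bar>pfrac (parse p t) - x\<bar> * real (pweight (parse p t)) \<le> 1"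
  proof (cases "m < 3")
    case False
    then have "pfrac (parse p t) = of_rat (rat_at u (m div 3 - 1))" "pweight (parse p t) = 2 ^ (m div 3 - 1)"
      using * by (simp_all add: pfrac_def pweight_def of_rat_rat_at)
    then show ?thesis using u(2)[of "m div 3 - 1"] by (simp add: abs_minus_commute field_simps)
  qed (use * in \<open>auto simp: pweight_def\<close>)
  have "E \<le> pweight (parse p t)" if t: "length (enc u (3 * (E + 1))) \<le> t" for t
  proof -
    obtain m k z1 z2 a b c W where *: "parse p t = (k, m mod 3, z1, z2, a, b, c, W)" "t = length (enc u m) + k" "k \<le> u m"
    "if m < 3 then W = 0 else W = 2 ^ (m div 3 - 1) \<and> a = u (3 * (m div 3 - 1)) \<and>
       b = u (3 * (m div 3 - 1) + 1) \<and> c = u (3 * (m div 3 - 1) + 2)"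
      using parse_encodes[OF u(1), of t] by blast
    have "3 * (E + 1) \<le> m"
    proof (rule ccontr)
      assume "\<not> ?thesis"
      then have "length (enc u (Suc m)) \<le> length (enc u (3 * (E + 1)))" by (intro length_enc_mono) simp
      then show False using t *(2,3) by (simp add: enc_Suc)
    qed
    then have "E \<le> m div 3 - 1" "\<not> m < 3" by presburger+
    then have "E < 2 ^ (m div 3 - 1)" "W = 2 ^ (m div 3 - 1)"
      using less_exp[of "m div 3 - 1"] *(4) by (auto intro: le_less_trans)
    then show ?thesis using *(1) by (simp add: pweight_def)
  qed
  then show "\<exists>t0. \<forall>t\<ge>t0. E \<le> pweight (parse p t)" by blast
qed

definition preg :: "(nat \<Rightarrow> nat) \<Rightarrow> nat \<Rightarrow> parser" where
  "preg \<sigma> i = (\<sigma> (rg 5 i), \<sigma> (rg 6 i), \<sigma> (rg 7 i), \<sigma> (rg 8 i), \<sigma> (rg 9 i), \<sigma> (rg 10 i), \<sigma> (rg 11 i), \<sigma> (rg 12 i))"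

text \<open>The bit just read drives one \<open>pstep\<close>. Each assignment precedes the one that
  overwrites its source.\<close>

definition rcode1 :: "nat \<Rightarrow> com" where
  "rcode1 i = (rg 14 0 :=: C 0) ;; Read False (rg 14 0) ;;
     Cond (V (rg 14 0)) (rg 5 i :=: Plus (V (rg 5 i)) (C 1)) ;;
     Cond (Minus (C 1) (V (rg 14 0)))
       (Cond (Minus (V (rg 6 i)) (C 1))
          ((rg 9 i :=: V (rg 7 i)) ;; (rg 10 i :=: V (rg 8 i)) ;; (rg 11 i :=: V (rg 5 i)) ;;
           (rg 12 i :=: Plus (Times (C 2) (V (rg 12 i))) (Minus (C 1) (V (rg 12 i))))) ;;
        (rg 7 i :=: V (rg 8 i)) ;; (rg 8 i :=: V (rg 5 i)) ;; (rg 5 i :=: C 0) ;;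
        (rg 6 i :=: Times (Minus (C 1) (Minus (V (rg 6 i)) (C 1))) (Plus (V (rg 6 i)) (C 1))))"

lemma exec_rcode1:
  "\<exists>\<sigma>'. exec X (rcode1 i) (\<sigma>, \<pi>, w) = (\<sigma>', \<pi>(False := Suc (\<pi> False)), w) \<and>
     preg \<sigma>' i = pstep (preg \<sigma> i) (X False (\<pi> False) = Some True) \<and>
     (\<forall>k j. (k \<notin> {5..12} \<or> j \<noteq> i) \<and> k \<noteq> 14 \<longrightarrow> \<sigma>' (rg k j) = \<sigma> (rg k j))"
proof (cases "X False (\<pi> False) = Some True")
  case True
  then show ?thesis by (simp add: rcode1_def exec_Cond preg_def; auto?)
next
  case False
  show ?thesis
  proof (cases "\<sigma> (rg 6 i) - 1 = 0")
    case True
    then have "(1 - (\<sigma> (rg 6 i) - 1)) * Suc (\<sigma> (rg 6 i)) = Suc (\<sigma> (rg 6 i))" by simp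
    then show ?thesis using False True by (simp add: rcode1_def exec_Cond preg_def; auto?)
  next
    case ph: False
    then show ?thesis using False by (simp add: rcode1_def exec_Cond preg_def; auto?)
  qed
qed

definition rcode :: "nat \<Rightarrow> com" where
  "rcode d = seqs (map rcode1 [0..<d])"

lemma exec_rcode:
  "\<exists>\<sigma>'. exec X (rcode d) (\<sigma>, \<pi>, w) = (\<sigma>', \<pi>(False := \<pi> False + d), w) \<and>
     (\<forall>i<d. preg \<sigma>' i = pstep (preg \<sigma> i) (X False (\<pi> False + i) = Some True)) \<and>
     (\<forall>k j. (k \<notin> {5..12} \<or> d \<le> j) \<and> k \<noteq> 14 \<longrightarrow> \<sigma>' (rg k j) = \<sigma> (rg k j))"
proof (induction d)
  case 0
  then show ?case by (simp add: rcode_def)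
next
  case (Suc d)
  then obtain \<sigma>1 where 1: "exec X (rcode d) (\<sigma>, \<pi>, w) = (\<sigma>1, \<pi>(False := \<pi> False + d), w)"
     "\<forall>i<d. preg \<sigma>1 i = pstep (preg \<sigma> i) (X False (\<pi> False + i) = Some True)"
     "\<forall>k j. (k \<notin> {5..12} \<or> d \<le> j) \<and> k \<noteq> 14 \<longrightarrow> \<sigma>1 (rg k j) = \<sigma> (rg k j)" by blast
  obtain \<sigma>2 where 2: "exec X (rcode1 d) (\<sigma>1, \<pi>(False := \<pi> False + d), w) = (\<sigma>2, \<pi>(False := \<pi> False + Suc d), w)"
     "preg \<sigma>2 d = pstep (preg \<sigma>1 d) (X False (\<pi> False + d) = Some True)"
     "\<forall>k j. (k \<notin> {5..12} \<or> j \<noteq> d) \<and> k \<noteq> 14 \<longrightarrow> \<sigma>2 (rg k j) = \<sigma>1 (rg k j)"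
    using exec_rcode1[of X d \<sigma>1 "\<pi>(False := \<pi> False + d)" w] by auto
  have "exec X (rcode (Suc d)) (\<sigma>, \<pi>, w) = (\<sigma>2, \<pi>(False := \<pi> False + Suc d), w)"
    unfolding rcode_def exec_seqs_upt_Suc by (fold rcode_def) (simp only: 1(1) 2(1))
  moreover have "preg \<sigma>1 d = preg \<sigma> d" using 1(3) by (simp add: preg_def)
  then have "preg \<sigma>2 i = pstep (preg \<sigma> i) (X False (\<pi> False + i) = Some True)" if "i < Suc d" for i
  proof (cases "i = d")
    case False
    then have "preg \<sigma>2 i = preg \<sigma>1 i" using 2(3) by (simp add: preg_def)
    then show ?thesis using 1(2) that False by simp
  qed (simp add: 2(2) \<open>preg \<sigma>1 d = preg \<sigma> d\<close>)
  moreover have "\<sigma>2 (rg k j) = \<sigma> (rg k j)" if "(k \<notin> {5..12} \<or> Suc d \<le> j) \<and> k \<noteq> 14" for k j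
  proof -
    have "\<sigma>2 (rg k j) = \<sigma>1 (rg k j)" using that by (intro 2(3)[rule_format]) auto
    also have "\<dots> = \<sigma> (rg k j)" using that by (intro 1(3)[rule_format]) auto
    finally show ?thesis .
  qed
  ultimately show ?case by blast
qed

subsection \<open>Tests in rational arithmetic\<close>

datatype tm = Fr ex ex ex | Add tm tm | Mul tm tm | Neg tm

primrec tval :: "tm \<Rightarrow> (nat \<Rightarrow> nat) \<Rightarrow> real" where
  "tval (Fr a b c) \<sigma> = frac (eval a \<sigma>) (eval b \<sigma>) (eval c \<sigma>)"
| "tval (Add s t) \<sigma> = tval s \<sigma> + tval t \<sigma>"
| "tval (Mul s t) \<sigma> = tval s \<sigma> * tval t \<sigma>"
| "tval (Neg t) \<sigma> = - tval t \<sigma>"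

text \<open>The triple \<open>(p, q, d)\<close> stands for \<open>(p - q) / d\<close>.\<close>

fun quot :: "tm \<Rightarrow> ex \<times> ex \<times> ex" where
  "quot (Fr a b c) = (a, b, Plus c (C 1))"
| "quot (Add s t) = (case (quot s, quot t) of ((p, q, d), (p', q', d')) \<Rightarrow>
     (Plus (Times p d') (Times p' d), Plus (Times q d') (Times q' d), Times d d'))"
| "quot (Mul s t) = (case (quot s, quot t) of ((p, q, d), (p', q', d')) \<Rightarrow>
     (Plus (Times p p') (Times q q'), Plus (Times p q') (Times q p'), Times d d'))"
| "quot (Neg t) = (case quot t of (p, q, d) \<Rightarrow> (q, p, d))"

lemma quot_correct:
  "quot t = (p, q, d) \<Longrightarrow> 0 < eval d \<sigma> \<and> real (eval p \<sigma>) - real (eval q \<sigma>) = tval t \<sigma> * real (eval d \<sigma>)"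
proof (induction t arbitrary: p q d)
  case (Fr a b c)
  have "frac x y z * (real z + 1) = real x - real y" for x y z :: nat
  proof -
    have "real z + 1 \<noteq> 0" by linarith
    then show ?thesis by (simp add: frac_def)
  qed
  from this[of "eval a \<sigma>" "eval b \<sigma>" "eval c \<sigma>"] show ?case using Fr by (auto simp: algebra_simps)
next
  case (Add s t)
  obtain p1 q1 d1 p2 q2 d2 where q: "quot s = (p1, q1, d1)" "quot t = (p2, q2, d2)" by (metis prod_cases3)
  note IH = Add.IH(1)[OF q(1)] Add.IH(2)[OF q(2)]
  have "real (eval p1 \<sigma>) = tval s \<sigma> * real (eval d1 \<sigma>) + real (eval q1 \<sigma>)"
    "real (eval p2 \<sigma>) = tval t \<sigma> * real (eval d2 \<sigma>) + real (eval q2 \<sigma>)" using IH by linarith+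
  then show ?case using Add.prems q IH by (auto simp: algebra_simps)
next
  case (Mul s t)
  obtain p1 q1 d1 p2 q2 d2 where q: "quot s = (p1, q1, d1)" "quot t = (p2, q2, d2)" by (metis prod_cases3)
  note IH = Mul.IH(1)[OF q(1)] Mul.IH(2)[OF q(2)]
  have "real (eval p1 \<sigma>) = tval s \<sigma> * real (eval d1 \<sigma>) + real (eval q1 \<sigma>)"
    "real (eval p2 \<sigma>) = tval t \<sigma> * real (eval d2 \<sigma>) + real (eval q2 \<sigma>)" using IH by linarith+
  then show ?case using Mul.prems q IH by (auto simp: algebra_simps)
next
  case (Neg t)
  obtain p1 q1 d1 where q: "quot t = (p1, q1, d1)" by (metis prod_cases3)
  then show ?case using Neg.prems Neg.IH[OF q] by (auto simp: algebra_simps)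
qed

text \<open>The comparison of \<open>(p - q) / d\<close> with \<open>(p' - q') / d'\<close>, cleared
  of denominators and with negative parts moved to the other side, since expressions range over
  natural numbers.\<close>

definition Le :: "tm \<Rightarrow> tm \<Rightarrow> ex" where
  "Le s t = (case (quot s, quot t) of ((p, q, d), (p', q', d')) \<Rightarrow>
     Minus (C 1) (Minus (Plus (Times p d') (Times q' d)) (Plus (Times p' d) (Times q d'))))"

lemma eval_Le: "eval (Le s t) \<sigma> \<noteq> 0 \<longleftrightarrow> tval s \<sigma> \<le> tval t \<sigma>"
proof -
  obtain p1 q1 d1 p2 q2 d2 where q: "quot s = (p1, q1, d1)" "quot t = (p2, q2, d2)" by (metis prod_cases3)
  note 1 = quot_correct[OF q(1), of \<sigma>] and 2 = quot_correct[OF q(2), of \<sigma>]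
  let ?D1 = "real (eval d1 \<sigma>)" and ?D2 = "real (eval d2 \<sigma>)"
  have "eval (Le s t) \<sigma> \<noteq> 0 \<longleftrightarrow> eval p1 \<sigma> * eval d2 \<sigma> + eval q2 \<sigma> * eval d1 \<sigma> \<le> eval p2 \<sigma> * eval d1 \<sigma> + eval q1 \<sigma> * eval d2 \<sigma>"
    by (simp add: Le_def q) linarith
  also have "\<dots> \<longleftrightarrow> real (eval p1 \<sigma> * eval d2 \<sigma> + eval q2 \<sigma> * eval d1 \<sigma>) \<le> real (eval p2 \<sigma> * eval d1 \<sigma> + eval q1 \<sigma> * eval d2 \<sigma>)"
    by (simp only: of_nat_le_iff)
  also have "\<dots> \<longleftrightarrow> (real (eval p1 \<sigma>) - real (eval q1 \<sigma>)) * ?D2 \<le> (real (eval p2 \<sigma>) - real (eval q2 \<sigma>)) * ?D1"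
    by (simp add: algebra_simps)
  also have "\<dots> \<longleftrightarrow> tval s \<sigma> * (?D1 * ?D2) \<le> tval t \<sigma> * (?D1 * ?D2)"
    using 1 2 by (simp add: mult_ac)
  also have "\<dots> \<longleftrightarrow> tval s \<sigma> \<le> tval t \<sigma>" proof -
    have "0 < ?D1 * ?D2" using 1 2 by simp
    then show ?thesis by (simp only: mult_le_cancel_right_pos)
  qed
  finally show ?thesis .
qed

definition Conj :: "nat \<Rightarrow> (nat \<Rightarrow> ex) \<Rightarrow> ex" where
  "Conj n f = foldr Times (map f [0..<n]) (C 1)"

lemma eval_Conj: "eval (Conj n f) \<sigma> \<noteq> 0 \<longleftrightarrow> (\<forall>i<n. eval (f i) \<sigma> \<noteq> 0)"
proof -
  have "eval (foldr Times es (C 1)) \<sigma> \<noteq> 0 \<longleftrightarrow> (\<forall>e\<in>set es. eval e \<sigma> \<noteq> 0)" for es by (induction es) auto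
  then show ?thesis by (auto simp: Conj_def)
qed

definition TSum :: "nat \<Rightarrow> (nat \<Rightarrow> tm) \<Rightarrow> tm" where
  "TSum n f = foldr Add (map f [0..<n]) (Fr (C 0) (C 0) (C 0))"

lemma tval_TSum: "tval (TSum n f) \<sigma> = (\<Sum>i<n. tval (f i) \<sigma>)"
proof -
  have "tval (foldr Add ts (Fr (C 0) (C 0) (C 0))) \<sigma> = (\<Sum>t\<leftarrow>ts. tval t \<sigma>)" for ts
    by (induction ts) (auto simp: frac_def)
  then show ?thesis by (simp add: TSum_def interv_sum_list_conv_sum_set_nat atLeast0LessThan comp_def)
qed

definition TNat :: "ex \<Rightarrow> tm" where
  "TNat e = Fr e (C 0) (C 0)"

lemma tval_TNat [simp]: "tval (TNat e) \<sigma> = real (eval e \<sigma>)"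
  by (simp add: TNat_def frac_def)

definition Eq :: "ex \<Rightarrow> ex \<Rightarrow> ex" where
  "Eq e f = Minus (C 1) (Plus (Minus e f) (Minus f e))"

lemma eval_Eq: "eval (Eq e f) \<sigma> \<noteq> 0 \<longleftrightarrow> eval e \<sigma> = eval f \<sigma>"
  by (auto simp: Eq_def)

subsection \<open>The eigenvector program\<close>

text \<open>Registers \<open>rg k i\<close>: iteration counter (\<open>k = 0\<close>), advice (\<open>1\<close>), \<open>P\<close> (\<open>2\<close>), scratch (\<open>3, 14, 15\<close>),
  candidate (\<open>4\<close>), parsers (\<open>5..12\<close>), last accepted vector (\<open>13\<close>).\<close>

definition entry_tm :: "nat \<Rightarrow> nat \<Rightarrow> tm" where
  "entry_tm i j = (let k = upper_index (min i j) (max i j) in Fr (V (rg 9 k)) (V (rg 10 k)) (V (rg 11 k)))"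

definition slot_tm :: "nat \<Rightarrow> tm" where
  "slot_tm s = Fr (V (rg 4 (3 * s))) (V (rg 4 (3 * s + 1))) (V (rg 4 (3 * s + 2)))"

definition prev_tm :: "nat \<Rightarrow> tm" where
  "prev_tm i = Fr (V (rg 13 (3 * i))) (V (rg 13 (3 * i + 1))) (V (rg 13 (3 * i + 2)))"

definition shift_tm :: "nat \<Rightarrow> nat \<Rightarrow> tm" where
  "shift_tm i l = Add (entry_tm i l) (Neg (Mul (slot_tm 0) (TNat (C (if i = l then 1 else 0)))))"

text \<open>The nested differences form the indicator of \<open>r < kk\<close>, with
  \<open>kk\<close> in the register \<open>rg 1 0\<close>.\<close>

definition cert_tm :: "nat \<Rightarrow> nat \<Rightarrow> nat \<Rightarrow> tm" where
  "cert_tm n i l = Add (Add (TSum n (\<lambda>m. Mul (slot_tm (1 + n + (i * n + m))) (shift_tm m l)))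
     (TSum n (\<lambda>r. Mul (TNat (Minus (C 1) (Minus (C 1) (Minus (V (rg 1 0)) (C r)))))
        (Mul (slot_tm (1 + n + n * n + (r * n + i))) (slot_tm (1 + n + n * n + (r * n + l)))))))
     (Neg (TNat (C (if i = l then 1 else 0))))"

definition rho_tm :: "nat \<Rightarrow> tm" where
  "rho_tm n = TSum n (\<lambda>i. TSum n (\<lambda>m. Add (TNat (C 1)) (Mul (slot_tm (1 + n + (i * n + m))) (slot_tm (1 + n + (i * n + m))))))"

definition resid_tm :: "nat \<Rightarrow> nat \<Rightarrow> tm" where
  "resid_tm n i = TSum n (\<lambda>l. Mul (shift_tm i l) (slot_tm (1 + l)))"

definition bulk_tm :: "nat \<Rightarrow> tm" where
  "bulk_tm n = TSum n (\<lambda>l. Add (TNat (C 1)) (Mul (slot_tm (1 + l)) (slot_tm (1 + l))))"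

definition eps_tm :: "nat \<Rightarrow> tm" where
  "eps_tm n = Fr (C 1) (C 0) (V (rg 4 (3 * slots n)))"

definition both :: "(tm \<Rightarrow> ex) \<Rightarrow> ex" where
  "both f = Times (f (TNat (C 1))) (f (Neg (TNat (C 1))))"

text \<open>\<open>accept\<close> and \<open>balanced\<close> as one expression: conjunction is
  multiplication, and testing both signs replaces absolute values. The denominator is given as
  \<open>4 * n - 1\<close> because \<open>Fr\<close> adds 1 to its third component.\<close>

definition test :: "nat \<Rightarrow> ex" where
  "test n =
     Times (Conj (n * (n + 1) div 2) (\<lambda>k. Minus (C 1) (Minus (Plus (V (rg 4 (3 * slots n))) (C 1)) (V (rg 12 k)))))
    (Times (both (\<lambda>s. Conj n (\<lambda>i. Conj n (\<lambda>l.
        Le (Add (Mul s (cert_tm n i l)) (Mul (rho_tm n) (eps_tm n))) (Fr (C 1) (C 0) (C (4 * n - 1)))))))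
    (Times (both (\<lambda>s. Conj n (\<lambda>i.
        Le (Mul (Mul (Mul (TNat (Plus (V (rg 2 0)) (C 1))) (TNat (C (128 * n ^ 3)))) (rho_tm n))
          (Add (Mul s (resid_tm n i)) (Mul (bulk_tm n) (eps_tm n)))) (TNat (C 1)))))
    (Times (both (\<lambda>s. Conj n (\<lambda>i.
        Le (Mul (TNat (Times (C 4) (V (rg 2 0)))) (Mul s (Add (slot_tm (1 + i)) (Neg (prev_tm i))))) (TNat (C 1)))))
    (Times (Le (TNat (C n)) (Add (TNat (Times (C n) (V (rg 2 0)))) (TSum n (\<lambda>i. Mul (slot_tm (1 + i)) (slot_tm (1 + i))))))
      (Conj n (\<lambda>i. Eq (Plus (Plus (V (rg 4 (3 * (1 + i)))) (V (rg 4 (3 * (1 + i) + 1)))) (V (rg 4 (3 * (1 + i) + 2))))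
        (V (rg 4 (3 * slots n + 1)))))))))"

definition creg :: "(nat \<Rightarrow> nat) \<Rightarrow> nat \<Rightarrow> nat" where
  "creg \<sigma> r = \<sigma> (rg 4 r)"

definition yreg :: "(nat \<Rightarrow> nat) \<Rightarrow> nat \<Rightarrow> real" where
  "yreg \<sigma> i = frac (\<sigma> (rg 13 (3 * i))) (\<sigma> (rg 13 (3 * i + 1))) (\<sigma> (rg 13 (3 * i + 2)))"

text \<open>All components of an accepted vector then have encodings of the same length
  \<open>cK n c + 3\<close>, so that their names can be written symbol by symbol in turn.\<close>

definition balanced :: "nat \<Rightarrow> (nat \<Rightarrow> nat) \<Rightarrow> bool" where
  "balanced n c \<longleftrightarrow> (\<forall>i<n. c (3 * (1 + i)) + c (3 * (1 + i) + 1) + c (3 * (1 + i) + 2) = cK n c)"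

lemma tval_entry: "tval (entry_tm i j) \<sigma> = smat (\<lambda>k. pfrac (preg \<sigma> k)) i j"
  by (simp add: entry_tm_def smat_def pfrac_def preg_def Let_def)

lemma tval_slot: "tval (slot_tm s) \<sigma> = cval (creg \<sigma>) s"
  by (simp add: slot_tm_def cval_def creg_def)

lemma tval_prev: "tval (prev_tm i) \<sigma> = yreg \<sigma> i"
  by (simp add: prev_tm_def yreg_def)

lemma tval_shift:
  "tval (shift_tm i l) \<sigma> = smat (\<lambda>k. pfrac (preg \<sigma> k)) i l - cmu (creg \<sigma>) * (if i = l then 1 else 0)"
  by (simp add: shift_tm_def tval_entry tval_slot)

lemma tval_cert:
  "tval (cert_tm n i l) \<sigma> = cert n (\<lambda>k. pfrac (preg \<sigma> k)) (\<sigma> (rg 1 0)) (cmu (creg \<sigma>)) (cR n (creg \<sigma>)) (cU n (creg \<sigma>)) i l"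
proof -
  have "real (1 - (1 - (a - r))) = (if r < a then 1 else 0)" for a r :: nat by auto
  then show ?thesis
    by (simp add: cert_tm_def cert_def tval_TSum tval_shift tval_slot del: of_nat_diff of_nat_diff_real)
qed

lemma tval_rho: "tval (rho_tm n) \<sigma> = rho n (cR n (creg \<sigma>))"
  by (simp add: rho_tm_def rho_def tval_TSum tval_slot)

lemma tval_resid: "tval (resid_tm n i) \<sigma> = resid n (\<lambda>k. pfrac (preg \<sigma> k)) (cmu (creg \<sigma>)) (cv (creg \<sigma>)) i"
  by (simp add: resid_tm_def resid_def tval_TSum tval_slot tval_shift)

lemma tval_bulk: "tval (bulk_tm n) \<sigma> = bulk n (cv (creg \<sigma>))"
  by (simp add: bulk_tm_def bulk_def tval_TSum tval_slot)

lemma tval_eps: "tval (eps_tm n) \<sigma> = 1 / (real (cE n (creg \<sigma>)) + 1)"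
  by (simp add: eps_tm_def frac_def creg_def)

lemma eval_Times_nz: "eval (Times e f) \<sigma> \<noteq> 0 \<longleftrightarrow> eval e \<sigma> \<noteq> 0 \<and> eval f \<sigma> \<noteq> 0"
  by simp

lemma eval_both: "eval (both f) \<sigma> \<noteq> 0 \<longleftrightarrow> (\<forall>s\<in>{TNat (C 1), Neg (TNat (C 1))}. eval (f s) \<sigma> \<noteq> 0)"
  by (simp add: both_def)

lemma eval_test:
  assumes n: "n \<ge> 1"
  shows "eval (test n) \<sigma> \<noteq> 0 \<longleftrightarrow>
    accept n (\<lambda>k. pfrac (preg \<sigma> k)) (\<lambda>k. pweight (preg \<sigma> k)) (\<sigma> (rg 1 0)) (\<sigma> (rg 2 0)) (yreg \<sigma>)
      (cmu (creg \<sigma>)) (cv (creg \<sigma>)) (cR n (creg \<sigma>)) (cU n (creg \<sigma>)) (cE n (creg \<sigma>)) \<and> balanced n (creg \<sigma>)"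
proof -
  have n4: "frac (Suc 0) 0 (4 * n - Suc 0) = 1 / (4 * real n)" using n by (simp add: frac_def)
  have w: "eval (Minus (C 1) (Minus (Plus (V (rg 4 (3 * slots n))) (C 1)) (V (rg 12 k)))) \<sigma> \<noteq> 0 \<longleftrightarrow>
     Suc (cE n (creg \<sigma>)) \<le> pweight (preg \<sigma> k)" for k
    by (auto simp: creg_def pweight_def preg_def)
  have b: "eval (Eq (Plus (Plus (V (rg 4 (3 * (1 + i)))) (V (rg 4 (3 * (1 + i) + 1)))) (V (rg 4 (3 * (1 + i) + 2))))
        (V (rg 4 (3 * slots n + 1)))) \<sigma> \<noteq> 0 \<longleftrightarrow>
     creg \<sigma> (3 * (1 + i)) + creg \<sigma> (3 * (1 + i) + 1) + creg \<sigma> (3 * (1 + i) + 2) = cK n (creg \<sigma>)" for i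
    unfolding eval_Eq by (simp add: creg_def)
  show ?thesis
    unfolding test_def eval_Times_nz eval_both eval_Conj eval_Le w b tval.simps(2-4) tval_cert tval_rho tval_resid tval_bulk
      tval_eps tval_slot tval_prev tval_TSum accept_def balanced_def
    by (simp add: n4 add.commute[of 1])
qed

section \<open>Writing an accepted vector\<close>

definition outb :: "ex \<Rightarrow> com" where
  "outb e = Cond e (Out True) ;; Cond (Minus (C 1) e) (Out False)"

lemma exec_outb: "exec X (outb e) (\<sigma>, \<pi>, w) = (\<sigma>, \<pi>, w @ [eval e \<sigma> \<noteq> 0])"
  by (simp add: outb_def exec_Cond)

definition Neq :: "ex \<Rightarrow> ex \<Rightarrow> ex" where
  "Neq e f = Plus (Minus e f) (Minus f e)"

text \<open>Bit \<open>s\<close> of the block \<open>1^a 0 1^b 0 1^c 0\<close> where \<open>a + b + c\<close> is the common sum of the triples.\<close>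

definition cbit :: "nat \<Rightarrow> (nat \<Rightarrow> nat) \<Rightarrow> nat \<Rightarrow> nat \<Rightarrow> bool" where
  "cbit n c s i \<longleftrightarrow> s \<noteq> c (3 * (1 + i)) \<and> s \<noteq> c (3 * (1 + i)) + c (3 * (1 + i) + 1) + 1 \<and> s \<noteq> cK n c + 2"

definition bit_ex :: "nat \<Rightarrow> nat \<Rightarrow> ex" where
  "bit_ex n i = Times (Neq (V (rg 15 0)) (V (rg 4 (3 * (1 + i)))))
     (Times (Neq (V (rg 15 0)) (Plus (Plus (V (rg 4 (3 * (1 + i)))) (V (rg 4 (3 * (1 + i) + 1)))) (C 1)))
       (Neq (V (rg 15 0)) (Plus (V (rg 4 (3 * slots n + 1))) (C 2))))"

lemma eval_bit_ex: "eval (bit_ex n i) \<sigma> \<noteq> 0 \<longleftrightarrow> cbit n (creg \<sigma>) (\<sigma> (rg 15 0)) i"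
  by (auto simp: bit_ex_def cbit_def creg_def Neq_def)

definition ocode :: "nat \<Rightarrow> com" where
  "ocode n = (rg 15 0 :=: C 0) ;; For (Plus (V (rg 4 (3 * slots n + 1))) (C 3))
     (seqs (map (\<lambda>i. outb (bit_ex n i)) [0..<n]) ;; (rg 15 0 :=: Plus (V (rg 15 0)) (C 1)))"

definition block :: "nat \<Rightarrow> (nat \<Rightarrow> nat) \<Rightarrow> bool list" where
  "block n c = concat (map (\<lambda>s. map (cbit n c s) [0..<n]) [0..<cK n c + 3])"

lemma exec_ocode:
  "\<exists>\<sigma>'. exec X (ocode n) (\<sigma>, \<pi>, w) = (\<sigma>', \<pi>, w @ block n (creg \<sigma>)) \<and> (\<forall>k j. k \<noteq> 15 \<longrightarrow> \<sigma>' (rg k j) = \<sigma> (rg k j))"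
proof -
  define row where "row = seqs (map (\<lambda>i. outb (bit_ex n i)) [0..<n]) ;; (rg 15 0 :=: Plus (V (rg 15 0)) (C 1))"
  have row: "exec X row (\<tau>, \<pi>, v) = (\<tau>(rg 15 0 := Suc (\<tau> (rg 15 0))), \<pi>, v @ map (cbit n (creg \<tau>) (\<tau> (rg 15 0))) [0..<n])" for \<tau> v
  proof -
    have "exec X (seqs (map (\<lambda>i. outb (bit_ex n i)) [0..<m])) (\<tau>, \<pi>, v) = (\<tau>, \<pi>, v @ map (cbit n (creg \<tau>) (\<tau> (rg 15 0))) [0..<m])" for m
      by (induction m) (simp_all add: exec_seqs_append exec_outb eval_bit_ex[unfolded neq0_conv] )
    then show ?thesis by (simp add: row_def)
  qed
  have iter: "\<exists>\<sigma>'. (exec X row ^^ m) (\<sigma>(rg 15 0 := 0), \<pi>, w) = (\<sigma>', \<pi>, w @ concat (map (\<lambda>s. map (cbit n (creg \<sigma>) s) [0..<n]) [0..<m]))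
      \<and> \<sigma>' (rg 15 0) = m \<and> (\<forall>k j. k \<noteq> 15 \<longrightarrow> \<sigma>' (rg k j) = \<sigma> (rg k j))" for m
  proof (induction m)
    case (Suc m)
    then obtain \<sigma>1 where 1: "(exec X row ^^ m) (\<sigma>(rg 15 0 := 0), \<pi>, w) = (\<sigma>1, \<pi>, w @ concat (map (\<lambda>s. map (cbit n (creg \<sigma>) s) [0..<n]) [0..<m]))"
      "\<sigma>1 (rg 15 0) = m" "\<forall>k j. k \<noteq> 15 \<longrightarrow> \<sigma>1 (rg k j) = \<sigma> (rg k j)" by blast
    have "creg \<sigma>1 = creg \<sigma>" using 1(3) by (simp add: creg_def fun_eq_iff)
    moreover define \<tau> where "\<tau> = \<sigma>1(rg 15 0 := Suc m)"
    moreover have "\<tau> (rg 15 0) = Suc m" "\<forall>k j. k \<noteq> 15 \<longrightarrow> \<tau> (rg k j) = \<sigma> (rg k j)"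
      using 1(3) by (simp_all add: \<tau>_def)
    ultimately show ?case using 1(1,2) row[of \<sigma>1] by (intro exI[of _ \<tau>] conjI) (simp_all del: fun_upd_apply)
  qed simp
  have run: "exec X (ocode n) (\<sigma>, \<pi>, w) = (exec X row ^^ (cK n (creg \<sigma>) + 3)) (\<sigma>(rg 15 0 := 0), \<pi>, w)"
    by (simp add: ocode_def row_def creg_def)
  show ?thesis unfolding run block_def using iter[of "cK n (creg \<sigma>) + 3"] by blast
qed

text \<open>The offset 3 skips the triple of \<open>mu\<close>; the vector just written becomes the
  predecessor for the next test.\<close>

definition commit :: "nat \<Rightarrow> com" where
  "commit n = ocode n ;; seqs (map (\<lambda>i. rg 13 i :=: V (rg 4 (3 + i))) [0..<3 * n]) ;;
     (rg 2 0 :=: Plus (Times (C 2) (V (rg 2 0))) (Minus (C 1) (V (rg 2 0))))"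

lemma exec_commit:
  "\<exists>\<sigma>'. exec X (commit n) (\<sigma>, \<pi>, w) = (\<sigma>', \<pi>, w @ block n (creg \<sigma>)) \<and>
     \<sigma>' (rg 2 0) = 2 * \<sigma> (rg 2 0) + (1 - \<sigma> (rg 2 0)) \<and> (\<forall>i<n. yreg \<sigma>' i = cv (creg \<sigma>) i) \<and>
     (\<forall>k j. k \<notin> {2, 13, 15} \<longrightarrow> \<sigma>' (rg k j) = \<sigma> (rg k j))"
proof -
  obtain \<sigma>1 where 1: "exec X (ocode n) (\<sigma>, \<pi>, w) = (\<sigma>1, \<pi>, w @ block n (creg \<sigma>))"
    "\<forall>k j. k \<noteq> 15 \<longrightarrow> \<sigma>1 (rg k j) = \<sigma> (rg k j)" using exec_ocode by blast
  have "\<exists>\<sigma>2. exec X (seqs (map (\<lambda>i. rg 13 i :=: V (rg 4 (3 + i))) [0..<m])) (\<sigma>1, \<pi>, v) = (\<sigma>2, \<pi>, v) \<and>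
      (\<forall>i<m. \<sigma>2 (rg 13 i) = \<sigma>1 (rg 4 (3 + i))) \<and> (\<forall>k j. k \<noteq> 13 \<longrightarrow> \<sigma>2 (rg k j) = \<sigma>1 (rg k j))" for m v
  proof (induction m)
    case (Suc m)
    then obtain \<sigma>2 where 2: "exec X (seqs (map (\<lambda>i. rg 13 i :=: V (rg 4 (3 + i))) [0..<m])) (\<sigma>1, \<pi>, v) = (\<sigma>2, \<pi>, v)"
      "\<forall>i<m. \<sigma>2 (rg 13 i) = \<sigma>1 (rg 4 (3 + i))" "\<forall>k j. k \<noteq> 13 \<longrightarrow> \<sigma>2 (rg k j) = \<sigma>1 (rg k j)" by blast
    define \<tau> where "\<tau> = \<sigma>2(rg 13 m := \<sigma>1 (rg 4 (3 + m)))"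
    have "exec X (rg 13 m :=: V (rg 4 (3 + m))) (\<sigma>2, \<pi>, v) = (\<tau>, \<pi>, v)" using 2(3) by (simp add: \<tau>_def)
    moreover have "\<forall>i<Suc m. \<tau> (rg 13 i) = \<sigma>1 (rg 4 (3 + i))" "\<forall>k j. k \<noteq> 13 \<longrightarrow> \<tau> (rg k j) = \<sigma>1 (rg k j)"
      using 2(2,3) by (simp_all add: \<tau>_def less_Suc_eq)
    ultimately show ?case unfolding exec_seqs_upt_Suc 2(1) by blast
  qed simp
  then obtain \<sigma>2 where 2: "exec X (seqs (map (\<lambda>i. rg 13 i :=: V (rg 4 (3 + i))) [0..<3 * n])) (\<sigma>1, \<pi>, w @ block n (creg \<sigma>)) = (\<sigma>2, \<pi>, w @ block n (creg \<sigma>))"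
      "\<forall>i<3 * n. \<sigma>2 (rg 13 i) = \<sigma>1 (rg 4 (3 + i))" "\<forall>k j. k \<noteq> 13 \<longrightarrow> \<sigma>2 (rg k j) = \<sigma>1 (rg k j)" by blast
  define \<sigma>3 where "\<sigma>3 = \<sigma>2(rg 2 0 := 2 * \<sigma>2 (rg 2 0) + (1 - \<sigma>2 (rg 2 0)))"
  have "exec X (commit n) (\<sigma>, \<pi>, w) = (\<sigma>3, \<pi>, w @ block n (creg \<sigma>))"
    unfolding commit_def exec.simps(3) 1(1) 2(1) by (simp add: \<sigma>3_def)
  moreover have "\<sigma>3 (rg 2 0) = 2 * \<sigma> (rg 2 0) + (1 - \<sigma> (rg 2 0))" using 1(2) 2(3) by (simp add: \<sigma>3_def)
  moreover have "yreg \<sigma>3 i = cv (creg \<sigma>) i" if "i < n" for i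
  proof -
    have "3 * i < 3 * n" "3 * i + 1 < 3 * n" "3 * i + 2 < 3 * n" using that by auto
    then show ?thesis using 1(2) 2(2) by (simp add: \<sigma>3_def yreg_def cval_def creg_def algebra_simps)
  qed
  moreover have "\<sigma>3 (rg k j) = \<sigma> (rg k j)" if "k \<notin> {2, 13, 15}" for k j
    using that 1(2) 2(3) by (simp add: \<sigma>3_def)
  ultimately show ?thesis by blast
qed

text \<open>The candidate of round \<open>t\<close> is given by the first component of
  \<open>prod_decode t\<close>, so every candidate returns infinitely often, with more input read
  each time. One advice symbol is read per round; the blanks after its end add 0.\<close>

definition prepare :: "nat \<Rightarrow> com" where
  "prepare n = (rU :=: V (rg 0 0)) ;; ucode ;; (rU :=: V rX) ;; dcode (3 * slots n + 2) ;;
     (rg 0 0 :=: Plus (V (rg 0 0)) (C 1)) ;; Read True (rg 1 0) ;; rcode (n * (n + 1) div 2)"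

lemma exec_prepare:
  fixes n :: nat
  defines "d \<equiv> n * (n + 1) div 2"
  shows "\<exists>\<sigma>'. exec X (prepare n) (\<sigma>, \<pi>, w) = (\<sigma>', \<pi>(False := \<pi> False + d, True := Suc (\<pi> True)), w) \<and>
     (\<forall>r<3 * slots n + 2. creg \<sigma>' r = cand (fst (prod_decode (\<sigma> (rg 0 0)))) r) \<and>
     (\<forall>r\<ge>3 * slots n + 2. creg \<sigma>' r = creg \<sigma> r) \<and> \<sigma>' (rg 0 0) = Suc (\<sigma> (rg 0 0)) \<and>
     \<sigma>' (rg 1 0) = \<sigma> (rg 1 0) + (if X True (\<pi> True) = Some True then 1 else 0) \<and>
     (\<forall>i<d. preg \<sigma>' i = pstep (preg \<sigma> i) (X False (\<pi> False + i) = Some True)) \<and>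
     \<sigma>' (rg 2 0) = \<sigma> (rg 2 0) \<and> yreg \<sigma>' = yreg \<sigma>"
proof -
  define R where "R = 3 * slots n + 2"
  define \<sigma>0 where "\<sigma>0 = \<sigma>(rU := \<sigma> (rg 0 0))"
  obtain \<sigma>1 where 1: "exec X ucode (\<sigma>0, \<pi>, w) = (\<sigma>1, \<pi>, w)" "(\<sigma>1 rX, \<sigma>1 rY) = prod_decode (\<sigma>0 rU)"
    "\<forall>r. r \<notin> {rX, rY, rZ} \<longrightarrow> \<sigma>1 r = \<sigma>0 r" using exec_ucode by blast
  define \<sigma>2 where "\<sigma>2 = \<sigma>1(rU := \<sigma>1 rX)"
  obtain \<sigma>3 where 3: "exec X (dcode R) (\<sigma>2, \<pi>, w) = (\<sigma>3, \<pi>, w)" "\<forall>r<R. \<sigma>3 (rg 4 r) = cand (\<sigma>2 rU) r"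
     "\<forall>k j. k \<noteq> 3 \<and> (k \<noteq> 4 \<or> R \<le> j) \<longrightarrow> \<sigma>3 (rg k j) = \<sigma>2 (rg k j)"
    using exec_dcode[of X R \<sigma>2 \<pi> w] by (elim exE conjE) (rule that)
  define \<sigma>4 where "\<sigma>4 = \<sigma>3(rg 0 0 := Suc (\<sigma>3 (rg 0 0)))"
  define \<sigma>5 where "\<sigma>5 = \<sigma>4(rg 1 0 := \<sigma>4 (rg 1 0) + (if X True (\<pi> True) = Some True then 1 else 0))"
  define \<pi>5 where "\<pi>5 = \<pi>(True := Suc (\<pi> True))"
  obtain \<sigma>6 where 6: "exec X (rcode d) (\<sigma>5, \<pi>5, w) = (\<sigma>6, \<pi>5(False := \<pi>5 False + d), w)"
     "\<forall>i<d. preg \<sigma>6 i = pstep (preg \<sigma>5 i) (X False (\<pi>5 False + i) = Some True)"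
     "\<forall>k j. (k \<notin> {5..12} \<or> d \<le> j) \<and> k \<noteq> 14 \<longrightarrow> \<sigma>6 (rg k j) = \<sigma>5 (rg k j)"
    using exec_rcode[of X d \<sigma>5 \<pi>5 w] by (elim exE conjE) (rule that)
  have "exec X (rU :=: V (rg 0 0)) (\<sigma>, \<pi>, w) = (\<sigma>0, \<pi>, w)" by (simp add: \<sigma>0_def)
  moreover have "exec X (rU :=: V rX) (\<sigma>1, \<pi>, w) = (\<sigma>2, \<pi>, w)" by (simp add: \<sigma>2_def)
  moreover have "exec X (rg 0 0 :=: Plus (V (rg 0 0)) (C 1)) (\<sigma>3, \<pi>, w) = (\<sigma>4, \<pi>, w)" by (simp add: \<sigma>4_def)
  moreover have "exec X (Read True (rg 1 0)) (\<sigma>4, \<pi>, w) = (\<sigma>5, \<pi>5, w)" by (simp add: \<sigma>5_def \<pi>5_def)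
  ultimately have ex: "exec X (prepare n) (\<sigma>, \<pi>, w) = (\<sigma>6, \<pi>5(False := \<pi>5 False + d), w)"
    unfolding prepare_def exec.simps(3) R_def[symmetric] d_def[symmetric] by (simp only: 1(1) 3(1) 6(1))
  have pi: "\<pi>5(False := \<pi>5 False + d) = \<pi>(False := \<pi> False + d, True := Suc (\<pi> True))"
    by (auto simp: \<pi>5_def fun_eq_iff)
  have f1: "\<sigma>1 (rg k j) = \<sigma> (rg k j)" if "k \<noteq> 3" for k j
    using 1(3) that by (simp add: \<sigma>0_def r_defs)
  have f2: "\<sigma>2 (rg k j) = \<sigma> (rg k j)" if "k \<noteq> 3" for k j
    using f1[OF that] that by (simp add: \<sigma>2_def r_defs)
  have f5: "\<sigma>5 (rg k j) = \<sigma>3 (rg k j)" if "k \<noteq> 0" "k \<noteq> 1" for k j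
    using that by (simp add: \<sigma>4_def \<sigma>5_def)
  have f3: "\<sigma>3 (rg k j) = \<sigma> (rg k j)" if "k \<noteq> 3 \<and> (k \<noteq> 4 \<or> R \<le> j)" for k j
    using 3(3)[rule_format, OF that] f2 that by simp
  have u: "\<sigma>2 rU = fst (prod_decode (\<sigma> (rg 0 0)))"
  proof -
    have "\<sigma>1 rX = fst (prod_decode (\<sigma>0 rU))" using 1(2) by (metis fst_conv)
    then show ?thesis by (simp add: \<sigma>2_def \<sigma>0_def)
  qed
  have f6: "\<sigma>6 (rg k j) = \<sigma>5 (rg k j)" if "k \<notin> {5..12}" "k \<noteq> 14" for k j using 6(3) that by blast
  have "creg \<sigma>6 r = cand (fst (prod_decode (\<sigma> (rg 0 0)))) r" if "r < R" for r
    using 3(2) that u by (simp add: creg_def f6 f5)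
  moreover have "creg \<sigma>6 r = creg \<sigma> r" if "r \<ge> R" for r
    using that by (simp add: creg_def f6 f5 f3)
  moreover have "\<sigma>6 (rg 0 0) = Suc (\<sigma> (rg 0 0))"
    by (simp add: f6) (simp add: \<sigma>5_def \<sigma>4_def f3)
  moreover have "\<sigma>6 (rg 1 0) = \<sigma> (rg 1 0) + (if X True (\<pi> True) = Some True then 1 else 0)"
    by (simp add: f6) (simp add: \<sigma>5_def \<sigma>4_def f3)
  moreover have "preg \<sigma>6 i = pstep (preg \<sigma> i) (X False (\<pi> False + i) = Some True)" if "i < d" for i
  proof -
    have "preg \<sigma>5 i = preg \<sigma> i" by (simp add: preg_def f5 f3)
    then show ?thesis using 6(2) that by (simp add: \<pi>5_def)
  qed
  moreover have "\<sigma>6 (rg 2 0) = \<sigma> (rg 2 0)" by (simp add: f6 f5 f3)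
  moreover have "yreg \<sigma>6 = yreg \<sigma>" by (simp add: fun_eq_iff yreg_def f6 f5 f3)
  ultimately show ?thesis using ex unfolding pi R_def[symmetric] by blast
qed

definition body :: "nat \<Rightarrow> com" where
  "body n = prepare n ;; Cond (test n) (commit n)"

definition component :: "nat \<Rightarrow> (nat \<Rightarrow> bool) \<Rightarrow> nat \<Rightarrow> nat \<Rightarrow> bool" where
  "component d p i k = p (d * k + i)"

definition candidate :: "nat \<Rightarrow> nat \<Rightarrow> nat \<Rightarrow> nat" where
  "candidate n z r = (if r < 3 * slots n + 2 then cand z r else 0)"

text \<open>Acceptance in round \<open>t\<close>, freed from registers: after \<open>Suc t\<close>
  reads the advice register holds \<open>min (Suc t) q\<close>.\<close>

definition good :: "nat \<Rightarrow> (nat \<Rightarrow> bool) \<Rightarrow> nat \<Rightarrow> nat \<Rightarrow> nat \<Rightarrow> (nat \<Rightarrow> real) \<Rightarrow> bool" where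
  "good n p q t P y = (let c = candidate n (fst (prod_decode t)); s = (\<lambda>k. parse (component (n * (n + 1) div 2) p k) (Suc t)) in
     accept n (\<lambda>k. pfrac (s k)) (\<lambda>k. pweight (s k)) (min (Suc t) q) P y (cmu c) (cv c) (cR n c) (cU n c) (cE n c) \<and> balanced n c)"

lemma accept_cong:
  assumes "\<And>k. k < n * (n + 1) div 2 \<Longrightarrow> a k = a' k" "\<And>k. k < n * (n + 1) div 2 \<Longrightarrow> W k = W' k"
  shows "accept n a W kk P y mu v R U E \<longleftrightarrow> accept n a' W' kk P y mu v R U E"
proof -
  have s: "smat a i j = smat a' i j" if "i < n" "j < n" for i j
    using that upper_index_less[of "min i j" "max i j" n] assms(1) by (simp add: smat_def)
  have "cert n a kk mu R U i l = cert n a' kk mu R U i l" if "i < n" "l < n" for i l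
    using s that by (simp add: cert_def)
  moreover have "resid n a mu v i = resid n a' mu v i" if "i < n" for i
    using s that by (simp add: resid_def)
  ultimately show ?thesis using assms(2) unfolding accept_def by simp
qed

text \<open>The program is reduced to three sequences, so that its correctness can be argued without
  machine states.\<close>

lemma program_run:
  fixes p :: "nat \<Rightarrow> bool" and q :: nat
  assumes n: "n \<ge> 1"
  defines "X \<equiv> (\<lambda>b. if b then word_tape (replicate q True) else omega_tape p)"
  shows "\<exists>P Y out. P 0 = 0 \<and> out 0 = [] \<and> (\<forall>t. snd (snd ((exec X (body n) ^^ t) pinit)) = out t) \<and>
    (\<forall>t. if good n p q t (P t) (Y t)
      then P (Suc t) = 2 * P t + (1 - P t) \<and> (\<forall>i<n. Y (Suc t) i = cv (candidate n (fst (prod_decode t))) i) \<and>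
        out (Suc t) = out t @ block n (candidate n (fst (prod_decode t)))
      else P (Suc t) = P t \<and> Y (Suc t) = Y t \<and> out (Suc t) = out t)"
proof -
  define d where "d = n * (n + 1) div 2"
  define R where "R = 3 * slots n + 2"
  define st where "st t = (exec X (body n) ^^ t) pinit" for t
  define invar :: "nat \<Rightarrow> pstate \<Rightarrow> bool" where "invar t s \<longleftrightarrow> (\<exists>\<sigma> \<pi> w. s = (\<sigma>, \<pi>, w) \<and> \<sigma> (rg 0 0) = t \<and> \<sigma> (rg 1 0) = min t q \<and> (\<forall>r\<ge>R. creg \<sigma> r = 0) \<and>
     (\<forall>i<d. preg \<sigma> i = parse (component d p i) t) \<and> \<pi> False = d * t \<and> \<pi> True = t)" for t s
  define P where "P t = fst (st t) (rg 2 0)" for t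
  define Y where "Y t = yreg (fst (st t))" for t
  define out where "out t = snd (snd (st t))" for t
  have step: "invar (Suc t) (st (Suc t)) \<and> (if good n p q t (P t) (Y t)
      then P (Suc t) = 2 * P t + (1 - P t) \<and> (\<forall>i<n. Y (Suc t) i = cv (candidate n (fst (prod_decode t))) i) \<and>
        out (Suc t) = out t @ block n (candidate n (fst (prod_decode t)))
      else P (Suc t) = P t \<and> Y (Suc t) = Y t \<and> out (Suc t) = out t)" if invar: "invar t (st t)" for t
  proof -
    define c where "c = candidate n (fst (prod_decode t))"
    obtain \<sigma> \<pi> w where s: "st t = (\<sigma>, \<pi>, w)" "\<sigma> (rg 0 0) = t" "\<sigma> (rg 1 0) = min t q" "\<forall>r\<ge>R. creg \<sigma> r = 0"
      "\<forall>i<d. preg \<sigma> i = parse (component d p i) t" "\<pi> False = d * t" "\<pi> True = t"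
      using invar unfolding invar_def by (elim exE conjE) (rule that)
    define \<pi>' where "\<pi>' = \<pi>(False := \<pi> False + d, True := Suc (\<pi> True))"
    obtain \<sigma>' where m: "exec X (prepare n) (\<sigma>, \<pi>, w) = (\<sigma>', \<pi>', w)"
     "\<forall>r<R. creg \<sigma>' r = cand (fst (prod_decode (\<sigma> (rg 0 0)))) r"
     "\<forall>r\<ge>R. creg \<sigma>' r = creg \<sigma> r" "\<sigma>' (rg 0 0) = Suc (\<sigma> (rg 0 0))"
     "\<sigma>' (rg 1 0) = \<sigma> (rg 1 0) + (if X True (\<pi> True) = Some True then 1 else 0)"
     "\<forall>i<d. preg \<sigma>' i = pstep (preg \<sigma> i) (X False (\<pi> False + i) = Some True)"
     "\<sigma>' (rg 2 0) = \<sigma> (rg 2 0)" "yreg \<sigma>' = yreg \<sigma>"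
      using exec_prepare[of X n \<sigma> \<pi> w] unfolding d_def[symmetric] R_def[symmetric] \<pi>'_def[symmetric]
      by (elim exE conjE) (rule that)
    have kk: "\<sigma>' (rg 1 0) = min (Suc t) q"
      unfolding m(5) s(3) s(7) by (auto simp: X_def word_tape_def)
    have pr: "preg \<sigma>' i = parse (component d p i) (Suc t)" if "i < d" for i
      using m(6) s(5,6) that by (simp add: X_def omega_tape_def component_def)
    have acc: "eval (test n) \<sigma>' \<noteq> 0 \<longleftrightarrow>
      accept n (\<lambda>k. pfrac (parse (component d p k) (Suc t))) (\<lambda>k. pweight (parse (component d p k) (Suc t))) (min (Suc t) q) (P t) (Y t)
        (cmu (creg \<sigma>')) (cv (creg \<sigma>')) (cR n (creg \<sigma>')) (cU n (creg \<sigma>')) (cE n (creg \<sigma>')) \<and> balanced n (creg \<sigma>')"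
      unfolding eval_test[OF n] kk m(7,8) P_def Y_def s(1) fst_conv
      by (intro arg_cong2[where f = "(\<and>)"] accept_cong refl) (simp_all only: pr d_def)
    have cr: "creg \<sigma>' = c"
      using m(2,3) s(2,4) by (auto simp: c_def candidate_def R_def fun_eq_iff)
    have gd: "good n p q t (P t) (Y t) \<longleftrightarrow> eval (test n) \<sigma>' \<noteq> 0"
      unfolding good_def Let_def acc cr by (simp add: c_def d_def)
    have invar': "invar (Suc t) (\<sigma>'', \<pi>', v)" if "\<forall>k j. k \<notin> {2, 13, 15} \<longrightarrow> \<sigma>'' (rg k j) = \<sigma>' (rg k j)" for \<sigma>'' v
      unfolding invar_def
    proof (intro exI conjI)
      show "(\<sigma>'', \<pi>', v) = (\<sigma>'', \<pi>', v)" ..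
      show "\<sigma>'' (rg 0 0) = Suc t" "\<sigma>'' (rg 1 0) = min (Suc t) q" using that m(4) s(2) kk by simp_all
      show "\<forall>r\<ge>R. creg \<sigma>'' r = 0" using that m(3) s(4) by (simp add: creg_def)
      show "\<forall>i<d. preg \<sigma>'' i = parse (component d p i) (Suc t)" using that pr by (simp add: preg_def)
      show "\<pi>' False = d * Suc t" "\<pi>' True = Suc t" using s(6,7) by (simp_all add: \<pi>'_def)
    qed
    have stS: "st (Suc t) = (if eval (test n) \<sigma>' = 0 then (\<sigma>', \<pi>', w) else exec X (commit n) (\<sigma>', \<pi>', w))"
      using s(1) m(1) by (simp add: st_def body_def exec_Cond)
    show ?thesis
    proof (cases "eval (test n) \<sigma>' = 0")
      case True
      then show ?thesis
        using gd invar'[of \<sigma>' w] stS m(7,8) s(1) by (simp add: P_def Y_def out_def)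
    next
      case False
      obtain \<sigma>'' where f: "exec X (commit n) (\<sigma>', \<pi>', w) = (\<sigma>'', \<pi>', w @ block n c)"
        "\<sigma>'' (rg 2 0) = 2 * \<sigma>' (rg 2 0) + (1 - \<sigma>' (rg 2 0))" "\<forall>i<n. yreg \<sigma>'' i = cv c i"
        "\<forall>k j. k \<notin> {2, 13, 15} \<longrightarrow> \<sigma>'' (rg k j) = \<sigma>' (rg k j)"
        using exec_commit[of X n \<sigma>' \<pi>' w] unfolding cr by (elim exE conjE) (rule that)
      have st': "st (Suc t) = (\<sigma>'', \<pi>', w @ block n c)" using stS False f(1) by simp
      show ?thesis
        using False gd invar'[OF f(4)] f(2,3) m(7) s(1) by (simp add: P_def Y_def out_def st' c_def)
    qed
  qed
  have st0: "st 0 = pinit" by (simp add: st_def)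
  have "invar t (st t)" for t
  proof (induction t)
    case 0
    then show ?case unfolding invar_def st0 by (simp add: creg_def preg_def)
  qed (use step in blast)
  then have "if good n p q t (P t) (Y t)
      then P (Suc t) = 2 * P t + (1 - P t) \<and> (\<forall>i<n. Y (Suc t) i = cv (candidate n (fst (prod_decode t))) i) \<and>
        out (Suc t) = out t @ block n (candidate n (fst (prod_decode t)))
      else P (Suc t) = P t \<and> Y (Suc t) = Y t \<and> out (Suc t) = out t" for t
    using step by blast
  moreover have "P 0 = 0" "out 0 = []" by (simp_all add: P_def out_def st0)
  moreover have "snd (snd ((exec X (body n) ^^ t) pinit)) = out t" for t by (simp add: out_def st_def)
  ultimately show ?thesis by blast
qed

section \<open>Correctness of the program\<close>

lemma tracked_cong:
  assumes "\<And>i. i < n \<Longrightarrow> y i = y' i"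
  shows "tracked n A lam kk P y \<longleftrightarrow> tracked n A lam kk P y'"
  using assms by (simp add: tracked_def cong: conj_cong)

lemma map_upt_rounds:
  "map Q [0..<n * (N + k)] = map Q [0..<n * N] @ concat (map (\<lambda>s. map (\<lambda>i. Q (n * (N + s) + i)) [0..<n]) [0..<k])"
proof (induction k)
  case (Suc k)
  have "[0..<n * (N + Suc k)] = [0..<n * (N + k)] @ [n * (N + k)..<n * (N + k) + n]"
    using upt_add_eq_append[of 0 "n * (N + k)" n] by (simp add: add.commute)
  also have "[n * (N + k)..<n * (N + k) + n] = map (\<lambda>i. n * (N + k) + i) [0..<n]"
    using map_add_upt[of "n * (N + k)" n] by (simp add: add.commute)
  finally show ?case using Suc by (simp add: comp_def)
qed simp

lemma block_bit:
  fixes u :: "nat \<Rightarrow> nat" and k :: nat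
  assumes "encodes p u"
  defines "L \<equiv> length (enc u k)"
  assumes "s < u k + u (k + 1) + u (k + 2) + 3"
  shows "p (L + s) \<longleftrightarrow> s \<noteq> u k \<and> s \<noteq> u k + u (k + 1) + 1 \<and> s \<noteq> u k + u (k + 1) + u (k + 2) + 2"
proof -
  have L: "length (enc u (k + 1)) = L + u k + 1" "length (enc u (k + 2)) = L + u k + u (k + 1) + 2"
    by (simp_all add: enc_Suc L_def)
  consider "s < u k" | "s = u k" | j where "j < u (k + 1)" "s = u k + 1 + j" | "s = u k + u (k + 1) + 1"
    | j where "j < u (k + 2)" "s = u k + u (k + 1) + 2 + j" | "s = u k + u (k + 1) + u (k + 2) + 2"
  proof -
    assume a: "s < u k \<Longrightarrow> thesis" "s = u k \<Longrightarrow> thesis" "\<And>j. j < u (k + 1) \<Longrightarrow> s = u k + 1 + j \<Longrightarrow> thesis"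
      "s = u k + u (k + 1) + 1 \<Longrightarrow> thesis" "\<And>j. j < u (k + 2) \<Longrightarrow> s = u k + u (k + 1) + 2 + j \<Longrightarrow> thesis"
      "s = u k + u (k + 1) + u (k + 2) + 2 \<Longrightarrow> thesis"
    show thesis
    proof (cases "s \<le> u k + u (k + 1) + 1")
      case True
      then show ?thesis using a(1,2,4) a(3)[of "s - (u k + 1)"] by linarith
    next
      case False
      then show ?thesis using a(6) a(5)[of "s - (u k + u (k + 1) + 2)"] assms(3) by linarith
    qed
  qed
  then show ?thesis
  proof cases
    case 1
    then show ?thesis using encodes_block(1)[OF assms(1), of s k] by (simp add: L_def)
  next
    case 2
    then show ?thesis using encodes_block(2)[OF assms(1), of k] by (simp add: L_def)
  next
    case 3
    then show ?thesis using encodes_block(1)[OF assms(1), of j "k + 1"] unfolding L by (simp add: add_ac)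
  next
    case 4
    then show ?thesis using encodes_block(2)[OF assms(1), of "k + 1"] unfolding L by (simp add: add_ac)
  next
    case 5
    then show ?thesis using encodes_block(1)[OF assms(1), of j "k + 2"] unfolding L by (simp add: add_ac)
  next
    case 6
    then show ?thesis using encodes_block(2)[OF assms(1), of "k + 2"] unfolding L by (simp add: add_ac)
  qed
qed

text \<open>Unary for the largest size of a group that has no room for two eigenvalues of
  multiplicity at least \<open>2 ^ j\<close>.\<close>

definition advice :: "nat \<Rightarrow> bool list" where
  "advice j = replicate (2 ^ Suc j - 1) True"

definition advised :: "(nat \<Rightarrow> bool) \<Rightarrow> nat \<Rightarrow> bool \<Rightarrow> nat \<Rightarrow> symbol" where
  "advised p j b = (if b then word_tape (advice j) else omega_tape p)"

text \<open>Safety is the invariant \<open>tr\<close>, liveness the recurrence \<open>live\<close>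
  of accepted rounds. The accepted vectors converge to an eigenvector with error at most
  \<open>1 / 2 ^ m\<close>, so the blocks written for them concatenate to a name of it.\<close>

theorem program_correct:
  fixes n :: nat and A :: "nat \<Rightarrow> real"
  defines "d \<equiv> n * (n + 1) div 2"
  assumes n: "n \<ge> 1" and A: "A \<in> topspace (Euclidean_space d)"
    and e: "eigenbasis n (smat A) b lam"
    and mult: "\<And>i. i < n \<Longrightarrow> 2 ^ j \<le> card {i'. i' < n \<and> lam i' = lam i}"
    and small: "\<exists>i<n. card {i'. i' < n \<and> lam i' = lam i} < 2 ^ Suc j"
    and name: "cauchy_rep_pow d p A"
  shows "\<exists>Q. prints (advised p j) (body n) Q \<and> (\<exists>w\<in>EVec n A. cauchy_rep_pow n Q w)"
proof -
  define q :: nat where "q = 2 ^ Suc j - 1"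
  define X where "X = (\<lambda>b. if b then word_tape (replicate q True) else omega_tape p)"
  have X: "advised p j = X" unfolding X_def q_def advised_def[abs_def] advice_def by (rule refl)
  have q: "q < 2 * 2 ^ j" by (simp add: q_def)
  define cd where "cd t = candidate n (fst (prod_decode t))" for t
  obtain P Y out where run0: "P 0 = 0" "out 0 = []" and out: "\<forall>t. snd (snd ((exec X (body n) ^^ t) pinit)) = out t"
    and run: "\<forall>t. if good n p q t (P t) (Y t)
      then P (Suc t) = 2 * P t + (1 - P t) \<and> (\<forall>i<n. Y (Suc t) i = cv (cd t) i) \<and> out (Suc t) = out t @ block n (cd t)
      else P (Suc t) = P t \<and> Y (Suc t) = Y t \<and> out (Suc t) = out t"
    using program_run[OF n, of q p] unfolding X_def[symmetric] cd_def[symmetric] by (elim exE conjE) (rule that)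
  define g where "g t \<longleftrightarrow> good n p q t (P t) (Y t)" for t
  have g1: "P (Suc t) = 2 * P t + (1 - P t)" "\<And>i. i < n \<Longrightarrow> Y (Suc t) i = cv (cd t) i" "out (Suc t) = out t @ block n (cd t)"
    if "g t" for t using run[rule_format, of t] that by (simp_all add: g_def)
  have g0: "P (Suc t) = P t" "Y (Suc t) = Y t" "out (Suc t) = out t" if "\<not> g t" for t
    using run[rule_format, of t] that by (simp_all add: g_def)
  define a where "a t k = pfrac (parse (component d p k) (Suc t))" for t k
  define W where "W t k = pweight (parse (component d p k) (Suc t))" for t k
  have nm: "cauchy_rep (component d p k) (A k)" if "k < d" for k
    using name that by (simp add: cauchy_rep_pow_def component_def[abs_def])
  have near: "\<forall>k<n * (n + 1) div 2. \<bar>a t k - A k\<bar> * real (W t k) \<le> 1" for t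
    unfolding a_def W_def d_def[symmetric] using parse_approx(1)[OF nm] by blast
  have gA: "g t \<longleftrightarrow> accept n (a t) (W t) (min (Suc t) q) (P t) (Y t) (cmu (cd t)) (cv (cd t)) (cR n (cd t)) (cU n (cd t)) (cE n (cd t)) \<and> balanced n (cd t)" for t
    unfolding g_def good_def Let_def cd_def a_def[abs_def] W_def[abs_def] d_def by (rule refl)
  have tr: "tracked n A lam q (P t) (Y t)" for t
  proof (induction t)
    case 0
    then show ?case by (simp add: tracked_def run0)
  next
    case (Suc t)
    show ?case
    proof (cases "g t")
      case True
      have "tracked n A lam q (2 * P t + (1 - P t)) (cv (cd t))"
      proof (rule accept_tracked[OF n e mult _ _ _ near Suc])
        show "accept n (a t) (W t) (min (Suc t) q) (P t) (Y t) (cmu (cd t)) (cv (cd t)) (cR n (cd t)) (cU n (cd t)) (cE n (cd t))"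
          using gA True by blast
      qed (use q in auto)
      then show ?thesis using g1(1,2)[OF True] tracked_cong[of n "Y (Suc t)" "cv (cd t)"] by simp
    qed (simp add: g0 Suc)
  qed
  have const: "P t' = P t \<and> Y t' = Y t \<and> out t' = out t" if "t \<le> t'" "\<And>s. t \<le> s \<Longrightarrow> s < t' \<Longrightarrow> \<not> g s" for t t'
    using that
  proof (induction t' rule: dec_induct)
    case (step m)
    then show ?case using g0[of m] by auto
  qed simp
  \<comment> \<open>Without further acceptance \<open>P\<close> and \<open>Y\<close> are frozen. The
    candidate that exists for these frozen values is tried again in a later round, when the whole
    advice and enough input have been read.\<close>
  have live: "\<exists>t\<ge>t0. g t" for t0
  proof (rule ccontr)
    assume no: "\<not> ?thesis"
    have "\<exists>i0<n. card {i. i < n \<and> lam i = lam i0} \<le> q" using small by (auto simp: q_def)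
    from accepting_candidate[OF n e tr[of t0] this] obtain c where
      c: "\<forall>r\<ge>3 * slots n + 2. c r = 0"
      "\<forall>i<n. c (3 * (1 + i)) + c (3 * (1 + i) + 1) + c (3 * (1 + i) + 2) = cK n c"
      "\<forall>a W. (\<forall>k<n * (n + 1) div 2. \<bar>a k - A k\<bar> * real (W k) \<le> 1 \<and> Suc (cE n c) \<le> W k) \<longrightarrow>
         accept n a W q (P t0) (Y t0) (cmu c) (cv c) (cR n c) (cU n c) (cE n c)"
      by (elim exE conjE) (rule that)
    obtain z where z: "cand z = c" using cand_surj[of "3 * slots n + 2" c] c(1) by blast
    have cz: "candidate n z = c" using c(1) by (auto simp: candidate_def z fun_eq_iff)
    have "\<forall>k. \<exists>T. k < d \<longrightarrow> (\<forall>t\<ge>T. Suc (cE n c) \<le> pweight (parse (component d p k) t))"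
      using parse_approx(2)[OF nm] by blast
    then obtain T where T: "\<And>k t. k < d \<Longrightarrow> T k \<le> t \<Longrightarrow> Suc (cE n c) \<le> pweight (parse (component d p k) t)"
      by metis
    \<comment> \<open>The first component selects the candidate; the second pushes the round beyond
      \<open>t0\<close>, beyond the end of the advice and beyond the times at which the entries are
      precise enough.\<close>
    define t where "t = prod_encode (z, t0 + q + (\<Sum>k<d. T k))"
    have t: "t0 + q + (\<Sum>k<d. T k) \<le> t" unfolding t_def by (rule le_prod_encode_2)
    have "T k \<le> Suc t" if "k < d" for k
    proof -
      have "T k \<le> (\<Sum>k<d. T k)" using that by (intro member_le_sum) auto
      then show ?thesis using t by linarith
    qed
    then have W: "Suc (cE n c) \<le> W t k" if "k < d" for k using T[OF that] that unfolding W_def by blast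
    have PY: "P t = P t0 \<and> Y t = Y t0" using const[of t0 t] no t by (meson add_leE)
    have "cd t = c" by (simp add: cd_def t_def cz)
    moreover have "min (Suc t) q = q" using t by simp
    moreover have "accept n (a t) (W t) q (P t0) (Y t0) (cmu c) (cv c) (cR n c) (cU n c) (cE n c)"
      using c(3) near[of t] W unfolding d_def by blast
    moreover have "balanced n c" using c(2) by (simp add: balanced_def)
    ultimately have "g t" unfolding gA using PY by simp
    then show False using no t by (meson add_leE)
  qed
  define S where "S = {t. g t}"
  have inf: "infinite S" unfolding infinite_nat_iff_unbounded_le S_def using live by auto
  define \<tau> where "\<tau> m = enumerate S m" for m
  have \<tau>g: "g (\<tau> m)" for m using enumerate_in_set[OF inf, of m] by (simp add: \<tau>_def S_def)
  define c where "c m = cd (\<tau> m)" for m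
  have first: "P (\<tau> 0) = 0" "out (\<tau> 0) = []"
  proof -
    have "\<not> g s" if "s < \<tau> 0" for s using not_less_Least[of s "\<lambda>n. n \<in> S"] that by (auto simp: \<tau>_def enumerate_0 S_def)
    then show "P (\<tau> 0) = 0" "out (\<tau> 0) = []" using const[of 0 "\<tau> 0"] run0 by auto
  qed
  have nxt: "P (\<tau> (Suc m)) = 2 * P (\<tau> m) + (1 - P (\<tau> m))" "\<And>i. i < n \<Longrightarrow> Y (\<tau> (Suc m)) i = cv (c m) i"
     "out (\<tau> (Suc m)) = out (\<tau> m) @ block n (c m)" for m
  proof -
    have "\<tau> (Suc m) = (LEAST s. s \<in> S \<and> \<tau> m < s)" unfolding \<tau>_def by (rule enumerate_Suc''[OF inf])
    then have "\<not> g s" if "Suc (\<tau> m) \<le> s" "s < \<tau> (Suc m)" for s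
      using not_less_Least[of s "\<lambda>s. s \<in> S \<and> \<tau> m < s"] that by (simp add: S_def Suc_le_eq)
    moreover have "Suc (\<tau> m) \<le> \<tau> (Suc m)" using enumerate_step[OF inf, of m] by (simp add: \<tau>_def)
    ultimately have "P (\<tau> (Suc m)) = P (Suc (\<tau> m)) \<and> Y (\<tau> (Suc m)) = Y (Suc (\<tau> m)) \<and> out (\<tau> (Suc m)) = out (Suc (\<tau> m))"
      by (intro const) auto
    then show "P (\<tau> (Suc m)) = 2 * P (\<tau> m) + (1 - P (\<tau> m))" "\<And>i. i < n \<Longrightarrow> Y (\<tau> (Suc m)) i = cv (c m) i"
     "out (\<tau> (Suc m)) = out (\<tau> m) @ block n (c m)" using g1[OF \<tau>g] by (simp_all add: c_def)
  qed
  \<comment> \<open>The exponent lags by one: the first accepted round only turns \<open>P\<close>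
    from 0 into 1.\<close>
  have P: "P (\<tau> (Suc m)) = 2 ^ m" for m by (induction m) (simp_all add: nxt first)
  have acc: "accept n (a (\<tau> m)) (W (\<tau> m)) (min (Suc (\<tau> m)) q) (P (\<tau> m)) (Y (\<tau> m)) (cmu (c m)) (cv (c m)) (cR n (c m)) (cU n (c m)) (cE n (c m))"
    and bal: "balanced n (c m)" for m using \<tau>g[of m] unfolding gA c_def by blast+
  note ex = accept_exact[OF n acc near]
  have "\<exists>w\<in>EVec n A. \<forall>m. \<forall>i<n. \<bar>w i - cv (c m) i\<bar> \<le> 1 / 2 ^ m"
  proof (rule limit_eigenvector[where mu = "\<lambda>m. cmu (c m)"])
    show "A \<in> topspace (Euclidean_space (n * (n + 1) div 2))" using A by (simp add: d_def)
    show "4 * 2 ^ m * \<bar>cv (c (Suc m)) i - cv (c m) i\<bar> \<le> 1" if "i < n" for m i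
      using ex(3)[OF that, of "Suc m"] nxt(2)[OF that, of m] by (simp add: P)
    show "\<exists>i<n. 1 \<le> \<bar>cv (c 0) i\<bar>" using ex(4)[of 0] first(1) by (intro sum_squares_entry[OF n]) simp
    show "\<bar>resid n A (cmu (c m)) (cv (c m)) i\<bar> \<le> 2 / 2 ^ m" if i: "i < n" for m i
    proof -
      let ?r = "\<bar>resid n A (cmu (c m)) (cv (c m)) i\<bar>" and ?\<rho> = "rho n (cR n (c m))"
      have "1 \<le> ?\<rho>"
      proof -
        have "1 \<le> real n * real n" using n mult_mono[of 1 "real n" 1 "real n"] by simp
        also have "\<dots> = (\<Sum>i<n. \<Sum>m<n. 1)" by simp
        also have "\<dots> \<le> ?\<rho>" unfolding rho_def by (intro sum_mono) simp
        finally show ?thesis .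
      qed
      moreover have "1 \<le> real n ^ 3" using n by (intro one_le_power) simp
      then have "1 \<le> 128 * real n ^ 3" by linarith
      ultimately have "1 * 1 \<le> 128 * real n ^ 3 * ?\<rho>" by (intro mult_mono) auto
      then have "(real (P (\<tau> m)) + 1) * ?r * 1 \<le> (real (P (\<tau> m)) + 1) * ?r * (128 * real n ^ 3 * ?\<rho>)"
        by (intro mult_left_mono) auto
      also have "\<dots> \<le> 1" using ex(2)[OF i, of m] by (simp add: mult_ac)
      finally have r: "(real (P (\<tau> m)) + 1) * ?r \<le> 1" by simp
      \<comment> \<open>\<open>P\<close> is 0 for \<open>m = 0\<close> and
        \<open>2 ^ (m - 1)\<close> afterwards; the 2 in the residual bound absorbs both.\<close>
      have "2 ^ m / 2 \<le> real (P (\<tau> m)) + 1"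
      proof (cases m)
        case (Suc m')
        then show ?thesis by (simp add: P)
      qed (simp add: first)
      then have "2 ^ m / 2 * ?r \<le> (real (P (\<tau> m)) + 1) * ?r" by (intro mult_right_mono) auto
      then have "2 ^ m / 2 * ?r \<le> 1" using r by linarith
      then show ?thesis by (simp add: field_simps)
    qed
  qed
  then obtain w where w: "w \<in> EVec n A" "\<And>m i. i < n \<Longrightarrow> \<bar>w i - cv (c m) i\<bar> \<le> 1 / 2 ^ m" by blast
  \<comment> \<open>The name of component \<open>i\<close> lists the triples of this component from
    all accepted candidates.\<close>
  define u where "u i k = c (k div 3) (3 * (1 + i) + k mod 3)" for i k
  have u: "u i (3 * m) = c m (3 * (1 + i))" "u i (3 * m + 1) = c m (3 * (1 + i) + 1)" "u i (3 * m + 2) = c m (3 * (1 + i) + 2)" for i m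
  proof -
    have "(3 * m + 2) mod 3 = 2" "(3 * m + 2) div 3 = m" "(3 * m + 1) mod 3 = 1" "(3 * m + 1) div 3 = m" by presburger+
    then show "u i (3 * m) = c m (3 * (1 + i))" "u i (3 * m + 1) = c m (3 * (1 + i) + 1)" "u i (3 * m + 2) = c m (3 * (1 + i) + 2)"
      by (simp_all add: u_def)
  qed
  define pp where "pp i = (SOME p. encodes p (u i))" for i
  have pp: "encodes (pp i) (u i)" for i unfolding pp_def by (rule someI_ex[OF encodes_exists])
  define Q where "Q x = pp (x mod n) (x div n)" for x
  \<comment> \<open>Symbols written per component for the first \<open>m\<close> accepted vectors;
    \<open>balanced\<close> makes this number the same for all components.\<close>
  define N where "N m = (\<Sum>k<m. cK n (c k) + 3)" for m
  have sumK: "u i (3 * m) + u i (3 * m + 1) + u i (3 * m + 2) = cK n (c m)" if "i < n" for i m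
    unfolding u using bal[of m] that by (simp add: balanced_def)
  have len: "length (enc (u i) (3 * m)) = N m" if "i < n" for i m
  proof (induction m)
    case (Suc m)
    have *: "3 * Suc m = Suc (Suc (Suc (3 * m)))" by simp
    have "length (enc (u i) (3 * Suc m)) = length (enc (u i) (3 * m)) + (u i (3 * m) + u i (3 * m + 1) + u i (3 * m + 2)) + 3"
      unfolding * enc_Suc by simp
    then show ?case unfolding Suc sumK[OF that] by (simp add: N_def)
  qed (simp add: N_def)
  have bit: "Q (n * (N m + s) + i) = cbit n (c m) s i" if "i < n" "s < cK n (c m) + 3" for m s i
  proof -
    have "Q (n * (N m + s) + i) = pp i (N m + s)" using that(1) by (simp add: Q_def)
    also have "\<dots> = cbit n (c m) s i"
      using block_bit[OF pp[of i], of s "3 * m"] that(2) sumK[OF that(1), of m] bal[of m] that(1)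
      unfolding len[OF that(1)] u cbit_def by (simp add: balanced_def)
    finally show ?thesis .
  qed
  have outQ: "out (\<tau> m) = map Q [0..<n * N m]" for m
  proof (induction m)
    case (Suc m)
    have "block n (c m) = concat (map (\<lambda>s. map (\<lambda>i. Q (n * (N m + s) + i)) [0..<n]) [0..<cK n (c m) + 3])"
      unfolding block_def by (intro arg_cong[where f = concat] map_cong refl) (simp add: bit)
    then show ?case unfolding nxt(3) Suc using map_upt_rounds[of Q n "N m" "cK n (c m) + 3"] by (simp add: N_def)
  qed (simp add: first N_def)
  have "x < length (out (\<tau> (Suc x))) \<and> out (\<tau> (Suc x)) ! x = Q x" for x
  proof -
    have "m \<le> N m" for m by (induction m) (auto simp: N_def)
    from this[of "Suc x"] have "1 * Suc x \<le> n * N (Suc x)" using n by (intro mult_le_mono) auto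
    then show ?thesis unfolding outQ by simp
  qed
  moreover have "cauchy_rep_pow n Q w"
    unfolding cauchy_rep_pow_def
  proof (intro conjI allI impI)
    show "w \<in> topspace (Euclidean_space n)" using w(1) A unfolding d_def by (simp add: EVec_iff)
    fix i assume i: "i < n"
    have "(\<lambda>k. Q (n * k + i)) = pp i" using i by (auto simp: Q_def)
    moreover have "real_of_rat (rat_at (u i) m) = cv (c m) i" for m
      unfolding of_rat_rat_at u cval_def ..
    ultimately show "cauchy_rep (\<lambda>k. Q (n * k + i)) (w i)"
      unfolding cauchy_rep_def using pp[of i] w(2)[OF i] by auto
  qed
  ultimately show ?thesis
    unfolding X prints_def using out w(1) by (intro exI[of _ Q]) auto
qed

section \<open>The upper bound\<close>

text \<open>The spectrum is that of an arbitrarily chosen eigenbasis, so no invariance of multiplicities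
  is needed for the classes to be disjoint.\<close>

definition spectrum_of :: "nat \<Rightarrow> (nat \<Rightarrow> real) \<Rightarrow> nat \<Rightarrow> real" where
  "spectrum_of n a = (SOME lam. \<exists>b. eigenbasis n (smat a) b lam)"

definition min_mult :: "nat \<Rightarrow> (nat \<Rightarrow> real) \<Rightarrow> nat" where
  "min_mult n a = Min ((\<lambda>i. card {i'. i' < n \<and> spectrum_of n a i' = spectrum_of n a i}) ` {..<n})"

definition level :: "nat \<Rightarrow> (nat \<Rightarrow> real) \<Rightarrow> nat" where
  "level n a = nat \<lfloor>log 2 (real (min_mult n a))\<rfloor>"

lemma spectrum_of: "\<exists>b. eigenbasis n (smat a) b (spectrum_of n a)"
proof -
  have "\<exists>lam b. eigenbasis n (smat a) b lam" using spectral_theorem[of n "smat a"] smat_sym by blast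
  then show ?thesis unfolding spectrum_of_def by (rule someI_ex)
qed

lemma min_mult:
  assumes "n \<ge> 1"
  shows "i < n \<Longrightarrow> min_mult n a \<le> card {i'. i' < n \<and> spectrum_of n a i' = spectrum_of n a i}"
    and "\<exists>i<n. min_mult n a = card {i'. i' < n \<and> spectrum_of n a i' = spectrum_of n a i}"
    and "1 \<le> min_mult n a" "min_mult n a \<le> n"
proof -
  let ?f = "\<lambda>i. card {i'. i' < n \<and> spectrum_of n a i' = spectrum_of n a i}"
  show "min_mult n a \<le> ?f i" if "i < n" unfolding min_mult_def using that by (intro Min_le) auto
  have "Min (?f ` {..<n}) \<in> ?f ` {..<n}" using assms by (intro Min_in) (auto simp: lessThan_empty_iff)
  then show ex: "\<exists>i<n. min_mult n a = ?f i" unfolding min_mult_def by blast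
  then obtain i where i: "i < n" "min_mult n a = ?f i" by blast
  have "{i'. i' < n \<and> spectrum_of n a i' = spectrum_of n a i} \<noteq> {}" using i(1) by blast
  then have "?f i > 0" by (simp add: card_gt_0_iff)
  then show "1 \<le> min_mult n a" using i(2) by simp
  have "?f i \<le> card {..<n}" by (intro card_mono) auto
  then show "min_mult n a \<le> n" using i(2) by simp
qed

lemma level_le:
  assumes "n \<ge> 1"
  shows "level n a \<le> nat \<lfloor>log 2 (real n)\<rfloor>"
  unfolding level_def using min_mult(3,4)[OF assms, of a] by (intro nat_mono floor_mono) simp

lemma computable_at_level:
  assumes n: "n \<ge> 1" and a: "a \<in> topspace (Euclidean_space (n * (n + 1) div 2))"
    and name: "cauchy_rep_pow (n * (n + 1) div 2) p a"
  shows "\<exists>Q. prints (advised p (level n a)) (body n) Q \<and> (\<exists>w\<in>EVec n a. cauchy_rep_pow n Q w)"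
proof -
  note mm = min_mult[OF n, where a = a]
  note lv = log2_floor[OF min_mult(3)[OF n, of a], folded level_def]
  obtain b where "eigenbasis n (smat a) b (spectrum_of n a)" using spectrum_of by blast
  then show ?thesis
  proof (rule program_correct[OF n a _ _ _ name])
    show "2 ^ level n a \<le> card {i'. i' < n \<and> spectrum_of n a i' = spectrum_of n a i}" if "i < n" for i
      using lv(1) mm(1)[OF that] by linarith
    show "\<exists>i<n. card {i'. i' < n \<and> spectrum_of n a i' = spectrum_of n a i} < 2 ^ Suc (level n a)"
      using lv(2) mm(2) by metis
  qed
qed

text \<open>One machine serves all levels, since the level reaches it as a unary bound on the advice
  tape. Multiplicities are at most \<open>n\<close>, which leaves at most \<open>N + 1\<close>
  levels.\<close>

theorem C_c_EVec_le:
  assumes n: "n \<ge> 1"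
  shows "C_c (EVec n) (cauchy_rep_pow (n * (n + 1) div 2)) (cauchy_rep_pow n) \<le> enat (nat \<lfloor>log 2 (real n)\<rfloor> + 1)"
proof -
  define d where "d = n * (n + 1) div 2"
  define N where "N = nat \<lfloor>log 2 (real n)\<rfloor>"
  define D where "D j = {a \<in> topspace (Euclidean_space d). level n a = j}" for j
  \<comment> \<open>A partition has no empty member, so levels without matrices are dropped, and
    \<delta> is undefined on their words.\<close>
  define \<Delta> where "\<Delta> = D ` {..N} - {{}}"
  have inj: "advice j = advice k \<Longrightarrow> j = k" for j k
  proof -
    assume "advice j = advice k"
    then have "(2::nat) ^ Suc j - 1 = 2 ^ Suc k - 1" by (metis advice_def length_replicate)
    moreover have "(2::nat) ^ Suc j \<ge> 1" "(2::nat) ^ Suc k \<ge> 1" by simp_all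
    ultimately have "(2::nat) ^ Suc j = 2 ^ Suc k" by linarith
    then show "j = k" by simp
  qed
  define \<delta> where "\<delta> w = (if \<exists>j\<le>N. w = advice j \<and> D j \<noteq> {} then Some (D (SOME j. w = advice j)) else None)" for w
  have \<delta>_advice: "(SOME k. advice j = advice k) = j" for j using inj by (intro some_equality) auto
  have \<delta>: "\<delta> w = Some E \<longleftrightarrow> (\<exists>j\<le>N. w = advice j \<and> D j \<noteq> {} \<and> E = D j)" for w E
    unfolding \<delta>_def using \<delta>_advice by auto
  have "ran \<delta> = \<Delta>" unfolding ran_def \<delta> \<Delta>_def by auto
  have part: "partition_on (mv_dom (EVec n)) \<Delta>"
    unfolding partition_on_def mv_dom_EVec[OF n] d_def[symmetric]
  proof (intro conjI)
    show "\<Union> \<Delta> = topspace (Euclidean_space d)"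
      using level_le[OF n] by (auto simp: \<Delta>_def D_def N_def)
    show "disjoint \<Delta>" by (auto simp: \<Delta>_def D_def disjoint_def)
    show "{} \<notin> \<Delta>" by (simp add: \<Delta>_def)
  qed
  obtain M where M: "t2_wf M" "num_inputs M = 2"
    "\<And>X q. prints X (body n) q \<Longrightarrow> t2_outputs M [X False, X True] q"
    using program_computable[of "body n"] by blast
  have "computable_with_advice (EVec n) (cauchy_rep_pow d) (cauchy_rep_pow n) \<Delta>"
    unfolding computable_with_advice_def notation_of_def
  proof (intro exI[of _ \<delta>] exI[of _ M] conjI ballI allI impI)
    fix E a p w assume E: "E \<in> \<Delta>" "a \<in> E" and pw: "cauchy_rep_pow d p a \<and> \<delta> w = Some E"
    then obtain j where j: "w = advice j" "E = D j" by (auto simp: \<delta>)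
    then have a: "a \<in> topspace (Euclidean_space d)" "level n a = j" using E by (auto simp: D_def)
    from computable_at_level[OF n a(1)[unfolded d_def], of p] pw
    obtain Q where Q: "prints (advised p j) (body n) Q" "\<exists>w\<in>EVec n a. cauchy_rep_pow n Q w"
      unfolding a(2) d_def by blast
    have "t2_outputs M [omega_tape p, word_tape w] Q" using M(3)[OF Q(1)] by (simp add: advised_def j(1))
    then show "\<exists>q. t2_outputs M [omega_tape p, word_tape w] q \<and> (\<exists>b\<in>EVec n a. cauchy_rep_pow n q b)"
      using Q(2) by blast
  qed (use \<open>ran \<delta> = \<Delta>\<close> M(1) in auto)
  moreover have "countable \<Delta>" by (simp add: \<Delta>_def)
  ultimately have "C_c (EVec n) (cauchy_rep_pow d) (cauchy_rep_pow n) \<le> ecard \<Delta>"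
    unfolding C_c_def using part by (intro INF_lower) simp
  also have "\<dots> \<le> enat (N + 1)"
  proof -
    have "card \<Delta> \<le> card (D ` {..N})" unfolding \<Delta>_def by (intro card_mono) auto
    also have "\<dots> \<le> N + 1" using card_image_le[of "{..N}" D] by simp
    finally show ?thesis by (simp add: ecard_def \<Delta>_def)
  qed
  finally show ?thesis by (simp add: d_def N_def)
qed

theorem theorem4:
  fixes n :: nat
  assumes "n \<ge> 1"
  shows "C_t (Euclidean_space (n * (n + 1) div 2)) (Euclidean_space n) (EVec n)
           = C_c (EVec n) (cauchy_rep_pow (n * (n + 1) div 2)) (cauchy_rep_pow n)
       \<and> C_c (EVec n) (cauchy_rep_pow (n * (n + 1) div 2)) (cauchy_rep_pow n)
           = enat (nat \<lfloor>log 2 (real n)\<rfloor> + 1)"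
proof -
  have "n * (n + 1) div 2 \<ge> 1" using upper_index_less[of 0 0 n] assms by simp
  then have "C_t (Euclidean_space (n * (n + 1) div 2)) (Euclidean_space n) (EVec n)
      \<le> C_c (EVec n) (cauchy_rep_pow (n * (n + 1) div 2)) (cauchy_rep_pow n)"
    by (intro C_t_le_C_c) (simp_all only: mv_dom_EVec[OF assms] order.refl)
  then show ?thesis using C_t_EVec_ge[OF assms] C_c_EVec_le[OF assms] by (meson antisym order.trans)
qed

end
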